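(* Let $B$ be a barrier of a matching covered graph $G$, and let $J$ be any bicritical cubic graph. Then $G$ is $J$-free if and only if, for each component $L$ of $G-B$, the graph $G/\overline{V(L)}$ is $J$-free.
   Context: Graphs are finite and loopless; multiple edges allowed. A connected graph with at least two vertices is matching covered if every edge lies in a perfect matching. A graph $J$ is bicritical if it has a perfect matching and $J-u-v$ has a perfect matching for every pair of distinct vertices $u,v$ (so, e.g., $\theta$, two vertices joined by three parallel edges, is bicritical cubic). A barrier of a graph with a perfect matching is a set $B$ of vertices such that the number of odd components of $G-B$ equals $|B|$. For $X\subseteq V(G)$, $G/\overline{X}$ denotes the graph obtained by shrinking $V(G)-X$ to a single vertex. A subgraph $H$ of $G$ is conformal if $G-V(H)$ has a perfect matching; a bisubdivision of $J$ is obtained by replacing some edges of $J$ by paths with an even number of internal vertices; $G$ is $J$-based if it has a conformal subgraph that is a bisubdivision of $J$, and $J$-free otherwise. *)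

theory Defs
  imports Main
begin

text \<open>Undirected multigraphs: \<open>ends G e\<close> is the set of ends of the edge \<open>e\<close>, so parallel edges are
  distinct edges with the same set of ends. The value of \<open>ends G\<close> outside \<open>edges G\<close> is irrelevant.\<close>

record ('a, 'e) mgraph =
  verts :: "'a set"
  edges :: "'e set"
  ends :: "'e \<Rightarrow> 'a set"

definition finite_loopless :: "('a, 'e) mgraph \<Rightarrow> bool" where
  "finite_loopless G \<longleftrightarrow> finite (verts G) \<and> finite (edges G) \<and>
     (\<forall>e\<in>edges G. ends G e \<subseteq> verts G \<and> card (ends G e) = 2)"

definition subgraph :: "('a, 'e) mgraph \<Rightarrow> ('a, 'e) mgraph \<Rightarrow> bool" where
  "subgraph H G \<longleftrightarrow> verts H \<subseteq> verts G \<and> edges H \<subseteq> edges G \<and>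
     (\<forall>e\<in>edges H. ends H e = ends G e \<and> ends H e \<subseteq> verts H)"

definition induced :: "('a, 'e) mgraph \<Rightarrow> 'a set \<Rightarrow> ('a, 'e) mgraph" where
  "induced G X = \<lparr>verts = verts G \<inter> X, edges = {e \<in> edges G. ends G e \<subseteq> X}, ends = ends G\<rparr>"

definition delete_verts :: "('a, 'e) mgraph \<Rightarrow> 'a set \<Rightarrow> ('a, 'e) mgraph" where
  "delete_verts G X = induced G (verts G - X)"

definition degree :: "('a, 'e) mgraph \<Rightarrow> 'a \<Rightarrow> nat" where
  "degree G v = card {e \<in> edges G. v \<in> ends G e}"

definition cubic :: "('a, 'e) mgraph \<Rightarrow> bool" where
  "cubic G \<longleftrightarrow> (\<forall>v\<in>verts G. degree G v = 3)"


definition adj :: "('a, 'e) mgraph \<Rightarrow> ('a \<times> 'a) set" where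
  "adj G = {(u, v). \<exists>e\<in>edges G. ends G e = {u, v}}"

definition connected_graph :: "('a, 'e) mgraph \<Rightarrow> bool" where
  "connected_graph G \<longleftrightarrow> verts G \<noteq> {} \<and> (\<forall>u\<in>verts G. \<forall>v\<in>verts G. (u, v) \<in> (adj G)\<^sup>*)"

definition components :: "('a, 'e) mgraph \<Rightarrow> ('a, 'e) mgraph set" where
  "components G = (\<lambda>u. induced G {v. (u, v) \<in> (adj G)\<^sup>*}) ` verts G"

definition odd_components :: "('a, 'e) mgraph \<Rightarrow> ('a, 'e) mgraph set" where
  "odd_components G = {L \<in> components G. odd (card (verts L))}"


definition perfect_matching :: "('a, 'e) mgraph \<Rightarrow> 'e set \<Rightarrow> bool" where
  "perfect_matching G M \<longleftrightarrow> M \<subseteq> edges G \<and> (\<forall>v\<in>verts G. \<exists>!e. e \<in> M \<and> v \<in> ends G e)"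

definition has_perfect_matching :: "('a, 'e) mgraph \<Rightarrow> bool" where
  "has_perfect_matching G \<longleftrightarrow> (\<exists>M. perfect_matching G M)"

definition matching_covered :: "('a, 'e) mgraph \<Rightarrow> bool" where
  "matching_covered G \<longleftrightarrow> connected_graph G \<and> card (verts G) \<ge> 2 \<and>
     (\<forall>e\<in>edges G. \<exists>M. perfect_matching G M \<and> e \<in> M)"

definition bicritical :: "('a, 'e) mgraph \<Rightarrow> bool" where
  "bicritical G \<longleftrightarrow> has_perfect_matching G \<and>
     (\<forall>u\<in>verts G. \<forall>v\<in>verts G. u \<noteq> v \<longrightarrow> has_perfect_matching (delete_verts G {u, v}))"

definition barrier :: "('a, 'e) mgraph \<Rightarrow> 'a set \<Rightarrow> bool" where
  "barrier G B \<longleftrightarrow> has_perfect_matching G \<and> B \<subseteq> verts G \<and>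
     card (odd_components (delete_verts G B)) = card B"

text \<open>Shrinking \<open>Y\<close> to a single vertex, represented by \<open>None\<close>: edges with both ends in \<open>Y\<close> would
  become loops and are removed, all other edges are kept (so parallel edges may arise). If no
  vertex of \<open>G\<close> lies in \<open>Y\<close>, no new vertex is created and the result is a copy of \<open>G\<close>.\<close>

definition shrink :: "('a, 'e) mgraph \<Rightarrow> 'a set \<Rightarrow> ('a option, 'e) mgraph" where
  "shrink G Y =
     (let p = (\<lambda>v. if v \<in> Y then None else Some v)
      in \<lparr>verts = p ` verts G, edges = {e \<in> edges G. \<not> ends G e \<subseteq> Y}, ends = (\<lambda>e. p ` ends G e)\<rparr>)"


definition conformal :: "('a, 'e) mgraph \<Rightarrow> ('a, 'e) mgraph \<Rightarrow> bool" where
  "conformal H G \<longleftrightarrow> subgraph H G \<and> has_perfect_matching (delete_verts G (verts H))"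

text \<open>A path is given by its sequence of vertices together with its sequence of edges.\<close>

definition is_path :: "('a, 'e) mgraph \<Rightarrow> 'a list \<Rightarrow> 'e list \<Rightarrow> bool" where
  "is_path G vs es \<longleftrightarrow> length vs = Suc (length es) \<and> distinct vs \<and>
     set vs \<subseteq> verts G \<and> set es \<subseteq> edges G \<and>
     (\<forall>i<length es. ends G (es ! i) = {vs ! i, vs ! Suc i})"

definition internal :: "'a list \<Rightarrow> 'a list" where
  "internal vs = butlast (tl vs)"

text \<open>\<open>H\<close> is, up to isomorphism, a bisubdivision of \<open>J\<close>: \<open>f\<close> embeds the vertices of \<open>J\<close>, and the
  edge \<open>e\<close> of \<open>J\<close> is replaced by the path with vertices \<open>P e\<close> and edges \<open>Q e\<close>. An edge that is
  kept is replaced by a path without internal vertices. Disjointness of the \<open>Q e\<close> keeps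
  parallel edges of \<open>J\<close> distinct in \<open>H\<close>.\<close>

definition bisubdivision :: "('a, 'e) mgraph \<Rightarrow> ('b, 'f) mgraph \<Rightarrow> bool" where
  "bisubdivision H J \<longleftrightarrow> (\<exists>(f :: 'b \<Rightarrow> 'a) (P :: 'f \<Rightarrow> 'a list) (Q :: 'f \<Rightarrow> 'e list).
     inj_on f (verts J) \<and>
     (\<forall>e\<in>edges J. is_path H (P e) (Q e) \<and> {hd (P e), last (P e)} = f ` ends J e \<and>
        even (length (internal (P e))) \<and> set (internal (P e)) \<inter> f ` verts J = {}) \<and>
     (\<forall>e\<in>edges J. \<forall>e'\<in>edges J. e \<noteq> e' \<longrightarrow>
        set (internal (P e)) \<inter> set (internal (P e')) = {} \<and> set (Q e) \<inter> set (Q e') = {}) \<and>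
     verts H = f ` verts J \<union> (\<Union>e\<in>edges J. set (internal (P e))) \<and>
     edges H = (\<Union>e\<in>edges J. set (Q e)))"

definition based :: "('b, 'f) mgraph \<Rightarrow> ('a, 'e) mgraph \<Rightarrow> bool" where
  "based J G \<longleftrightarrow> (\<exists>H. conformal H G \<and> bisubdivision H J)"

definition free_of :: "('b, 'f) mgraph \<Rightarrow> ('a, 'e) mgraph \<Rightarrow> bool" where
  "free_of J G \<longleftrightarrow> \<not> based J G"

end

theory Submission imports Defs begin

text \<open>If \<open>B\<close> is nonempty, then all components ("blobs") of \<open>G - B\<close> are odd, there are \<open>card B\<close> of them, no
  edge joins two vertices of \<open>B\<close>, and every perfect matching has exactly one edge in the cut of each blob.

  From a blob contraction back to \<open>G\<close>: the contraction vertex has degree at most three in the bisubdivision.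
  Perfect matchings of \<open>G\<close> through the edges of the bisubdivision at that vertex restrict to
  near-perfect matchings of \<open>G - L\<close>. Alternating paths between them form an even path, respectively a
  star with three even legs, by which the contraction vertex is replaced. The barrier forces all
  junctions to lie in \<open>B\<close>, whence the parity.

  From \<open>G\<close> to a blob: unless a conformal bisubdivision \<open>H\<close> lies in a single blob, every blob that meets
  \<open>H\<close> is left by at least two edges of \<open>H\<close>, and by at least three if it separates two branch vertices,
  since \<open>J\<close> has no cut with fewer edges. On the other hand, \<open>H\<close> meets as many blobs as vertices of \<open>B\<close>, whose
  degrees in \<open>H\<close> are two, except that at most one of them, as \<open>J\<close> is bicritical, has degree three.
  So one blob \<open>L\<close> contains all branch vertices, with at most one exception in \<open>B\<close>, and shrinking the part
  of \<open>H\<close> outside \<open>L\<close> leaves a bisubdivision of \<open>J\<close>.\<close>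

subsection \<open>Perfect matchings of vertex sets\<close>

text \<open>One count is used with three choices of \<open>D\<close>. A matching that misses exactly
  \<open>D\<close> has at most \<open>card (B - D)\<close> edges at \<open>B\<close>, and by parity
  every blob with \<open>K - D\<close> odd uses up one of them. For \<open>D = {}\<close> the
  barrier equation leaves no slack. If \<open>D\<close> consists of two vertices of
  \<open>B\<close>, the count fails, so no two branch vertices lie in \<open>B\<close>. If
  \<open>D\<close> has one vertex in \<open>B\<close> and one in \<open>L\<close>, the count is
  exact again and forbids edges leaving \<open>L\<close>.

  The passage from \<open>G\<close> to a blob has a slack of one: twice the number of blobs met is
  at most the number of crossing edges, hence at most \<open>2 * card (B \<inter> U) + 1\<close>.
  Integrality closes this gap, and as a by-product the matching outside the bisubdivision leaves no
  blob that is met.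

  The recurring obstacle is the evenness of the subdivided paths: whatever replaces the contraction
  vertex, or is absorbed by it, must have the right parity.

  Shrinking keeps the names of edges, so edge lists are shared between \<open>G\<close> and its
  contractions and only the vertex \<open>None\<close> needs translation.\<close>

definition cut :: "('a, 'e) mgraph \<Rightarrow> 'a set \<Rightarrow> 'e set" where
  "cut G X = {e \<in> edges G. ends G e \<inter> X \<noteq> {} \<and> \<not> ends G e \<subseteq> X}"

text \<open>Takes the vertex set as a parameter and confines the edges to it, so that matchings of
  pieces of \<open>G\<close> can be cut out and glued without forming subgraphs.\<close>

definition pmatch :: "('a, 'e) mgraph \<Rightarrow> 'a set \<Rightarrow> 'e set \<Rightarrow> bool" where
  "pmatch G W M \<longleftrightarrow> M \<subseteq> edges G \<and> (\<forall>e\<in>M. ends G e \<subseteq> W) \<and>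
     (\<forall>v\<in>W. \<exists>!e. e \<in> M \<and> v \<in> ends G e)"

lemma finite_looplessD:
  assumes "finite_loopless G"
  shows "finite (verts G)" "finite (edges G)"
    "e \<in> edges G \<Longrightarrow> ends G e \<subseteq> verts G" "e \<in> edges G \<Longrightarrow> card (ends G e) = 2"
    "e \<in> edges G \<Longrightarrow> finite (ends G e)"
proof -
  show "finite (verts G)" "finite (edges G)"
    "e \<in> edges G \<Longrightarrow> ends G e \<subseteq> verts G" "e \<in> edges G \<Longrightarrow> card (ends G e) = 2"
    using assms by (auto simp: finite_loopless_def)
  then show "e \<in> edges G \<Longrightarrow> finite (ends G e)" by (meson finite_subset)
qed

lemma ends_cases:
  assumes "finite_loopless G" "e \<in> edges G"
  obtains u v where "ends G e = {u, v}" "u \<noteq> v" "u \<in> verts G" "v \<in> verts G"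
proof -
  have "card (ends G e) = 2" "ends G e \<subseteq> verts G"
    using finite_looplessD[OF assms(1)] assms(2) by auto
  then show thesis using that by (auto simp: card_2_iff)
qed

lemma ends_other:
  assumes "finite_loopless G" "e \<in> edges G" "u \<in> ends G e"
  obtains v where "ends G e = {u, v}" "u \<noteq> v" "v \<in> verts G"
  using ends_cases[OF assms(1,2)] assms(3) by (metis doubleton_eq_iff insertE singletonD)

lemma perfect_matching_iff_pmatch:
  assumes "finite_loopless G"
  shows "perfect_matching G M \<longleftrightarrow> pmatch G (verts G) M"
  using finite_looplessD(3)[OF assms] unfolding perfect_matching_def pmatch_def by blast

lemma perfect_matching_delete_iff_pmatch:
  "perfect_matching (delete_verts G U) M \<longleftrightarrow> pmatch G (verts G - U) M"
proof -
  have "verts (delete_verts G U) = verts G - U" "ends (delete_verts G U) = ends G"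
    "M \<subseteq> edges (delete_verts G U) \<longleftrightarrow> M \<subseteq> edges G \<and> (\<forall>e\<in>M. ends G e \<subseteq> verts G - U)"
    by (auto simp: delete_verts_def induced_def)
  then show ?thesis by (simp add: perfect_matching_def pmatch_def)
qed

lemma pmatchD:
  assumes "pmatch G W M"
  shows "M \<subseteq> edges G" "e \<in> M \<Longrightarrow> ends G e \<subseteq> W"
    "v \<in> W \<Longrightarrow> \<exists>e. e \<in> M \<and> v \<in> ends G e"
    "e \<in> M \<Longrightarrow> e' \<in> M \<Longrightarrow> v \<in> ends G e \<Longrightarrow> v \<in> ends G e' \<Longrightarrow> e = e'"
  using assms unfolding pmatch_def by blast+

lemma pmatch_empty: "pmatch G {} {}"
  by (simp add: pmatch_def)

lemma pmatch_edge: "e \<in> edges G \<Longrightarrow> pmatch G (ends G e) {e}"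
  by (auto simp: pmatch_def)

lemma pmatch_UN:
  assumes "\<And>i. i \<in> A \<Longrightarrow> pmatch G (W i) (M i)"
    and "\<And>i j. i \<in> A \<Longrightarrow> j \<in> A \<Longrightarrow> i \<noteq> j \<Longrightarrow> W i \<inter> W j = {}"
  shows "pmatch G (\<Union>i\<in>A. W i) (\<Union>i\<in>A. M i)"
  unfolding pmatch_def
proof (intro conjI ballI)
  show "(\<Union>i\<in>A. M i) \<subseteq> edges G" using pmatchD(1)[OF assms(1)] by blast
  show "ends G e \<subseteq> (\<Union>i\<in>A. W i)" if "e \<in> (\<Union>i\<in>A. M i)" for e
    using that pmatchD(2)[OF assms(1)] by blast
next
  fix v assume "v \<in> (\<Union>i\<in>A. W i)"
  then obtain i where i: "i \<in> A" "v \<in> W i" by blast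
  then obtain e where e: "e \<in> M i" "v \<in> ends G e" using pmatchD(3)[OF assms(1)] by blast
  show "\<exists>!e. e \<in> (\<Union>i\<in>A. M i) \<and> v \<in> ends G e"
  proof (rule ex1I[of _ e])
    show "e \<in> (\<Union>i\<in>A. M i) \<and> v \<in> ends G e" using e i by blast
    fix e' assume "e' \<in> (\<Union>i\<in>A. M i) \<and> v \<in> ends G e'"
    then obtain j where j: "j \<in> A" "e' \<in> M j" "v \<in> ends G e'" by blast
    then have "v \<in> W j" using pmatchD(2)[OF assms(1)] by blast
    then have "i = j" using assms(2) i j by blast
    then show "e' = e" using pmatchD(4)[OF assms(1)[OF i(1)]] e j by blast
  qed
qed

lemma pmatch_Un:
  assumes "pmatch G W M" "pmatch G W' M'" "W \<inter> W' = {}"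
  shows "pmatch G (W \<union> W') (M \<union> M')"
proof -
  have "pmatch G (\<Union>b\<in>UNIV. if b then W else W') (\<Union>b\<in>UNIV. if b then M else M')"
    by (rule pmatch_UN) (use assms in auto)
  then show ?thesis by (simp add: UNIV_bool Un_commute)
qed

lemma pmatch_restrict:
  assumes "pmatch G W M" "X \<subseteq> W" "\<And>e. e \<in> M \<Longrightarrow> ends G e \<inter> X = {} \<or> ends G e \<subseteq> X"
  shows "pmatch G X {e \<in> M. ends G e \<subseteq> X}"
  unfolding pmatch_def
proof (intro conjI ballI)
  show "{e \<in> M. ends G e \<subseteq> X} \<subseteq> edges G" using pmatchD(1)[OF assms(1)] by blast
  show "ends G e \<subseteq> X" if "e \<in> {e \<in> M. ends G e \<subseteq> X}" for e using that by blast
  fix v assume v: "v \<in> X"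
  then obtain e where e: "e \<in> M" "v \<in> ends G e" using pmatchD(3)[OF assms(1)] assms(2) by blast
  then show "\<exists>!e. e \<in> {e \<in> M. ends G e \<subseteq> X} \<and> v \<in> ends G e"
    using assms(3)[OF e(1)] pmatchD(4)[OF assms(1)] v by (intro ex1I[of _ e]) blast+
qed

lemma pmatch_remove_edge:
  assumes "pmatch G W M" "e \<in> M"
  shows "pmatch G (W - ends G e) (M - {e})"
  unfolding pmatch_def
proof (intro conjI ballI)
  show "M - {e} \<subseteq> edges G" using pmatchD(1)[OF assms(1)] by blast
  show "ends G e' \<subseteq> W - ends G e" if "e' \<in> M - {e}" for e'
    using that assms(2) pmatchD(2,4)[OF assms(1)] by blast
  fix v assume v: "v \<in> W - ends G e"
  then obtain e' where "e' \<in> M" "v \<in> ends G e'" using pmatchD(3)[OF assms(1)] by blast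
  then show "\<exists>!e'. e' \<in> M - {e} \<and> v \<in> ends G e'"
    using v pmatchD(4)[OF assms(1)] by (intro ex1I[of _ e']) blast+
qed

text \<open>Double counting: the sum equals the sum over \<open>M\<close> of
  \<open>card (ends G e \<inter> S)\<close>, which is odd exactly for the edges of the cut. Degree
  one gives the parity of matched sets, degree three the handshake for cubic graphs.\<close>

lemma incidence_parity:
  assumes G: "finite_loopless G" and M: "M \<subseteq> edges G" and S: "finite S"
  shows "even (\<Sum>v\<in>S. card {e \<in> M. v \<in> ends G e}) \<longleftrightarrow> even (card (M \<inter> cut G S))"
proof -
  have fin: "finite M" using M finite_looplessD(2)[OF G] finite_subset by blast
  have "(\<Sum>v\<in>S. card {e \<in> M. v \<in> ends G e}) = (\<Sum>e\<in>M. card (ends G e \<inter> S))"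
  proof (rule sum_multicount_gen[OF S fin], rule ballI)
    fix e show "card {v \<in> S. v \<in> ends G e} = card (ends G e \<inter> S)"
      by (rule arg_cong[where f = card]) blast
  qed
  moreover have "odd (card (ends G e \<inter> S)) \<longleftrightarrow> e \<in> cut G S" if "e \<in> M" for e
  proof -
    have e: "e \<in> edges G" using that M by blast
    obtain u v where "ends G e = {u, v}" "u \<noteq> v" using ends_cases[OF G e] by blast
    then show ?thesis using e by (auto simp: cut_def Int_insert_left)
  qed
  then have "{e \<in> M. odd (card (ends G e \<inter> S))} = M \<inter> cut G S" by blast
  ultimately show ?thesis by (simp add: even_sum_iff[OF fin])
qed

lemma pmatch_parity:
  assumes G: "finite_loopless G" and M: "pmatch G W M" and W: "finite W"
  shows "even (card (W \<inter> X)) \<longleftrightarrow> even (card (M \<inter> cut G X))"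
proof -
  have "card {e \<in> M. v \<in> ends G e} = 1" if "v \<in> W" for v
  proof -
    obtain e where "e \<in> M" "v \<in> ends G e" using pmatchD(3)[OF M \<open>v \<in> W\<close>] by blast
    then have "{e \<in> M. v \<in> ends G e} = {e}" using pmatchD(4)[OF M] by blast
    then show ?thesis by simp
  qed
  then have "(\<Sum>v\<in>W \<inter> X. card {e \<in> M. v \<in> ends G e}) = card (W \<inter> X)" by simp
  \<comment> \<open>All edges of \<open>M\<close> lie in \<open>W\<close>, so vertices of
    \<open>X\<close> outside \<open>W\<close> do not affect which of them cross.\<close>
  moreover have "M \<inter> cut G (W \<inter> X) = M \<inter> cut G X"
    using pmatchD(2)[OF M] unfolding cut_def by blast
  ultimately show ?thesis
    using incidence_parity[OF G pmatchD(1)[OF M], of "W \<inter> X"] W by simp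
qed

lemma pmatch_even:
  assumes "finite_loopless G" "pmatch G W M" "finite W"
  shows "even (card W)"
proof -
  have "M \<inter> cut G W = {}" using pmatchD(2)[OF assms(2)] by (auto simp: cut_def)
  then show ?thesis using pmatch_parity[OF assms, of W] by simp
qed

subsection \<open>Paths\<close>

lemma is_path_single [simp]: "is_path G [v] es \<longleftrightarrow> es = [] \<and> v \<in> verts G"
  by (auto simp: is_path_def)

lemma is_path_Cons:
  "is_path G (v # w # vs) (e # es) \<longleftrightarrow> v \<in> verts G \<and> e \<in> edges G \<and> ends G e = {v, w} \<and>
     v \<notin> set (w # vs) \<and> is_path G (w # vs) es"
proof -
  have 1: "(\<forall>i<length (e # es). ends G ((e # es) ! i) = {(v # w # vs) ! i, (v # w # vs) ! Suc i})
    \<longleftrightarrow> ends G e = {v, w} \<and> (\<forall>i<length es. ends G (es ! i) = {(w # vs) ! i, (w # vs) ! Suc i})"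
    by (auto simp: less_Suc_eq_0_disj)
  have 2: "length (v # w # vs) = Suc (length (e # es)) \<longleftrightarrow> length (w # vs) = Suc (length es)"
    "distinct (v # w # vs) \<longleftrightarrow> v \<notin> set (w # vs) \<and> distinct (w # vs)"
    "set (v # w # vs) \<subseteq> verts G \<longleftrightarrow> v \<in> verts G \<and> set (w # vs) \<subseteq> verts G"
    "set (e # es) \<subseteq> edges G \<longleftrightarrow> e \<in> edges G \<and> set es \<subseteq> edges G"
    by simp_all
  show ?thesis unfolding is_path_def 1 2
    by (rule iffI; elim conjE; intro conjI; assumption)
qed

lemma is_path_Nil [simp]: "\<not> is_path G [] es"
  by (simp add: is_path_def)

lemma is_path_Cons_iff:
  "is_path G (v # w # vs) es \<longleftrightarrow> (\<exists>e es'. es = e # es' \<and> v \<in> verts G \<and> e \<in> edges G \<and>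
     ends G e = {v, w} \<and> v \<notin> set (w # vs) \<and> is_path G (w # vs) es')"
proof (cases es)
  case Nil
  then show ?thesis by (simp add: is_path_def)
next
  case (Cons e es')
  then show ?thesis unfolding Cons is_path_Cons by simp
qed

lemma is_path_induct [consumes 1, case_names single Cons]:
  assumes "is_path G vs es"
    and "\<And>v. v \<in> verts G \<Longrightarrow> P [v] []"
    and "\<And>v w vs e es. is_path G (w # vs) es \<Longrightarrow> v \<in> verts G \<Longrightarrow> e \<in> edges G \<Longrightarrow> ends G e = {v, w} \<Longrightarrow>
      v \<notin> set (w # vs) \<Longrightarrow> P (w # vs) es \<Longrightarrow> P (v # w # vs) (e # es)"
  shows "P vs es"
  using assms(1)
proof (induction vs arbitrary: es rule: induct_list012)
  case (3 v w vs)
  obtain e es' where "es = e # es'" "v \<in> verts G" "e \<in> edges G" "ends G e = {v, w}"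
    "v \<notin> set (w # vs)" "is_path G (w # vs) es'" using 3(3) unfolding is_path_Cons_iff by blast
  then show ?case using assms(3) 3(2) by blast
qed (use assms(2) in auto)

lemma is_pathD:
  assumes "is_path G vs es"
  shows "vs \<noteq> []" "length vs = Suc (length es)" "distinct vs" "set vs \<subseteq> verts G" "set es \<subseteq> edges G"
  using assms by (auto simp: is_path_def)

lemma is_path_ends:
  assumes "is_path G vs es" "e \<in> set es"
  shows "ends G e \<subseteq> set vs"
  using assms by (induction rule: is_path_induct) auto

lemma is_path_append:
  assumes "is_path G vs es" "is_path G (last vs # ws) fs" "set vs \<inter> set ws = {}"
  shows "is_path G (vs @ ws) (es @ fs)"
  using assms by (induction rule: is_path_induct) (auto simp: is_path_Cons)

lemma is_path_split:
  assumes "is_path G (vs @ w # ws) es"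
  obtains es1 es2 where "es = es1 @ es2" "is_path G (vs @ [w]) es1" "is_path G (w # ws) es2"
proof -
  have "\<exists>es1 es2. es = es1 @ es2 \<and> is_path G (vs @ [w]) es1 \<and> is_path G (w # ws) es2"
    using assms
  proof (induction vs arbitrary: es rule: induct_list012)
    case 1
    then have "w \<in> verts G" using is_pathD(4) by fastforce
    then have "es = [] @ es" "is_path G ([] @ [w]) []" "is_path G (w # ws) es" using 1 by simp_all
    then show ?case by blast
  next
    case (2 v)
    then have "is_path G (v # w # ws) es" by simp
    then obtain e es' where "es = e # es'" "v \<in> verts G" "e \<in> edges G" "ends G e = {v, w}"
      "v \<notin> set (w # ws)" "is_path G (w # ws) es'" unfolding is_path_Cons_iff by blast
    moreover from this have "w \<in> verts G" using is_pathD(4) by fastforce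
    ultimately have "es = [e] @ es'" "is_path G ([v] @ [w]) [e]" "is_path G (w # ws) es'"
      by (simp_all add: is_path_Cons)
    then show ?case by blast
  next
    case (3 v v' vs)
    from 3(3) have "is_path G (v # v' # vs @ w # ws) es" by simp
    then obtain e es' where e: "es = e # es'" "v \<in> verts G" "e \<in> edges G" "ends G e = {v, v'}"
      "v \<notin> set (v' # vs @ w # ws)" "is_path G (v' # vs @ w # ws) es'" unfolding is_path_Cons_iff by blast
    with 3(2)[of es'] obtain es1 es2 where "es' = es1 @ es2"
      "is_path G (v' # vs @ [w]) es1" "is_path G (w # ws) es2" by auto
    then have "es = (e # es1) @ es2" "is_path G ((v # v' # vs) @ [w]) (e # es1)" "is_path G (w # ws) es2"
      using e by (simp_all add: is_path_Cons)
    then show ?case by blast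
  qed
  then show thesis using that by blast
qed

lemma is_path_rev:
  assumes "is_path G vs es"
  shows "is_path G (rev vs) (rev es)"
  using assms
proof (induction rule: is_path_induct)
  case (Cons v w vs e es)
  then have w: "w \<in> verts G" using is_pathD(4) by fastforce
  have "is_path G (rev (w # vs) @ [v]) (rev es @ [e])"
    by (rule is_path_append) (use Cons w in \<open>auto simp: is_path_Cons insert_commute\<close>)
  then show ?case by simp
qed auto

text \<open>A common edge would have two distinct ends on both paths, which share at most one
  vertex.\<close>

lemma is_path_edges_disjoint:
  assumes G: "finite_loopless G" and "is_path G vs es" "is_path G ws fs" "set vs \<inter> set ws \<subseteq> {w}"
  shows "set es \<inter> set fs = {}"
proof (rule ccontr)
  assume "set es \<inter> set fs \<noteq> {}"
  then obtain e where e: "e \<in> set es" "e \<in> set fs" by blast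
  then have "ends G e \<subseteq> {w}" using is_path_ends[OF assms(2)] is_path_ends[OF assms(3)] assms(4) by blast
  moreover have "e \<in> edges G" using is_pathD(5)[OF assms(2)] e by blast
  then have "card (ends G e) = 2" using finite_looplessD(4)[OF G] by blast
  ultimately show False using card_mono[of "{w}" "ends G e"] by simp
qed

fun alternate :: "bool \<Rightarrow> 'e list \<Rightarrow> 'e set" where
  "alternate b [] = {}"
| "alternate b (e # es) = (if b then {e} else {}) \<union> alternate (\<not> b) es"

text \<open>Both phases are proved together because putting an edge in front exchanges them. On a
  path with an odd number of edges, phase \<open>True\<close> covers all vertices and phase
  \<open>False\<close> exactly the internal ones: the behaviour of a subdivided edge inside and
  outside a matching.\<close>

lemma pmatch_alternate:
  assumes "is_path G vs es"
  shows "pmatch G (set vs - (if even (length es) then {last vs} else {})) (alternate True es) \<and>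
    pmatch G (set (tl vs) - (if odd (length es) then {last vs} else {})) (alternate False es)"
  using assms
proof (induction rule: is_path_induct)
  case (single v)
  then show ?case by (simp add: pmatch_empty)
next
  case (Cons v w vs e es)
  define A where "A = (if odd (length es) then {last (w # vs)} else {})"
  have tl: "pmatch G (set vs - A) (alternate False es)"
    and all: "pmatch G (set (w # vs) - (if even (length es) then {last (w # vs)} else {})) (alternate True es)"
    using Cons(6) unfolding A_def by simp_all
  have "w \<notin> set vs" using is_pathD(3)[OF Cons(1)] by simp
  have "v \<notin> A" using Cons(5) last_in_set[of "w # vs"] by (auto simp: A_def)
  moreover have "w \<notin> A"
  proof (cases "odd (length es)")
    case True
    then have "vs \<noteq> []" using is_pathD(2)[OF Cons(1)] by auto
    then show ?thesis using \<open>w \<notin> set vs\<close> last_in_set[of vs] by (auto simp: A_def)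
  qed (simp add: A_def)
  ultimately have "set (v # w # vs) - A = ends G e \<union> (set vs - A)" unfolding Cons(4) by auto
  moreover have "ends G e \<inter> (set vs - A) = {}"
    unfolding Cons(4) using Cons(5) \<open>w \<notin> set vs\<close> by auto
  ultimately have "pmatch G (set (v # w # vs) - A) ({e} \<union> alternate False es)"
    using pmatch_Un[OF pmatch_edge[OF Cons(3)] tl] by simp
  then show ?case using all unfolding A_def
    by (cases "even (length es)") (simp_all del: last.simps add: last_ConsR)
qed

lemma path_crosses_cut:
  assumes "is_path G vs es" "(hd vs \<in> X) \<noteq> (last vs \<in> X)"
  shows "\<exists>e. e \<in> set es \<and> e \<in> cut G X"
  using assms
proof (induction rule: is_path_induct)
  case (single v)
  then show ?case by simp
next
  case (Cons v w vs e es)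
  have last: "last (v # w # vs) = last (w # vs)" by simp
  show ?case
  proof (cases "(v \<in> X) = (w \<in> X)")
    case True
    then have "(hd (w # vs) \<in> X) \<noteq> (last (w # vs) \<in> X)" using Cons(7) unfolding last list.sel by blast
    from Cons(6)[OF this] show ?thesis by (metis list.set_intros(2))
  next
    case False
    then have "e \<in> cut G X" using Cons(3) by (auto simp: cut_def Cons(4))
    then show ?thesis by (metis list.set_intros(1))
  qed
qed

text \<open>The path crosses before and after \<open>w\<close>, and the two pieces share only
  \<open>w\<close>, hence no edge.\<close>

lemma path_crosses_cut_twice:
  assumes G: "finite_loopless G" and p: "is_path G (xs @ w # ys) es"
    and X: "(hd (xs @ [w]) \<in> X) \<noteq> (w \<in> X)" "(last (w # ys) \<in> X) \<noteq> (w \<in> X)"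
  shows "\<exists>e e'. e \<noteq> e' \<and> {e, e'} \<subseteq> set es \<inter> cut G X"
proof -
  obtain es1 es2 where es: "es = es1 @ es2" "is_path G (xs @ [w]) es1" "is_path G (w # ys) es2"
    using is_path_split[OF p] .
  obtain e where e: "e \<in> set es1" "e \<in> cut G X"
    using path_crosses_cut[OF es(2), of X] X(1) by (metis last_snoc)
  obtain e' where e': "e' \<in> set es2" "e' \<in> cut G X"
    using path_crosses_cut[OF es(3), of X] X(2) by (metis list.sel(1))
  have "set (xs @ [w]) \<inter> set (w # ys) \<subseteq> {w}" using is_pathD(3)[OF p] by auto
  then have "set es1 \<inter> set es2 = {}" using is_path_edges_disjoint[OF G es(2,3)] by blast
  then have "e \<noteq> e'" using e e' by blast
  moreover have "{e, e'} \<subseteq> set es \<inter> cut G X" using e e' es(1) by auto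
  ultimately show ?thesis by blast
qed

subsection \<open>Oriented models of bisubdivisions\<close>

text \<open>Subdivided paths need a first and a last vertex although \<open>J\<close> is undirected.
  The choice is kept as separate data so that it can be changed when a branch vertex should start
  all its paths.\<close>

definition orientation :: "('b, 'f) mgraph \<Rightarrow> ('f \<Rightarrow> 'b) \<Rightarrow> ('f \<Rightarrow> 'b) \<Rightarrow> bool" where
  "orientation J s t \<longleftrightarrow> (\<forall>e\<in>edges J. ends J e = {s e, t e})"

text \<open>The witnesses of \<open>bisubdivision\<close>, with only internal vertices stored per
  edge. No subgraph is carried along: its vertex set is \<open>model_verts\<close>, and the matching
  condition of conformality concerns only the complement of that set.\<close>

definition model :: "('a, 'e) mgraph \<Rightarrow> ('b, 'f) mgraph \<Rightarrow> ('f \<Rightarrow> 'b) \<Rightarrow> ('f \<Rightarrow> 'b) \<Rightarrow>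
    ('b \<Rightarrow> 'a) \<Rightarrow> ('f \<Rightarrow> 'a list) \<Rightarrow> ('f \<Rightarrow> 'e list) \<Rightarrow> bool" where
  "model G J s t f I Q \<longleftrightarrow> inj_on f (verts J) \<and> f ` verts J \<subseteq> verts G \<and>
     (\<forall>e\<in>edges J. is_path G (f (s e) # I e @ [f (t e)]) (Q e) \<and> even (length (I e)) \<and>
        set (I e) \<inter> f ` verts J = {}) \<and>
     (\<forall>e\<in>edges J. \<forall>e'\<in>edges J. e \<noteq> e' \<longrightarrow>
        set (I e) \<inter> set (I e') = {} \<and> set (Q e) \<inter> set (Q e') = {})"

definition model_verts :: "('b, 'f) mgraph \<Rightarrow> ('b \<Rightarrow> 'a) \<Rightarrow> ('f \<Rightarrow> 'a list) \<Rightarrow> 'a set" where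
  "model_verts J f I = f ` verts J \<union> (\<Union>e\<in>edges J. set (I e))"

lemma modelD:
  assumes "model G J s t f I Q"
  shows "inj_on f (verts J)" "f ` verts J \<subseteq> verts G"
    "e \<in> edges J \<Longrightarrow> is_path G (f (s e) # I e @ [f (t e)]) (Q e)"
    "e \<in> edges J \<Longrightarrow> even (length (I e))"
    "e \<in> edges J \<Longrightarrow> set (I e) \<inter> f ` verts J = {}"
    "e \<in> edges J \<Longrightarrow> e' \<in> edges J \<Longrightarrow> e \<noteq> e' \<Longrightarrow> set (I e) \<inter> set (I e') = {}"
    "e \<in> edges J \<Longrightarrow> e' \<in> edges J \<Longrightarrow> e \<noteq> e' \<Longrightarrow> set (Q e) \<inter> set (Q e') = {}"
  using assms unfolding model_def by blast+

lemma orientationD: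
  assumes "finite_loopless J" "orientation J s t" "e \<in> edges J"
  shows "ends J e = {s e, t e}" "s e \<in> verts J" "t e \<in> verts J" "s e \<noteq> t e"
proof -
  show *: "ends J e = {s e, t e}" using assms by (simp add: orientation_def)
  show "s e \<in> verts J" "t e \<in> verts J" using finite_looplessD(3)[OF assms(1,3)] * by auto
  show "s e \<noteq> t e" using finite_looplessD(4)[OF assms(1,3)] * by auto
qed

lemma orientation_from:
  assumes "finite_loopless J"
  obtains s t where "orientation J s t" "\<And>e. e \<in> edges J \<Longrightarrow> z \<in> ends J e \<Longrightarrow> s e = z"
proof -
  have "\<exists>p. ends J e = {fst p, snd p} \<and> (z \<in> ends J e \<longrightarrow> fst p = z)" if "e \<in> edges J" for e
  proof -
    obtain u v where "ends J e = {u, v}" using ends_cases[OF assms \<open>e \<in> edges J\<close>] by blast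
    then show ?thesis
      by (intro exI[of _ "if z = v then (v, u) else (u, v)"]) auto
  qed
  then have "\<forall>e\<in>edges J. \<exists>p. ends J e = {fst p, snd p} \<and> (z \<in> ends J e \<longrightarrow> fst p = z)" by blast
  from bchoice[OF this] obtain p where p:
    "\<forall>e\<in>edges J. ends J e = {fst (p e), snd (p e)} \<and> (z \<in> ends J e \<longrightarrow> fst (p e) = z)" ..
  show thesis
  proof (rule that)
    show "orientation J (\<lambda>e. fst (p e)) (\<lambda>e. snd (p e))" using p by (simp add: orientation_def)
    show "fst (p e) = z" if "e \<in> edges J" "z \<in> ends J e" for e using p that by blast
  qed
qed

lemma path_decomp:
  assumes "2 \<le> length vs"
  shows "vs = hd vs # internal vs @ [last vs]"
proof -
  obtain v ws where vs: "vs = v # ws" "1 \<le> length ws"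
    using assms by (metis Suc_le_length_iff numeral_2_eq_2 One_nat_def)
  then have "ws \<noteq> []" by auto
  then show ?thesis using append_butlast_last_id[of ws] vs by (simp add: internal_def)
qed

lemma internal_eq [simp]: "internal (u # xs @ [v]) = xs"
  by (simp add: internal_def)

text \<open>Paths are reversed where the orientations disagree. The vertex set is unchanged, so a
  matching of the complement can be reused.\<close>

lemma model_reorient:
  assumes J: "finite_loopless J" and o: "orientation J s t" "orientation J s' t'"
    and m: "model G J s t f I Q"
  obtains I' Q' where "model G J s' t' f I' Q'" "model_verts J f I' = model_verts J f I"
proof -
  define I' where "I' e = (if s' e = s e then I e else rev (I e))" for e
  define Q' where "Q' e = (if s' e = s e then Q e else rev (Q e))" for e
  have [simp]: "set (I' e) = set (I e)" "set (Q' e) = set (Q e)" "length (I' e) = length (I e)" for e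
    by (auto simp: I'_def Q'_def)
  have "is_path G (f (s' e) # I' e @ [f (t' e)]) (Q' e)" if e: "e \<in> edges J" for e
  proof (cases "s' e = s e")
    case True
    then have "t' e = t e" using orientationD(1,4)[OF J _ e] o by (metis doubleton_eq_iff)
    then show ?thesis using modelD(3)[OF m e] True by (simp add: I'_def Q'_def)
  next
    case False
    then have "s' e = t e" "t' e = s e" using orientationD(1)[OF J _ e] o by (metis doubleton_eq_iff)+
    then show ?thesis using is_path_rev[OF modelD(3)[OF m e]] False by (simp add: I'_def Q'_def)
  qed
  then have "model G J s' t' f I' Q'" using m by (simp add: model_def)
  moreover have "model_verts J f I' = model_verts J f I" by (simp add: model_verts_def)
  ultimately show thesis using that by blast
qed

lemma model_path_verts:
  assumes "finite_loopless J" "orientation J s t" "e \<in> edges J"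
  shows "set (f (s e) # I e @ [f (t e)]) \<subseteq> model_verts J f I"
  using orientationD(2,3)[OF assms] assms(3) by (auto simp: model_verts_def)

lemma model_edge_ends:
  assumes "finite_loopless J" "orientation J s t" "e \<in> edges J" "model G J s t f I Q" "q \<in> set (Q e)"
  shows "ends G q \<subseteq> model_verts J f I"
  by (rule subset_trans[OF is_path_ends[OF modelD(3)[OF assms(4,3)] assms(5)] model_path_verts[where f = f and I = I, OF assms(1-3)]])

lemma model_verts_subset:
  assumes "model G J s t f I Q"
  shows "model_verts J f I \<subseteq> verts G"
proof
  fix x assume "x \<in> model_verts J f I"
  then consider "x \<in> f ` verts J" | e where "e \<in> edges J" "x \<in> set (I e)"
    unfolding model_verts_def by blast
  then show "x \<in> verts G"
  proof cases
    case 1 then show ?thesis using modelD(2)[OF assms] by blast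
  next
    case 2 then show ?thesis using is_pathD(4)[OF modelD(3)[OF assms 2(1)]] by auto
  qed
qed

lemma based_iff_model:
  assumes J: "finite_loopless J" and o: "orientation J s t"
  shows "based J G \<longleftrightarrow> (\<exists>f I Q. model G J s t f I Q \<and> (\<exists>M. pmatch G (verts G - model_verts J f I) M))"
proof
  assume "based J G"
  then obtain H where H: "conformal H G" "bisubdivision H J" by (auto simp: based_def)
  from H(2)[unfolded bisubdivision_def] obtain f P Q where *: "inj_on f (verts J) \<and>
     (\<forall>e\<in>edges J. is_path H (P e) (Q e) \<and> {hd (P e), last (P e)} = f ` ends J e \<and>
        even (length (internal (P e))) \<and> set (internal (P e)) \<inter> f ` verts J = {}) \<and>
     (\<forall>e\<in>edges J. \<forall>e'\<in>edges J. e \<noteq> e' \<longrightarrow>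
        set (internal (P e)) \<inter> set (internal (P e')) = {} \<and> set (Q e) \<inter> set (Q e') = {}) \<and>
     verts H = f ` verts J \<union> (\<Union>e\<in>edges J. set (internal (P e))) \<and>
     edges H = (\<Union>e\<in>edges J. set (Q e))" by (elim exE)
  have f: "inj_on f (verts J)"
    and P: "\<And>e. e \<in> edges J \<Longrightarrow> is_path H (P e) (Q e)"
      "\<And>e. e \<in> edges J \<Longrightarrow> {hd (P e), last (P e)} = f ` ends J e"
      "\<And>e. e \<in> edges J \<Longrightarrow> even (length (internal (P e)))"
      "\<And>e. e \<in> edges J \<Longrightarrow> set (internal (P e)) \<inter> f ` verts J = {}"
    and disj: "\<forall>e\<in>edges J. \<forall>e'\<in>edges J. e \<noteq> e' \<longrightarrow>
        set (internal (P e)) \<inter> set (internal (P e')) = {} \<and> set (Q e) \<inter> set (Q e') = {}"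
    and HV: "verts H = f ` verts J \<union> (\<Union>e\<in>edges J. set (internal (P e)))"
    using * by simp_all
  have sub: "subgraph H G" using H(1) by (simp add: conformal_def)
  have path: "is_path G vs es" if "is_path H vs es" for vs es
  proof -
    have "ends H e = ends G e" if "e \<in> edges H" for e using sub that by (auto simp: subgraph_def)
    then have "\<forall>i<length es. ends G (es ! i) = {vs ! i, vs ! Suc i}"
      using that unfolding is_path_def by (metis nth_mem subset_iff)
    then show ?thesis using that sub unfolding is_path_def subgraph_def by blast
  qed
  \<comment> \<open>The given paths already run in some direction. It is read off here as an
    orientation and converted to the prescribed one by \<open>model_reorient\<close>.\<close>
  define s0 where "s0 e = inv_into (verts J) f (hd (P e))" for e
  define t0 where "t0 e = inv_into (verts J) f (last (P e))" for e
  have st: "ends J e = {s0 e, t0 e} \<and> P e = f (s0 e) # internal (P e) @ [f (t0 e)]" if e: "e \<in> edges J" for e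
  proof -
    have sub: "ends J e \<subseteq> verts J" using finite_looplessD(3)[OF J e] .
    have "ends J e = inv_into (verts J) f ` {hd (P e), last (P e)}"
      unfolding P(2)[OF e] using inv_into_image_cancel[OF f sub] by simp
    then have 1: "ends J e = {s0 e, t0 e}" by (simp add: s0_def t0_def)
    have "{hd (P e), last (P e)} \<subseteq> f ` verts J" using P(2)[OF e] sub by blast
    then have h: "f (s0 e) = hd (P e)" "f (t0 e) = last (P e)" by (auto simp: s0_def t0_def f_inv_into_f)
    have "s0 e \<noteq> t0 e" using 1 finite_looplessD(4)[OF J e] by auto
    then have "hd (P e) \<noteq> last (P e)" by (auto simp: s0_def t0_def)
    then have "2 \<le> length (P e)" using is_pathD(1)[OF P(1)[OF e]] by (cases "P e"; cases "tl (P e)") auto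
    from path_decomp[OF this] show ?thesis using 1 h by simp
  qed
  have o0: "orientation J s0 t0" using st by (simp add: orientation_def)
  have "is_path G (f (s0 e) # internal (P e) @ [f (t0 e)]) (Q e)" if "e \<in> edges J" for e
    using path[OF P(1)[OF that]] st[OF that] by simp
  moreover have "f ` verts J \<subseteq> verts G" using HV sub by (auto simp: subgraph_def)
  ultimately have m: "model G J s0 t0 f (\<lambda>e. internal (P e)) Q"
    using f P(3,4) disj by (simp add: model_def)
  have V: "model_verts J f (\<lambda>e. internal (P e)) = verts H" using HV by (simp add: model_verts_def)
  have "\<exists>M. pmatch G (verts G - verts H) M"
    using H(1) by (simp add: conformal_def has_perfect_matching_def perfect_matching_delete_iff_pmatch)
  then show "\<exists>f I Q. model G J s t f I Q \<and> (\<exists>M. pmatch G (verts G - model_verts J f I) M)"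
    using model_reorient[OF J o0 o m] V by metis
next
  assume "\<exists>f I Q. model G J s t f I Q \<and> (\<exists>M. pmatch G (verts G - model_verts J f I) M)"
  then obtain f I Q M where m: "model G J s t f I Q" and M: "pmatch G (verts G - model_verts J f I) M"
    by blast
  define H where "H = \<lparr>verts = model_verts J f I, edges = (\<Union>e\<in>edges J. set (Q e)), ends = ends G\<rparr>"
  have H: "verts H = model_verts J f I" "edges H = (\<Union>e\<in>edges J. set (Q e))" "ends H = ends G"
    by (simp_all add: H_def)
  have "edges H \<subseteq> edges G" unfolding H using is_pathD(5)[OF modelD(3)[OF m]] by blast
  then have "subgraph H G"
    using model_verts_subset[OF m] model_edge_ends[OF J o _ m] unfolding subgraph_def H by blast
  then have "conformal H G"
    using M unfolding conformal_def has_perfect_matching_def perfect_matching_delete_iff_pmatch H by blast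
  moreover have "bisubdivision H J"
    unfolding bisubdivision_def
  proof (intro exI[of _ f] exI[of _ "\<lambda>e. f (s e) # I e @ [f (t e)]"] exI[of _ Q] conjI ballI)
    show "inj_on f (verts J)" using modelD(1)[OF m] .
    show "verts H = f ` verts J \<union> (\<Union>e\<in>edges J. set (internal (f (s e) # I e @ [f (t e)])))"
      by (simp add: H model_verts_def)
    show "edges H = (\<Union>e\<in>edges J. set (Q e))" by (simp add: H)
    fix e assume e: "e \<in> edges J"
    show "is_path H (f (s e) # I e @ [f (t e)]) (Q e)"
    proof -
      have "set (f (s e) # I e @ [f (t e)]) \<subseteq> verts H" unfolding H by (rule model_path_verts[OF J o e])
      moreover have "set (Q e) \<subseteq> edges H" unfolding H using e by blast
      ultimately show ?thesis using modelD(3)[OF m e] unfolding is_path_def H by blast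
    qed
    show "{hd (f (s e) # I e @ [f (t e)]), last (f (s e) # I e @ [f (t e)])} = f ` ends J e"
      using orientationD(1)[OF J o e] by simp
    show "even (length (internal (f (s e) # I e @ [f (t e)])))" using modelD(4)[OF m e] by simp
    show "set (internal (f (s e) # I e @ [f (t e)])) \<inter> f ` verts J = {}" using modelD(5)[OF m e] by simp
  next
    fix e e' assume e: "e \<in> edges J" "e' \<in> edges J"
    show "e \<noteq> e' \<longrightarrow> set (internal (f (s e) # I e @ [f (t e)])) \<inter> set (internal (f (s e') # I e' @ [f (t e')])) = {} \<and>
      set (Q e) \<inter> set (Q e') = {}"
      using modelD(6,7)[OF m e] by simp
  qed
  ultimately show "based J G" by (auto simp: based_def)
qed

text \<open>An edge of \<open>F\<close> has its whole path matched, any other edge only the internal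
  vertices of its path; both are possible because each path has an odd number of edges. This carries
  the matchings supplied by bicriticality from \<open>J\<close> to \<open>G\<close>.\<close>

lemma model_pmatch:
  assumes J: "finite_loopless J" and o: "orientation J s t" and m: "model G J s t f I Q"
    and D: "D \<subseteq> verts J" and F: "pmatch J (verts J - D) F"
  shows "pmatch G (model_verts J f I - f ` D) (\<Union>e\<in>edges J. alternate (e \<in> F) (Q e))"
proof -
  define W where "W e = (if e \<in> F then f ` ends J e else {}) \<union> set (I e)" for e
  have "pmatch G (\<Union>e\<in>edges J. W e) (\<Union>e\<in>edges J. alternate (e \<in> F) (Q e))"
  proof (rule pmatch_UN)
    fix e assume e: "e \<in> edges J"
    have p: "is_path G (f (s e) # I e @ [f (t e)]) (Q e)" using modelD(3)[OF m e] .
    have "length (Q e) = Suc (length (I e))" using is_pathD(2)[OF p] by simp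
    then have odd: "odd (length (Q e))" using modelD(4)[OF m e] by simp
    have "f (t e) \<notin> set (I e)" using is_pathD(3)[OF p] by simp
    then show "pmatch G (W e) (alternate (e \<in> F) (Q e))"
      using pmatch_alternate[OF p] odd orientationD(1)[OF J o e] by (auto simp: W_def insert_commute)
  next
    fix e e' assume e: "e \<in> edges J" "e' \<in> edges J" "e \<noteq> e'"
    have "ends J e \<inter> ends J e' = {}" if "e \<in> F" "e' \<in> F"
      using pmatchD(4)[OF F that] e(3) by blast
    moreover have "ends J e \<subseteq> verts J" "ends J e' \<subseteq> verts J" using finite_looplessD(3)[OF J] e by auto
    ultimately have ff: "f ` ends J e \<inter> f ` ends J e' = {}" if "e \<in> F" "e' \<in> F"
      using that inj_on_image_Int[OF modelD(1)[OF m], of "ends J e" "ends J e'"] by simp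
    have aux: "X \<inter> Z = {}" if "X \<subseteq> Y" "Z \<inter> Y = {}" for X Y Z :: "'x set" using that by blast
    have fe: "f ` ends J e \<subseteq> f ` verts J" "f ` ends J e' \<subseteq> f ` verts J"
      using \<open>ends J e \<subseteq> verts J\<close> \<open>ends J e' \<subseteq> verts J\<close> by (simp_all add: image_mono)
    have "f ` ends J e \<inter> set (I e') = {}" "f ` ends J e' \<inter> set (I e) = {}"
      using aux[OF fe(1) modelD(5)[OF m e(2)]] aux[OF fe(2) modelD(5)[OF m e(1)]] by simp_all
    then show "W e \<inter> W e' = {}"
      using ff modelD(6)[OF m e] unfolding W_def
      by (cases "e \<in> F"; cases "e' \<in> F") (simp_all add: Int_Un_distrib Int_Un_distrib2 Int_commute)
  qed
  moreover have "(\<Union>e\<in>edges J. W e) = model_verts J f I - f ` D"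
  proof -
    have "(\<Union>e\<in>edges J. W e) = f ` (\<Union>e\<in>F. ends J e) \<union> (\<Union>e\<in>edges J. set (I e))"
      using pmatchD(1)[OF F] by (auto simp: W_def image_UN split: if_splits)
    moreover have "(\<Union>e\<in>F. ends J e) = verts J - D" using pmatchD(2,3)[OF F] by blast
    moreover have "f ` (verts J - D) = f ` verts J - f ` D"
      using inj_on_image_set_diff[OF modelD(1)[OF m], of "verts J" D] D by blast
    moreover have "(\<Union>e\<in>edges J. set (I e)) \<inter> f ` D = {}" using modelD(5)[OF m] D by blast
    ultimately show ?thesis unfolding model_verts_def by (simp only: Un_Diff Diff_triv)
  qed
  ultimately show ?thesis by simp
qed

subsection \<open>Edge cuts of bicritical cubic graphs\<close>

lemma bicritical_pmatch:
  assumes "bicritical J" "u \<in> verts J" "v \<in> verts J" "u \<noteq> v"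
  obtains F where "pmatch J (verts J - {u, v}) F"
  using assms unfolding bicritical_def has_perfect_matching_def perfect_matching_delete_iff_pmatch by blast

text \<open>Suppose that at most two edges leave \<open>S\<close>. If \<open>card S\<close> is even, delete one vertex on each side so that
  no edge of the cut survives; if it is odd, some perfect matching avoids the only edge of the cut.
  Both contradict parity.\<close>

lemma bicritical_cubic_cut:
  assumes J: "finite_loopless J" "bicritical J" "cubic J"
    and S: "S \<subseteq> verts J" "S \<noteq> {}" "S \<noteq> verts J"
  shows "3 \<le> card (cut J S)"
proof (rule ccontr)
  assume "\<not> 3 \<le> card (cut J S)"
  then have le: "card (cut J S) \<le> 2" by simp
  have finV: "finite (verts J)" and finS: "finite S" and finC: "finite (cut J S)"
    using finite_looplessD[OF J(1)] S(1) finite_subset by (auto simp: cut_def)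
  have deg: "card {e \<in> edges J. v \<in> ends J e} = 3" if "v \<in> S" for v
    using J(3) S(1) that by (auto simp: cubic_def degree_def)
  have handshake: "even (card S) \<longleftrightarrow> even (card (cut J S))"
  proof -
    have "edges J \<inter> cut J S = cut J S" by (auto simp: cut_def)
    moreover have "(\<Sum>v\<in>S. card {e \<in> edges J. v \<in> ends J e}) = 3 * card S" using deg by simp
    ultimately show ?thesis using incidence_parity[OF J(1) subset_refl finS] by simp
  qed
  show False
  proof (cases "even (card S)")
    case True
    \<comment> \<open>The cut has zero or two edges. For two, take the end in \<open>S\<close> of
      one and the end outside \<open>S\<close> of the other; every edge of the cut then loses an
      end.\<close>
    obtain u v where uv: "u \<in> S" "v \<in> verts J - S" "\<And>e. e \<in> cut J S \<Longrightarrow> u \<in> ends J e \<or> v \<in> ends J e"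
    proof (cases "cut J S = {}")
      case True
      then show thesis using that S by blast
    next
      case False
      then have "card (cut J S) = 2" using \<open>even (card S)\<close> handshake le finC
        by (metis card_0_eq le_SucE le_zero_eq numeral_2_eq_2 odd_one One_nat_def)
      then obtain e e' where ee: "cut J S = {e, e'}" by (auto simp: card_2_iff)
      then have c: "e \<in> cut J S" "e' \<in> cut J S" by auto
      obtain u where u: "u \<in> ends J e" "u \<in> S" using c(1) by (auto simp: cut_def)
      obtain v where v: "v \<in> ends J e'" "v \<notin> S" using c(2) by (auto simp: cut_def)
      have "v \<in> verts J" using c(2) v(1) finite_looplessD(3)[OF J(1), of e'] by (auto simp: cut_def)
      then show thesis using that[of u v] u v ee by auto
    qed
    obtain F where F: "pmatch J (verts J - {u, v}) F"
      using bicritical_pmatch[OF J(2), of u v] uv S(1) by blast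
    have "F \<inter> cut J S = {}" using uv(3) pmatchD(2)[OF F] by blast
    then have "even (card ((verts J - {u, v}) \<inter> S))"
      using pmatch_parity[OF J(1) F, of S] finV by simp
    moreover have "(verts J - {u, v}) \<inter> S = S - {u}" using uv(2) S(1) by blast
    ultimately show False using True uv(1) finS by (simp add: card_gt_0_iff)
  next
    case False
    then have "card (cut J S) = 1" using handshake le by (metis One_nat_def even_numeral le_SucE numeral_2_eq_2 even_zero le_zero_eq)
    then obtain e where e: "cut J S = {e}" by (auto simp: card_1_singleton_iff)
    then obtain x where x: "x \<in> ends J e" "x \<in> S" by (auto simp: cut_def)
    \<comment> \<open>The end \<open>x\<close> of the only cut edge has degree three, so another
      edge \<open>g\<close> meets it. Forcing \<open>g\<close> into a perfect matching keeps
      \<open>e\<close> out.\<close>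
    have "{g \<in> edges J. x \<in> ends J g} \<noteq> {e}" using deg[OF x(2)] by auto
    moreover have "e \<in> edges J" using e by (auto simp: cut_def)
    ultimately obtain g where g: "g \<in> edges J" "x \<in> ends J g" "g \<noteq> e" using x(1) by blast
    obtain y where y: "ends J g = {x, y}" "x \<noteq> y" "y \<in> verts J" using ends_other[OF J(1) g(1,2)] .
    obtain F where "pmatch J (verts J - {x, y}) F"
      using bicritical_pmatch[OF J(2), of x y] x(2) y S(1) by blast
    then have "pmatch J (ends J g \<union> (verts J - {x, y})) ({g} \<union> F)"
      by (rule pmatch_Un[OF pmatch_edge[OF g(1)]]) (use y in auto)
    moreover have "ends J g \<union> (verts J - {x, y}) = verts J" using finite_looplessD(3)[OF J(1) g(1)] y by auto
    ultimately have F': "pmatch J (verts J) ({g} \<union> F)" by simp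
    have "e \<notin> {g} \<union> F" using pmatchD(4)[OF F', of g e x] g x(1) by blast
    then have "({g} \<union> F) \<inter> cut J S = {}" unfolding e by blast
    then have "even (card (verts J \<inter> S))" using pmatch_parity[OF J(1) F' finV, of S] by simp
    moreover have "verts J \<inter> S = S" using S(1) by blast
    ultimately show False using False by simp
  qed
qed

subsection \<open>Barriers\<close>

text \<open>The lower bounds already add up to \<open>card A\<close>, so no term can exceed its own.
  Applied to matching edges leaving blobs and to path edges crossing the cut of one blob.\<close>

lemma sum_eq_indicator:
  fixes c :: "'x \<Rightarrow> nat"
  assumes S: "finite S" "A \<subseteq> S" and ge: "\<And>x. x \<in> A \<Longrightarrow> 1 \<le> c x" and le: "sum c S \<le> card A"
    and y: "y \<in> S"
  shows "c y = of_bool (y \<in> A)"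
proof (rule ccontr)
  assume ne: "c y \<noteq> of_bool (y \<in> A)"
  have ge': "of_bool (x \<in> A) \<le> c x" for x using ge[of x] by simp
  have "of_bool (y \<in> A) < c y" using ge'[of y] ne by simp
  then have "(\<Sum>x\<in>S. of_bool (x \<in> A)) < sum c S"
    using sum_strict_mono_ex1[OF S(1), of "\<lambda>x. of_bool (x \<in> A)" c] ge' y by blast
  moreover have "S \<inter> A = A" using S(2) by blast
  then have "(\<Sum>x\<in>S. of_bool (x \<in> A)) = card A" using S(1) by simp
  ultimately show False using le by simp
qed

text \<open>Vertex sets stand in for the component graphs of \<open>G - B\<close>, so that cuts and
  parities apply to them directly.\<close>

locale blobs =
  fixes G :: "('a, 'e) mgraph" and B :: "'a set" and Ks :: "'a set set"
  assumes G: "finite_loopless G"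
    and B_sub: "B \<subseteq> verts G"
    and Union_Ks: "\<Union>Ks = verts G - B"
    and Ks_disjoint: "K \<in> Ks \<Longrightarrow> K' \<in> Ks \<Longrightarrow> K \<inter> K' \<noteq> {} \<Longrightarrow> K = K'"
    and edge_blob: "e \<in> edges G \<Longrightarrow> ends G e \<inter> B = {} \<Longrightarrow> \<exists>K\<in>Ks. ends G e \<subseteq> K"
begin

lemmas finV = finite_looplessD(1)[OF G]

lemma blob_subset: "K \<in> Ks \<Longrightarrow> K \<subseteq> verts G - B"
  using Union_Ks by blast

lemma finite_blob: "K \<in> Ks \<Longrightarrow> finite K"
  using blob_subset finV finite_subset by blast

lemma finite_Ks: "finite Ks"
proof -
  have "Ks \<subseteq> Pow (verts G)" using blob_subset by blast
  then show ?thesis using finV by (simp add: finite_subset)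
qed

lemma finite_B: "finite B"
  using B_sub finV finite_subset by blast

lemma cut_blob_ends:
  assumes K: "K \<in> Ks" and e: "e \<in> cut G K"
  obtains b v where "b \<in> B" "v \<in> K" "ends G e = {b, v}"
proof -
  have eG: "e \<in> edges G" using e by (simp add: cut_def)
  obtain v where v: "v \<in> ends G e" "v \<in> K" using e by (auto simp: cut_def)
  obtain b where b: "ends G e = {v, b}" using ends_other[OF G eG v(1)] by blast
  have "b \<in> B"
  proof (rule ccontr)
    assume "b \<notin> B"
    then have "ends G e \<inter> B = {}" using b v blob_subset[OF K] by auto
    then obtain K' where K': "K' \<in> Ks" "ends G e \<subseteq> K'" using edge_blob[OF eG] by blast
    then have "K = K'" using Ks_disjoint[OF K] v by blast
    then show False using K' e by (simp add: cut_def)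
  qed
  then show thesis using that v b by (simp add: insert_commute)
qed

lemma cut_blobs_disjoint:
  assumes "K \<in> Ks" "K' \<in> Ks" "e \<in> cut G K" "e \<in> cut G K'"
  shows "K = K'"
proof -
  obtain b v where 1: "b \<in> B" "v \<in> K" "ends G e = {b, v}" using cut_blob_ends[OF assms(1,3)] .
  obtain b' v' where 2: "b' \<in> B" "v' \<in> K'" "ends G e = {b', v'}" using cut_blob_ends[OF assms(2,4)] .
  have "v \<notin> B" "v' \<notin> B" using 1 2 assms blob_subset by auto
  then have "v = v'" using 1 2 by (metis doubleton_eq_iff)
  then show ?thesis using Ks_disjoint[OF assms(1,2)] 1 2 by blast
qed

text \<open>\<open>D\<close> is the set of vertices that the matching misses. An edge of
  \<open>N\<close> leaving a blob occupies a vertex of \<open>B - D\<close> and belongs to the cut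
  of one blob only, so the three parts together bound the number of exits by
  \<open>card (B - D)\<close>.\<close>

lemma sum_cut_le:
  assumes N: "pmatch G (verts G - D) N"
  shows "(\<Sum>K\<in>Ks. card (N \<inter> cut G K)) = card (\<Union>K\<in>Ks. N \<inter> cut G K)"
    and "(\<Union>K\<in>Ks. N \<inter> cut G K) \<subseteq> {e \<in> N. ends G e \<inter> B \<noteq> {}}"
    and "card {e \<in> N. ends G e \<inter> B \<noteq> {}} \<le> card (B - D)"
proof -
  have finN: "finite N" using pmatchD(1)[OF N] finite_looplessD(2)[OF G] finite_subset by blast
  show "(\<Sum>K\<in>Ks. card (N \<inter> cut G K)) = card (\<Union>K\<in>Ks. N \<inter> cut G K)"
    by (rule card_UN_disjoint[symmetric]) (use finite_Ks finN cut_blobs_disjoint in auto)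
  show "(\<Union>K\<in>Ks. N \<inter> cut G K) \<subseteq> {e \<in> N. ends G e \<inter> B \<noteq> {}}"
  proof
    fix e assume "e \<in> (\<Union>K\<in>Ks. N \<inter> cut G K)"
    then obtain K where K: "K \<in> Ks" "e \<in> N" "e \<in> cut G K" by blast
    then obtain b v where "b \<in> B" "ends G e = {b, v}" using cut_blob_ends by metis
    then show "e \<in> {e \<in> N. ends G e \<inter> B \<noteq> {}}" using K(2) by auto
  qed
  define X where "X = {e \<in> N. ends G e \<inter> B \<noteq> {}}"
  \<comment> \<open>An edge may have both ends in \<open>B\<close>, so one of them is chosen; in a
    matching any such choice is injective.\<close>
  define h where "h e = (SOME b. b \<in> ends G e \<inter> B)" for e
  have h: "h e \<in> ends G e \<inter> B" if "e \<in> X" for e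
    unfolding h_def by (rule someI_ex) (use that X_def in blast)
  have hBD: "h ` X \<subseteq> B - D" using h pmatchD(2)[OF N] X_def by blast
  have "inj_on h X"
  proof (rule inj_onI)
    fix e e' assume e: "e \<in> X" "e' \<in> X" "h e = h e'"
    then have "e \<in> N" "e' \<in> N" by (simp_all add: X_def)
    moreover have "h e \<in> ends G e" "h e \<in> ends G e'" using h[OF e(1)] h[OF e(2)] e(3) by simp_all
    ultimately show "e = e'" by (rule pmatchD(4)[OF N])
  qed
  then show "card {e \<in> N. ends G e \<inter> B \<noteq> {}} \<le> card (B - D)"
    using card_inj_on_le[OF _ hBD finite_Diff[OF finite_B]] by (simp add: X_def)
qed

text \<open>Parity forces an exit from every blob with \<open>K - D\<close> odd, and there are at
  most \<open>card (B - D)\<close> exits. The hypothesis makes the bounds meet: such blobs have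
  exactly one exit, the others none, and every matching edge at \<open>B\<close> is an exit.\<close>

lemma blob_tight:
  assumes N: "pmatch G (verts G - D) N"
    and le: "card (B - D) \<le> card {K \<in> Ks. odd (card (K - D))}"
  shows "K \<in> Ks \<Longrightarrow> card (N \<inter> cut G K) = of_bool (odd (card (K - D)))"
    and "e \<in> N \<Longrightarrow> ends G e \<inter> B \<noteq> {} \<Longrightarrow> \<exists>K\<in>Ks. e \<in> cut G K"
proof -
  define c where "c K = card (N \<inter> cut G K)" for K
  let ?O = "{K \<in> Ks. odd (card (K - D))}"
  let ?X = "{e \<in> N. ends G e \<inter> B \<noteq> {}}"
  note sum = sum_cut_le[OF N, folded c_def]
  have finX: "finite ?X" using pmatchD(1)[OF N] finite_looplessD(2)[OF G] finite_subset by fastforce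
  have sum_le: "(\<Sum>K\<in>Ks. c K) \<le> card ?O"
    using le sum(1,3) card_mono[OF finX sum(2)] by linarith
  have par: "even (card (K - D)) \<longleftrightarrow> even (c K)" if "K \<in> Ks" for K
  proof -
    have "(verts G - D) \<inter> K = K - D" using blob_subset[OF that] by blast
    then show ?thesis unfolding c_def using pmatch_parity[OF G N, of K] finV by simp
  qed
  have ge: "1 \<le> c K" if "K \<in> ?O" for K
    using par[of K] that by (cases "c K = 0") auto
  have "c K = of_bool (K \<in> ?O)" if "K \<in> Ks" for K
    by (rule sum_eq_indicator[OF finite_Ks _ ge sum_le that]) auto
  then have eq: "c K = of_bool (odd (card (K - D)))" if "K \<in> Ks" for K using that by simp
  then show "K \<in> Ks \<Longrightarrow> card (N \<inter> cut G K) = of_bool (odd (card (K - D)))"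
    by (simp add: c_def)
  \<comment> \<open>The exits are now as many as the edges at \<open>B\<close>, so the inclusion
    between the two sets is an equality.\<close>
  have "(\<Sum>K\<in>Ks. c K) = card ?O" using eq finite_Ks by (simp add: Int_def)
  then have "card ?X \<le> card (\<Union>K\<in>Ks. N \<inter> cut G K)" using sum(1,3) le by linarith
  then have "(\<Union>K\<in>Ks. N \<inter> cut G K) = ?X" using card_seteq[OF finX sum(2)] by simp
  then show "e \<in> N \<Longrightarrow> ends G e \<inter> B \<noteq> {} \<Longrightarrow> \<exists>K\<in>Ks. e \<in> cut G K" by blast
qed

end

text \<open>What a barrier of a matching covered graph provides once no blob is even.
  \<open>edge_cases\<close> rules out edges inside \<open>B\<close>; \<open>covered\<close> supplies
  the matchings from which replacement paths are built.\<close>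

locale odd_blobs = blobs +
  assumes odd_blob: "K \<in> Ks \<Longrightarrow> odd (card K)"
    and card_Ks: "card Ks = card B"
    and edge_cases: "e \<in> edges G \<Longrightarrow> \<exists>K\<in>Ks. ends G e \<subseteq> K \<or> e \<in> cut G K"
    and covered: "e \<in> edges G \<Longrightarrow> \<exists>M. pmatch G (verts G) M \<and> e \<in> M"
begin

lemma odd_Ks: "{K \<in> Ks. odd (card K)} = Ks"
  using odd_blob by blast

lemma pmatch_cut_blob:
  assumes "pmatch G (verts G) N" "K \<in> Ks"
  shows "card (N \<inter> cut G K) = 1"
  using blob_tight(1)[of "{}" N K] assms odd_Ks card_Ks odd_blob by simp

lemma pmatch_cut_blob_unique:
  assumes "pmatch G (verts G) N" "K \<in> Ks" "e \<in> N \<inter> cut G K" "e' \<in> N \<inter> cut G K"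
  shows "e = e'"
  using pmatch_cut_blob[OF assms(1,2)] assms(3,4) by (metis card_1_singleton_iff One_nat_def singletonD)

end

section \<open>Components of \<open>G - B\<close> as blobs\<close>

lemma adj_delete_iff:
  "(u, v) \<in> adj (delete_verts G B) \<longleftrightarrow> (\<exists>e\<in>edges G. ends G e \<subseteq> verts G - B \<and> ends G e = {u, v})"
  by (auto simp: adj_def delete_verts_def induced_def)

lemma sym_adj: "sym (adj G)"
  by (auto simp: sym_def adj_def insert_commute)

context
  fixes G :: "('a, 'e) mgraph" and B :: "'a set"
begin

definition reach :: "'a \<Rightarrow> 'a set" where
  "reach u = {v. (u, v) \<in> (adj (delete_verts G B))\<^sup>*}"

lemma reach_subset: "u \<in> verts G - B \<Longrightarrow> reach u \<subseteq> verts G - B"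
proof
  fix v assume u: "u \<in> verts G - B" and "v \<in> reach u"
  then have "(u, v) \<in> (adj (delete_verts G B))\<^sup>*" by (simp add: reach_def)
  then show "v \<in> verts G - B"
  proof (induction rule: rtrancl_induct)
    case base then show ?case using u .
  next
    case (step y z)
    then show ?case unfolding adj_delete_iff by blast
  qed
qed

lemma components_eq: "components (delete_verts G B) = (\<lambda>u. induced (delete_verts G B) (reach u)) ` (verts G - B)"
proof -
  have "verts (delete_verts G B) = verts G - B" by (auto simp: delete_verts_def induced_def)
  then show ?thesis by (simp add: components_def reach_def)
qed

lemma verts_component:
  assumes "u \<in> verts G - B"
  shows "verts (induced (delete_verts G B) (reach u)) = reach u"
  using reach_subset[OF assms] by (auto simp: delete_verts_def induced_def)

lemma verts_components: "verts ` components (delete_verts G B) = reach ` (verts G - B)"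
  unfolding components_eq image_image by (rule image_cong[OF refl verts_component])

text \<open>A component is induced by its own vertices, so counting components and counting their
  vertex sets agree.\<close>

lemma inj_verts_components: "inj_on verts (components (delete_verts G B))"
proof (rule inj_onI)
  fix L L' assume L: "L \<in> components (delete_verts G B)" "L' \<in> components (delete_verts G B)" "verts L = verts L'"
  have "L = induced (delete_verts G B) (verts L)" if "L \<in> components (delete_verts G B)" for L
  proof -
    obtain u where "u \<in> verts G - B" "L = induced (delete_verts G B) (reach u)"
      using \<open>L \<in> components (delete_verts G B)\<close> unfolding components_eq by blast
    then show ?thesis using verts_component[of u] by simp
  qed
  then show "L = L'" using L by metis
qed

lemma card_odd_components:
  "card (odd_components (delete_verts G B)) = card {K \<in> reach ` (verts G - B). odd (card K)}"
proof -
  have "{K \<in> reach ` (verts G - B). odd (card K)} = verts ` odd_components (delete_verts G B)"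
    unfolding verts_components[symmetric] odd_components_def by blast
  moreover have "inj_on verts (odd_components (delete_verts G B))"
    by (rule inj_on_subset[OF inj_verts_components]) (auto simp: odd_components_def)
  ultimately show ?thesis by (simp add: card_image)
qed

lemma reach_eq:
  assumes "reach u \<inter> reach v \<noteq> {}"
  shows "reach u = reach v"
proof -
  have s: "sym ((adj (delete_verts G B))\<^sup>*)" by (rule sym_rtrancl[OF sym_adj])
  obtain w where "(u, w) \<in> (adj (delete_verts G B))\<^sup>*" "(v, w) \<in> (adj (delete_verts G B))\<^sup>*"
    using assms by (auto simp: reach_def)
  then have "(u, v) \<in> (adj (delete_verts G B))\<^sup>*" "(v, u) \<in> (adj (delete_verts G B))\<^sup>*"
    using s by (meson rtrancl_trans symD)+
  then show ?thesis unfolding reach_def by (auto intro: rtrancl_trans)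
qed

lemma reach_blobs:
  assumes G: "finite_loopless G" and B: "B \<subseteq> verts G"
  shows "blobs G B (reach ` (verts G - B))"
proof
  show "finite_loopless G" "B \<subseteq> verts G" by fact+
  have "u \<in> reach u" for u by (simp add: reach_def)
  then show "\<Union> (reach ` (verts G - B)) = verts G - B" using reach_subset by blast
  show "K = K'" if "K \<in> reach ` (verts G - B)" "K' \<in> reach ` (verts G - B)" "K \<inter> K' \<noteq> {}" for K K'
    using that reach_eq by blast
  fix e assume e: "e \<in> edges G" "ends G e \<inter> B = {}"
  obtain u v where uv: "ends G e = {u, v}" "u \<in> verts G" "v \<in> verts G" using ends_cases[OF G e(1)] by blast
  have "ends G e \<subseteq> verts G - B" using uv e(2) by auto
  then have "(u, v) \<in> adj (delete_verts G B)"
    unfolding adj_delete_iff using uv(1) by (intro bexI[OF _ e(1)] conjI)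
  then have "(u, v) \<in> (adj (delete_verts G B))\<^sup>*" by (rule r_into_rtrancl)
  then have "ends G e \<subseteq> reach u" by (simp add: uv(1) reach_def)
  moreover have "u \<in> verts G - B" using uv e by auto
  ultimately show "\<exists>K\<in>reach ` (verts G - B). ends G e \<subseteq> K" by blast
qed

text \<open>Tightness for \<open>D = {}\<close> holds for all perfect matchings at once. None of
  them leaves an even blob, so no edge does, since every edge is in one of them; connectedness makes
  such a blob the whole graph. That case stays separate because shrinking an empty set creates no
  vertex.\<close>

lemma barrier_blobs:
  assumes G: "finite_loopless G" and mc: "matching_covered G" and bar: "barrier G B"
  shows "B = {} \<and> reach ` (verts G - B) = {verts G} \<or> odd_blobs G B (reach ` (verts G - B))"
proof -
  let ?Ks = "reach ` (verts G - B)"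
  have B: "B \<subseteq> verts G" using bar by (simp add: barrier_def)
  interpret blobs G B ?Ks by (rule reach_blobs[OF G B])
  have cardB: "card B = card {K \<in> ?Ks. odd (card K)}"
    using bar card_odd_components by (simp add: barrier_def)
  have covered: "\<exists>M. pmatch G (verts G) M \<and> e \<in> M" if "e \<in> edges G" for e
    using mc that unfolding matching_covered_def perfect_matching_iff_pmatch[OF G] by blast
  have tight: "card (M \<inter> cut G K) = of_bool (odd (card K))" if "pmatch G (verts G) M" "K \<in> ?Ks" for M K
    using blob_tight(1)[of "{}" M K] that cardB by simp
  have tight2: "\<exists>K\<in>?Ks. e \<in> cut G K" if "pmatch G (verts G) M" "e \<in> M" "ends G e \<inter> B \<noteq> {}" for M e
    using blob_tight(2)[of "{}" M e] that cardB by simp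
  have nonempty: "K \<noteq> {}" if "K \<in> ?Ks" for K using that by (auto simp: reach_def)
  show ?thesis
  proof (cases "\<exists>K\<in>?Ks. even (card K)")
    case True
    then obtain K where K: "K \<in> ?Ks" "even (card K)" by blast
    have noc: "cut G K = {}"
    proof (rule ccontr)
      assume "cut G K \<noteq> {}"
      then obtain e where e: "e \<in> cut G K" by blast
      then have eG: "e \<in> edges G" by (simp add: cut_def)
      then obtain M where M: "pmatch G (verts G) M" "e \<in> M" using covered by blast
      have "finite (M \<inter> cut G K)" using pmatchD(1)[OF M(1)] finite_looplessD(2)[OF G] finite_subset by blast
      moreover have "card (M \<inter> cut G K) = 0" using tight[OF M(1) K(1)] K(2) by simp
      ultimately show False using e M(2) by auto
    qed
    obtain u where u: "u \<in> K" "u \<in> verts G" using nonempty[OF K(1)] blob_subset[OF K(1)] by blast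
    have "v \<in> K" if v: "v \<in> verts G" for v
    proof -
      have "(u, v) \<in> (adj G)\<^sup>*" using mc u v by (simp add: matching_covered_def connected_graph_def)
      then show ?thesis
      proof (induction rule: rtrancl_induct)
        case base then show ?case using u by simp
      next
        case (step y z)
        then obtain e where e: "e \<in> edges G" "ends G e = {y, z}" by (auto simp: adj_def)
        have "e \<notin> cut G K" using noc by simp
        then show ?case using e step(3) by (auto simp: cut_def)
      qed
    qed
    then have KV: "K = verts G" using blob_subset[OF K(1)] by blast
    then have "B = {}" using blob_subset[OF K(1)] B by blast
    moreover have "?Ks = {verts G}"
    proof
      show "{verts G} \<subseteq> ?Ks" using K(1) KV by simp
      show "?Ks \<subseteq> {verts G}"
      proof
        fix K' assume K': "K' \<in> ?Ks"
        have "K \<inter> K' = K'" using blob_subset[OF K'] KV by blast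
        then have "K = K'" using Ks_disjoint[OF K(1) K'] nonempty[OF K'] by simp
        then show "K' \<in> {verts G}" using KV by simp
      qed
    qed
    ultimately show ?thesis by blast
  next
    case False
    then have odd: "\<And>K. K \<in> ?Ks \<Longrightarrow> odd (card K)" by blast
    then have "{K \<in> ?Ks. odd (card K)} = ?Ks" by blast
    then have "card ?Ks = card B" using cardB by simp
    \<comment> \<open>An edge inside \<open>B\<close> would lie in a perfect matching and be an edge
      at \<open>B\<close> that is not an exit, against tightness.\<close>
    moreover have "\<exists>K\<in>?Ks. ends G e \<subseteq> K \<or> e \<in> cut G K" if "e \<in> edges G" for e
    proof (cases "ends G e \<inter> B = {}")
      case True
      then show ?thesis using edge_blob[OF \<open>e \<in> edges G\<close>] by metis
    next
      case False
      obtain M where "pmatch G (verts G) M" "e \<in> M" using covered[OF \<open>e \<in> edges G\<close>] by metis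
      from tight2[OF this False] show ?thesis by metis
    qed
    ultimately have "odd_blobs G B ?Ks"
      using odd covered by (intro odd_blobs.intro odd_blobs_axioms.intro blobs_axioms) simp_all
    then show ?thesis by blast
  qed
qed

end

subsection \<open>Even stars in the complement of a blob\<close>

context odd_blobs
begin

text \<open>Follow \<open>M\<close>- and \<open>N\<close>-edges alternately from \<open>b\<close> until \<open>P\<close> is reached. By the last assumption, if
  the current vertex lies in a blob, then the only \<open>M\<close>-edge leaving that blob has been used up; hence
  the path can leave the blob only along \<open>N\<close>, visits \<open>B\<close> at even positions only and meets \<open>P\<close> in \<open>B\<close>.\<close>

lemma alternating_path:
  assumes "Y \<subseteq> verts G" "b \<in> Y" "P \<subseteq> Y"
    and "pmatch G (Y - P) M" "pmatch G (Y - {b}) N"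
    and "\<And>K e e'. K \<in> Ks \<Longrightarrow> e \<in> M \<inter> cut G K \<Longrightarrow> e' \<in> M \<inter> cut G K \<Longrightarrow> e = e'"
    and "\<And>K. K \<in> Ks \<Longrightarrow> K \<inter> P \<noteq> {} \<Longrightarrow> M \<inter> cut G K = {}"
    and "b \<in> B \<or> (\<exists>K\<in>Ks. b \<in> K \<and> K \<inter> P = {} \<and> M \<inter> cut G K = {})"
  shows "\<exists>vs es M'. is_path G vs es \<and> hd vs = b \<and> last vs \<in> P \<inter> B \<and> even (length es) \<and> set vs \<subseteq> Y \<and>
    set vs \<inter> P = {last vs} \<and> (\<forall>c\<in>set vs \<inter> B. \<exists>xs ys. vs = xs @ c # ys \<and> even (length xs)) \<and>
    M' \<subseteq> M \<and> pmatch G (Y - P - set vs) M' \<and>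
    (\<forall>K\<in>Ks. K \<inter> (P \<union> set vs) \<noteq> {} \<longrightarrow> M' \<inter> cut G K = {})"
  using assms
proof (induction "card Y" arbitrary: Y b M N rule: less_induct)
  case less
  note Y = less.prems(1) and bY = less.prems(2) and PY = less.prems(3) and M = less.prems(4)
    and N = less.prems(5) and uniq = less.prems(6) and closed = less.prems(7) and start = less.prems(8)
  have finY: "finite Y" using Y finV finite_subset by blast
  show ?case
  proof (cases "b \<in> P")
    case True
    then have bB: "b \<in> B" using start by blast
    have "Y - P - set [b] = Y - P" using True by auto
    then have M': "pmatch G (Y - P - set [b]) M" using M by simp
    have "P \<union> set [b] = P" using True by auto
    then have closed': "\<forall>K\<in>Ks. K \<inter> (P \<union> set [b]) \<noteq> {} \<longrightarrow> M \<inter> cut G K = {}" using closed by simp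
    have "\<forall>c\<in>set [b] \<inter> B. \<exists>xs ys. [b] = xs @ c # ys \<and> even (length xs)"
    proof
      fix c assume "c \<in> set [b] \<inter> B"
      then have "[b] = [] @ c # []" by simp
      then show "\<exists>xs ys. [b] = xs @ c # ys \<and> even (length xs)" using even_zero list.size(3) by metis
    qed
    moreover have "is_path G [b] []" using bY Y by auto
    ultimately show ?thesis using M' closed' True bB bY
      by (intro exI[of _ "[b]"] exI[of _ "[] :: 'b list"] exI[of _ M]) simp
  next
    case False
    then obtain e where e: "e \<in> M" "b \<in> ends G e" using pmatchD(3)[OF M, of b] bY by blast
    have eG: "e \<in> edges G" using pmatchD(1)[OF M] e(1) by blast
    obtain x where x: "ends G e = {b, x}" "b \<noteq> x" using ends_other[OF G eG e(2)] by metis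
    have xY: "x \<in> Y" "x \<notin> P" using pmatchD(2)[OF M e(1)] x by auto
    \<comment> \<open>The blob of the next vertex. From \<open>b\<close> in \<open>B\<close>, the
      edge \<open>e\<close> enters it and is the one \<open>M\<close>-edge allowed in its cut; from
      \<open>b\<close> inside a blob, no \<open>M\<close>-edge leaves, so \<open>x\<close> stays
      there. Either way the rest of \<open>M\<close> cannot leave \<open>K\<close>.\<close>
    obtain K where K: "K \<in> Ks" "x \<in> K" "K \<inter> P = {}" "(M - {e}) \<inter> cut G K = {}" "b \<in> B \<or> b \<in> K"
    proof (cases "b \<in> B")
      case True
      obtain K where K: "K \<in> Ks" "ends G e \<subseteq> K \<or> e \<in> cut G K" using edge_cases[OF eG] by metis
      have "b \<notin> K" using blob_subset[OF K(1)] True by auto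
      then have ec: "e \<in> cut G K" using K(2) x(1) by auto
      then have "x \<in> K" using x(1) \<open>b \<notin> K\<close> by (auto simp: cut_def)
      moreover have "K \<inter> P = {}" using closed[OF K(1)] ec e(1) by auto
      moreover have "(M - {e}) \<inter> cut G K = {}" using uniq[OF K(1), of e] ec e(1) by blast
      ultimately show thesis using that K(1) True by blast
    next
      case False
      then obtain K where K: "K \<in> Ks" "b \<in> K" "K \<inter> P = {}" "M \<inter> cut G K = {}" using start by metis
      then have "e \<notin> cut G K" using e(1) by auto
      then have "x \<in> K" using x(1) K(2) eG by (auto simp: cut_def)
      then show thesis using that[of K] K by auto
    qed
    have xB: "x \<notin> B" using blob_subset[OF K(1)] K(2) by auto
    obtain g where g: "g \<in> N" "x \<in> ends G g" using pmatchD(3)[OF N, of x] xY x(2) by auto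
    have gG: "g \<in> edges G" using pmatchD(1)[OF N] g(1) by blast
    obtain y where y: "ends G g = {x, y}" "x \<noteq> y" using ends_other[OF G gG g(2)] by metis
    have yY: "y \<in> Y" "y \<noteq> b" using pmatchD(2)[OF N g(1)] y by auto
    \<comment> \<open>Without \<open>b\<close> and \<open>x\<close>, the vertex missed by
      \<open>N\<close> is \<open>y\<close>, which takes over the role of \<open>b\<close>.\<close>
    define Y' where "Y' = Y - {b, x}"
    have "card Y' < card Y" unfolding Y'_def using finY bY by (intro psubset_card_mono) auto
    moreover have "Y' \<subseteq> verts G" using Y by (auto simp: Y'_def)
    moreover have yY': "y \<in> Y'" using yY y(2) by (auto simp: Y'_def)
    moreover have "P \<subseteq> Y'" using PY False xY(2) by (auto simp: Y'_def)
    moreover have "pmatch G (Y' - P) (M - {e})"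
    proof -
      have "Y' - P = Y - P - ends G e" unfolding x(1) Y'_def by auto
      then show ?thesis using pmatch_remove_edge[OF M e(1)] by simp
    qed
    moreover have "pmatch G (Y' - {y}) (N - {g})"
    proof -
      have "Y' - {y} = Y - {b} - ends G g" unfolding y(1) Y'_def by auto
      then show ?thesis using pmatch_remove_edge[OF N g(1)] by simp
    qed
    moreover have "f = f'" if "L \<in> Ks" "f \<in> (M - {e}) \<inter> cut G L" "f' \<in> (M - {e}) \<inter> cut G L" for L f f'
      using uniq[OF that(1), of f f'] that(2,3) by simp
    moreover have "(M - {e}) \<inter> cut G L = {}" if "L \<in> Ks" "L \<inter> P \<noteq> {}" for L
      using closed[OF that] by blast
    \<comment> \<open>If \<open>y\<close> is not in \<open>B\<close>, then \<open>g\<close> avoids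
      \<open>B\<close> and \<open>y\<close> is in the blob of \<open>x\<close>, whose cut contains
      no further edge of \<open>M\<close>.\<close>
    moreover have "y \<in> B \<or> (\<exists>K\<in>Ks. y \<in> K \<and> K \<inter> P = {} \<and> (M - {e}) \<inter> cut G K = {})"
    proof (cases "y \<in> B")
      case False
      then have "ends G g \<inter> B = {}" using y(1) xB by auto
      then obtain L where L: "L \<in> Ks" "ends G g \<subseteq> L" using edge_blob[OF gG] by metis
      then have "K \<inter> L \<noteq> {}" using K(2) y(1) by auto
      then have "K = L" using Ks_disjoint[OF K(1) L(1)] by simp
      then have "y \<in> K" using L(2) y(1) by auto
      then show ?thesis using K by blast
    qed simp
    ultimately have "\<exists>vs es M'. is_path G vs es \<and> hd vs = y \<and> last vs \<in> P \<inter> B \<and> even (length es) \<and>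
      set vs \<subseteq> Y' \<and> set vs \<inter> P = {last vs} \<and>
      (\<forall>c\<in>set vs \<inter> B. \<exists>xs ys. vs = xs @ c # ys \<and> even (length xs)) \<and>
      M' \<subseteq> M - {e} \<and> pmatch G (Y' - P - set vs) M' \<and>
      (\<forall>K\<in>Ks. K \<inter> (P \<union> set vs) \<noteq> {} \<longrightarrow> M' \<inter> cut G K = {})"
      by (rule less.hyps)
    then obtain vs es M' where IH: "is_path G vs es" "hd vs = y" "last vs \<in> P \<inter> B" "even (length es)"
      "set vs \<subseteq> Y'" "set vs \<inter> P = {last vs}"
      "\<forall>c\<in>set vs \<inter> B. \<exists>xs ys. vs = xs @ c # ys \<and> even (length xs)"
      "M' \<subseteq> M - {e}" "pmatch G (Y' - P - set vs) M'"
      "\<forall>K\<in>Ks. K \<inter> (P \<union> set vs) \<noteq> {} \<longrightarrow> M' \<inter> cut G K = {}"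
      by (elim exE conjE)
    obtain ws where ws: "vs = y # ws" using IH(2) is_pathD(1)[OF IH(1)] by (cases vs) auto
    let ?vs = "b # x # vs"
    have bx: "b \<notin> set vs" "x \<notin> set vs" using IH(5) by (auto simp: Y'_def)
    have V: "b \<in> verts G" "x \<in> verts G" using bY xY Y by auto
    have "is_path G (x # vs) (g # es)"
      using IH(1) bx V y gG unfolding ws by (simp add: is_path_Cons)
    then have 1: "is_path G ?vs (e # g # es)" using bx V x eG by (simp add: is_path_Cons)
    have last: "last ?vs = last vs" unfolding ws by simp
    have 2: "set ?vs \<subseteq> Y" using IH(5) bY xY by (auto simp: Y'_def)
    have 3: "set ?vs \<inter> P = {last vs}" using IH(6) False xY(2) by auto
    have 4: "\<forall>c\<in>set ?vs \<inter> B. \<exists>xs ys. ?vs = xs @ c # ys \<and> even (length xs)"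
    proof
      fix c assume c: "c \<in> set ?vs \<inter> B"
      show "\<exists>xs ys. ?vs = xs @ c # ys \<and> even (length xs)"
      proof (cases "c = b")
        case True
        then have "?vs = [] @ c # (x # vs) \<and> even (length ([] :: 'a list))" by simp
        then show ?thesis by blast
      next
        case False
        then have "c \<in> set vs \<inter> B" using c xB by auto
        then obtain xs ys where "vs = xs @ c # ys" "even (length xs)" using IH(7) by metis
        then have "?vs = (b # x # xs) @ c # ys \<and> even (length (b # x # xs))" by simp
        then show ?thesis by blast
      qed
    qed
    have "Y - P - set ?vs = Y' - P - set vs" by (auto simp: Y'_def)
    then have 5: "pmatch G (Y - P - set ?vs) M'" using IH(9) by simp
    have 6: "\<forall>L\<in>Ks. L \<inter> (P \<union> set ?vs) \<noteq> {} \<longrightarrow> M' \<inter> cut G L = {}"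
    proof (intro ballI impI)
      fix L assume L: "L \<in> Ks" "L \<inter> (P \<union> set ?vs) \<noteq> {}"
      show "M' \<inter> cut G L = {}"
      proof (cases "L \<inter> (P \<union> set vs) = {}")
        case True
        then have "b \<in> L \<or> x \<in> L" using L(2) by auto
        moreover have "b \<in> L \<Longrightarrow> b \<in> K" using blob_subset[OF L(1)] K(5) by auto
        ultimately have "K \<inter> L \<noteq> {}" using K(2) by auto
        then have "L = K" using Ks_disjoint[OF K(1) L(1)] by simp
        then show ?thesis using K(4) IH(8) by auto
      next
        case False
        then show ?thesis using IH(10) L(1) by blast
      qed
    qed
    have 7: "M' \<subseteq> M" using IH(8) by blast
    have 8: "last ?vs \<in> P \<inter> B" "set ?vs \<inter> P = {last ?vs}" using IH(3) 3 unfolding last by simp_all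
    show ?thesis
      by (rule exI[of _ ?vs], rule exI[of _ "e # g # es"], rule exI[of _ M'])
        (use 1 2 4 5 6 7 8 IH(4) in \<open>simp only: list.sel list.size even_Suc simp_thms\<close>, simp)
  qed
qed

text \<open>The last clause is inherited from perfect matchings of \<open>G\<close>; it is what
  \<open>alternating_path\<close> demands of its matching \<open>M\<close>.\<close>

definition near_matching :: "'a set \<Rightarrow> 'a \<Rightarrow> 'b set \<Rightarrow> bool" where
  "near_matching Y b N \<longleftrightarrow> b \<in> Y \<inter> B \<and> pmatch G (Y - {b}) N \<and>
     (\<forall>K\<in>Ks. \<forall>e e'. e \<in> N \<inter> cut G K \<longrightarrow> e' \<in> N \<inter> cut G K \<longrightarrow> e = e')"

text \<open>A perfect matching of \<open>G\<close> through \<open>e\<close> has no other edge in the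
  cut of \<open>L\<close>, so deleting \<open>L\<close> and \<open>b\<close> breaks no edge but
  \<open>e\<close>.\<close>

lemma near_matchingI:
  assumes L: "L \<in> Ks" and e: "e \<in> cut G L" and b: "b \<in> ends G e" "b \<in> B"
  shows "\<exists>N. near_matching (verts G - L) b N"
proof -
  have eG: "e \<in> edges G" using e by (simp add: cut_def)
  obtain M where M: "pmatch G (verts G) M" "e \<in> M" using covered[OF eG] by blast
  obtain b' v where bv: "b' \<in> B" "v \<in> L" "ends G e = {b', v}" using cut_blob_ends[OF L e] .
  have "v \<notin> B" using blob_subset[OF L] bv(2) by auto
  then have ends: "ends G e = {b, v}" using b bv by auto
  have bY: "b \<in> verts G - L" using b(2) B_sub blob_subset[OF L] by auto
  let ?X = "verts G - L - {b}"
  have "pmatch G ?X {g \<in> M. ends G g \<subseteq> ?X}"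
  proof (rule pmatch_restrict[OF M(1)])
    show "?X \<subseteq> verts G" by auto
    fix g assume g: "g \<in> M"
    show "ends G g \<inter> ?X = {} \<or> ends G g \<subseteq> ?X"
    proof (cases "g = e")
      case True
      then show ?thesis using ends bv(2) by auto
    next
      case False
      then have "g \<notin> cut G L" using pmatch_cut_blob_unique[OF M(1) L, of e g] M(2) e g by auto
      then have "ends G g \<inter> L = {} \<or> ends G g \<subseteq> L" using pmatchD(1)[OF M(1)] g by (auto simp: cut_def)
      moreover have "b \<notin> ends G g" using pmatchD(4)[OF M(1), of e g b] M(2) g b(1) False by blast
      ultimately show ?thesis using pmatchD(2)[OF M(1) g] by auto
    qed
  qed
  moreover have "f = f'" if "K \<in> Ks" "f \<in> M \<inter> cut G K" "f' \<in> M \<inter> cut G K" for K f f'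
    using pmatch_cut_blob_unique[OF M(1) that] .
  ultimately have "near_matching (verts G - L) b {g \<in> M. ends G g \<subseteq> ?X}"
    unfolding near_matching_def using bY b(2) by blast
  then show ?thesis by blast
qed

text \<open>\<open>alternating_path\<close> with \<open>P = {b'}\<close>, which meets no blob. The
  even positions of \<open>B\<close> and the control over \<open>M\<close> are passed on because
  \<open>near_matching_star\<close> runs a second path against this one.\<close>

lemma near_matching_path:
  assumes Y: "Y \<subseteq> verts G" and N: "near_matching Y b N" "near_matching Y b' N'"
  obtains vs es M where "is_path G vs es" "hd vs = b" "last vs = b'" "even (length es)" "set vs \<subseteq> Y"
    "\<forall>c\<in>set vs \<inter> B. \<exists>xs ys. vs = xs @ c # ys \<and> even (length xs)"
    "pmatch G (Y - set vs) M" "M \<subseteq> N'" "\<forall>K\<in>Ks. K \<inter> set vs \<noteq> {} \<longrightarrow> M \<inter> cut G K = {}"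
proof -
  have b: "b \<in> Y" "b \<in> B" "b' \<in> Y" "b' \<in> B" using N by (auto simp: near_matching_def)
  have noK: "K \<inter> {b'} = {}" if "K \<in> Ks" for K using blob_subset[OF that] b(4) by auto
  have 1: "pmatch G (Y - {b'}) N'" "pmatch G (Y - {b}) N" using N by (auto simp: near_matching_def)
  have 2: "e = e'" if "K \<in> Ks" "e \<in> N' \<inter> cut G K" "e' \<in> N' \<inter> cut G K" for K e e'
    using N(2) that unfolding near_matching_def by metis
  have "\<exists>vs es M'. is_path G vs es \<and> hd vs = b \<and> last vs \<in> {b'} \<inter> B \<and> even (length es) \<and> set vs \<subseteq> Y \<and>
    set vs \<inter> {b'} = {last vs} \<and> (\<forall>c\<in>set vs \<inter> B. \<exists>xs ys. vs = xs @ c # ys \<and> even (length xs)) \<and>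
    M' \<subseteq> N' \<and> pmatch G (Y - {b'} - set vs) M' \<and>
    (\<forall>K\<in>Ks. K \<inter> ({b'} \<union> set vs) \<noteq> {} \<longrightarrow> M' \<inter> cut G K = {})"
    by (rule alternating_path[OF Y b(1) _ 1 2]) (use b noK in auto)
  then obtain vs es M where p: "is_path G vs es" "hd vs = b" "last vs \<in> {b'} \<inter> B" "even (length es)" "set vs \<subseteq> Y"
    "\<forall>c\<in>set vs \<inter> B. \<exists>xs ys. vs = xs @ c # ys \<and> even (length xs)"
    "M \<subseteq> N'" "pmatch G (Y - {b'} - set vs) M" "\<forall>K\<in>Ks. K \<inter> ({b'} \<union> set vs) \<noteq> {} \<longrightarrow> M \<inter> cut G K = {}"
    by (elim exE conjE)
  have last: "last vs = b'" using p(3) by simp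
  then have "b' \<in> set vs" using is_pathD(1)[OF p(1)] last_in_set by metis
  then have "Y - {b'} - set vs = Y - set vs" by auto
  then have "pmatch G (Y - set vs) M" using p(8) by simp
  moreover have "\<forall>K\<in>Ks. K \<inter> set vs \<noteq> {} \<longrightarrow> M \<inter> cut G K = {}" using p(9) by auto
  ultimately show thesis using that[OF p(1,2) last p(4,5,6)] p(7) by blast
qed

text \<open>Two legs are the halves of one alternating path; the third runs from \<open>b i3\<close>
  until it hits that path. The hit \<open>w\<close> is in \<open>B\<close>, hence at an even
  position, so both halves are even. The \<open>b i\<close> may coincide, and legs may be
  empty.\<close>

lemma near_matching_star:
  assumes Y: "Y \<subseteq> verts G" and A: "card A = 3" and N: "\<And>i. i \<in> A \<Longrightarrow> \<exists>N. near_matching Y (b i) N"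
  shows "\<exists>w V E M. w \<in> Y \<and> w \<in> B \<and>
    (\<forall>i\<in>A. is_path G (w # V i) (E i) \<and> last (w # V i) = b i \<and> even (length (V i)) \<and> set (V i) \<subseteq> Y) \<and>
    (\<forall>i\<in>A. \<forall>j\<in>A. i \<noteq> j \<longrightarrow> set (V i) \<inter> set (V j) = {}) \<and>
    pmatch G (Y - ({w} \<union> (\<Union>i\<in>A. set (V i)))) M"
proof -
  obtain i1 i2 i3 where A3: "A = {i1, i2, i3}" "i1 \<noteq> i2" "i1 \<noteq> i3" "i2 \<noteq> i3"
    using A unfolding card_3_iff by metis
  have iA: "i1 \<in> A" "i2 \<in> A" "i3 \<in> A" unfolding A3(1) by simp_all
  obtain N1 N2 N3 where N: "near_matching Y (b i1) N1" "near_matching Y (b i2) N2" "near_matching Y (b i3) N3"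
    using N[OF iA(1)] N[OF iA(2)] N[OF iA(3)] by (elim exE)
  obtain vs es M where p: "is_path G vs es" "hd vs = b i1" "last vs = b i2" "even (length es)" "set vs \<subseteq> Y"
    "\<forall>c\<in>set vs \<inter> B. \<exists>xs ys. vs = xs @ c # ys \<and> even (length xs)"
    "pmatch G (Y - set vs) M" "M \<subseteq> N2" "\<forall>K\<in>Ks. K \<inter> set vs \<noteq> {} \<longrightarrow> M \<inter> cut G K = {}"
    using near_matching_path[OF Y N(1,2)] .
  have b3: "b i3 \<in> Y" "b i3 \<in> B" and N3: "pmatch G (Y - {b i3}) N3" using N(3) by (auto simp: near_matching_def)
  have uniq: "e = e'" if "K \<in> Ks" "e \<in> M \<inter> cut G K" "e' \<in> M \<inter> cut G K" for K e e'
  proof -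
    have "e \<in> N2 \<inter> cut G K" "e' \<in> N2 \<inter> cut G K" using that p(8) by auto
    then show ?thesis using N(2) that(1) unfolding near_matching_def by metis
  qed
  \<comment> \<open>Now \<open>P\<close> is the vertex set of the first path, and the matching left
    outside it takes the role of \<open>M\<close>.\<close>
  have "\<exists>us fs M'. is_path G us fs \<and> hd us = b i3 \<and> last us \<in> set vs \<inter> B \<and> even (length fs) \<and> set us \<subseteq> Y \<and>
    set us \<inter> set vs = {last us} \<and> (\<forall>c\<in>set us \<inter> B. \<exists>xs ys. us = xs @ c # ys \<and> even (length xs)) \<and>
    M' \<subseteq> M \<and> pmatch G (Y - set vs - set us) M' \<and>
    (\<forall>K\<in>Ks. K \<inter> (set vs \<union> set us) \<noteq> {} \<longrightarrow> M' \<inter> cut G K = {})"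
    by (rule alternating_path[OF Y b3(1) p(5,7) N3 uniq]) (use p(9) b3(2) in auto)
  then obtain us fs M' where q: "is_path G us fs" "hd us = b i3" "last us \<in> set vs \<inter> B" "even (length fs)"
    "set us \<subseteq> Y" "set us \<inter> set vs = {last us}" "pmatch G (Y - set vs - set us) M'"
    by (elim exE conjE)
  define w where "w = last us"
  obtain xs ys where vs: "vs = xs @ w # ys" "even (length xs)" using p(6) q(3) w_def by metis
  obtain es1 es2 where es: "is_path G (xs @ [w]) es1" "is_path G (w # ys) es2" using is_path_split p(1) vs(1) by metis
  obtain ws where us: "us = ws @ [w]" "length ws = length fs"
    using is_pathD(1,2)[OF q(1)] w_def append_butlast_last_id[of us] by (metis diff_Suc_1 length_butlast)
  have "length xs + length ys = length es" using is_pathD(2)[OF p(1)] vs(1) by simp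
  then have "even (length xs + length ys)" using p(4) by simp
  then have evens: "even (length ys)" "even (length ws)" using q(4) vs(2) us(2) by simp_all
  define V where "V i = (if i = i1 then rev xs else if i = i2 then ys else rev ws)" for i
  define E where "E i = (if i = i1 then rev es1 else if i = i2 then es2 else rev fs)" for i
  have V: "V i1 = rev xs" "V i2 = ys" "V i3 = rev ws" "E i1 = rev es1" "E i2 = es2" "E i3 = rev fs"
    using A3 by (auto simp: V_def E_def)
  have revus: "w # rev ws = rev us" by (simp add: us(1))
  have paths: "is_path G (w # rev xs) (rev es1)" "is_path G (w # rev ws) (rev fs)"
    using is_path_rev[OF es(1)] is_path_rev[OF q(1)] unfolding revus by simp_all
  have lasts: "last (w # rev xs) = b i1" "last (w # ys) = b i2" "last (w # rev ws) = b i3"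
  proof -
    show "last (w # rev xs) = b i1" using p(2) vs(1) by (cases xs) auto
    show "last (w # ys) = b i2" using p(3) vs(1) by simp
    show "last (w # rev ws) = b i3" unfolding revus using q(2) is_pathD(1)[OF q(1)] by (simp add: last_rev)
  qed
  have dvs: "distinct vs" using is_pathD(3)[OF p(1)] .
  have "w \<notin> set ws" using is_pathD(3)[OF q(1)] us(1) by simp
  moreover have setus: "set us = insert w (set ws)" by (simp add: us(1))
  ultimately have *: "w \<notin> set ws" "insert w (set ws) \<inter> set vs = {w}" using q(6) w_def by simp_all
  have dus: "set ws \<inter> set vs = {}"
  proof (rule equals0I)
    fix x assume "x \<in> set ws \<inter> set vs"
    then have "x \<in> insert w (set ws) \<inter> set vs" "x \<in> set ws" by simp_all
    then show False unfolding *(2) using *(1) by simp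
  qed
  have disj: "set xs \<inter> set ys = {}" "set xs \<inter> set ws = {}" "set ys \<inter> set ws = {}"
    using dvs dus unfolding vs(1) by auto
  have un: "{w} \<union> (\<Union>i\<in>A. set (V i)) = set vs \<union> set us"
    unfolding A3(1) using V vs(1) setus by auto
  have sub: "set xs \<subseteq> Y" "set ys \<subseteq> Y" "set ws \<subseteq> Y" using p(5) q(5) vs(1) setus by auto
  show ?thesis
  proof (rule exI[of _ w], rule exI[of _ V], rule exI[of _ E], rule exI[of _ M'], intro conjI ballI impI)
    show "w \<in> Y" "w \<in> B" using q(3) p(5) w_def by auto
    fix i assume i: "i \<in> A"
    then consider "i = i1" | "i = i2" | "i = i3" using A3(1) by blast
    then have "is_path G (w # V i) (E i) \<and> last (w # V i) = b i \<and> even (length (V i)) \<and> set (V i) \<subseteq> Y"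
      by cases (simp_all only: V paths es lasts evens vs(2) sub set_rev length_rev simp_thms)
    then show "is_path G (w # V i) (E i)" "last (w # V i) = b i" "even (length (V i))" "set (V i) \<subseteq> Y"
      by simp_all
    fix j assume "j \<in> A" "i \<noteq> j"
    moreover from this have "i = i1 \<or> i = i2 \<or> i = i3" "j = i1 \<or> j = i2 \<or> j = i3" using A3(1) i by auto
    ultimately show "set (V i) \<inter> set (V j) = {}" using disj V by (elim disjE) (simp_all add: Int_commute)
  next
    have "Y - ({w} \<union> (\<Union>i\<in>A. set (V i))) = Y - set vs - set us" unfolding un by auto
    then show "pmatch G (Y - ({w} \<union> (\<Union>i\<in>A. set (V i)))) M'" using q(7) by simp
  qed
qed

end

subsection \<open>Shrinking the complement of a vertex set\<close>

locale shrinking =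
  fixes G :: "('a, 'e) mgraph" and L :: "'a set"
  assumes loopless: "finite_loopless G" and L_sub: "L \<subseteq> verts G"
begin

abbreviation Y where "Y \<equiv> verts G - L"
abbreviation Gs where "Gs \<equiv> shrink G (verts G - L)"

text \<open>Agrees on \<open>verts G\<close> with the projection inside \<open>shrink\<close>, but
  tests membership in \<open>L\<close>. Off \<open>verts G\<close> the two differ, hence the
  restriction to edges of \<open>G\<close> in \<open>ends_shrink\<close>.\<close>

definition pr :: "'a \<Rightarrow> 'a option" where
  "pr v = (if v \<in> L then Some v else None)"

lemma verts_shrink: "verts Gs = Some ` L \<union> (if Y = {} then {} else {None})"
  using L_sub by (auto simp: shrink_def Let_def image_iff)

lemma edges_shrink: "edges Gs = {e \<in> edges G. \<not> ends G e \<subseteq> Y}"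
  by (simp add: shrink_def Let_def)

lemma ends_shrink: "e \<in> edges G \<Longrightarrow> ends Gs e = pr ` ends G e"
  using finite_looplessD(3)[OF loopless, of e] unfolding shrink_def Let_def pr_def
  by (auto simp: image_iff)

lemma pr_simps [simp]: "v \<in> L \<Longrightarrow> pr v = Some v" "v \<notin> L \<Longrightarrow> pr v = None"
  by (simp_all add: pr_def)

lemma ends_shrink_Some:
  assumes "v \<in> L" "w \<in> L"
  shows "e \<in> edges Gs \<and> ends Gs e = {Some v, Some w} \<longleftrightarrow> e \<in> edges G \<and> ends G e = {v, w}"
proof (cases "e \<in> edges G")
  case True
  then obtain x y where xy: "ends G e = {x, y}" using ends_cases[OF loopless] by metis
  have pr: "pr u = Some w \<longleftrightarrow> u \<in> L \<and> u = w" for u w by (simp add: pr_def)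
  have "pr ` {x, y} = {Some v, Some w} \<longleftrightarrow> {x, y} = {v, w}"
    using assms by (auto simp: doubleton_eq_iff pr)
  moreover have "\<not> {v, w} \<subseteq> Y" using assms by auto
  ultimately show ?thesis using True by (auto simp: edges_shrink ends_shrink xy)
qed (simp add: edges_shrink)

lemma ends_shrink_None:
  assumes "e \<in> edges Gs" "ends Gs e = {None, Some w}"
  obtains b where "b \<in> Y" "ends G e = {b, w}" "e \<in> cut G L" "w \<in> L"
proof -
  have e: "e \<in> edges G" using assms(1) by (simp add: edges_shrink)
  obtain x y where xy: "ends G e = {x, y}" "x \<in> verts G" "y \<in> verts G" using ends_cases[OF loopless e] by metis
  have "{pr x, pr y} = {None, Some w}" using assms(2) ends_shrink[OF e] xy(1) by simp
  then have "x \<notin> L \<and> y \<in> L \<and> y = w \<or> y \<notin> L \<and> x \<in> L \<and> x = w"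
    by (auto simp: doubleton_eq_iff pr_def split: if_splits)
  then show thesis
  proof
    assume a: "x \<notin> L \<and> y \<in> L \<and> y = w"
    then show thesis using that[of x] xy e by (auto simp: cut_def)
  next
    assume a: "y \<notin> L \<and> x \<in> L \<and> x = w"
    then show thesis using that[of y] xy e by (auto simp: cut_def)
  qed
qed

lemma finite_loopless_shrink: "finite_loopless Gs"
  unfolding finite_loopless_def
proof (intro conjI ballI)
  show "finite (verts Gs)" using finite_looplessD(1)[OF loopless] L_sub finite_subset
    by (auto simp: verts_shrink)
  show "finite (edges Gs)" using finite_looplessD(2)[OF loopless] by (simp add: edges_shrink)
  fix e assume e: "e \<in> edges Gs"
  then have eG: "e \<in> edges G" by (simp add: edges_shrink)
  obtain x y where xy: "ends G e = {x, y}" "x \<noteq> y" "x \<in> verts G" "y \<in> verts G"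
    using ends_cases[OF loopless eG] by metis
  have or: "x \<in> L \<or> y \<in> L" using e xy by (auto simp: edges_shrink)
  then have "pr x \<noteq> pr y" using xy(2) by (auto simp: pr_def)
  then show "card (ends Gs e) = 2" using ends_shrink[OF eG] xy(1) by simp
  show "ends Gs e \<subseteq> verts Gs" unfolding ends_shrink[OF eG] xy(1) verts_shrink
    using xy(3,4) by (auto simp: pr_def)
qed

lemma shrink_path:
  assumes "set vs \<subseteq> L"
  shows "is_path Gs (map Some vs) es \<longleftrightarrow> is_path G vs es"
  using assms
proof (induction vs arbitrary: es rule: induct_list012)
  case 1 then show ?case by simp
next
  case (2 v) then show ?case using L_sub by (auto simp: verts_shrink)
next
  case (3 v w vs)
  have vw: "v \<in> L" "w \<in> L" using 3(3) by auto
  have V: "Some v \<in> verts Gs" "v \<in> verts G" using vw L_sub by (auto simp: verts_shrink)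
  have S: "set (w # vs) \<subseteq> L" using 3(3) by auto
  have IH: "is_path Gs (Some w # map Some vs) es' \<longleftrightarrow> is_path G (w # vs) es'" for es'
    using 3(2)[OF S, of es'] by simp
  have N: "Some v \<notin> set (Some w # map Some vs) \<longleftrightarrow> v \<notin> set (w # vs)" by auto
  have "is_path Gs (map Some (v # w # vs)) es \<longleftrightarrow> is_path Gs (Some v # Some w # map Some vs) es" by simp
  also have "\<dots> \<longleftrightarrow> (\<exists>e es'. es = e # es' \<and> (e \<in> edges Gs \<and> ends Gs e = {Some v, Some w}) \<and>
      v \<notin> set (w # vs) \<and> is_path G (w # vs) es')"
    unfolding is_path_Cons_iff[of Gs] N IH using V(1) by metis
  also have "\<dots> \<longleftrightarrow> is_path G (v # w # vs) es"
    unfolding is_path_Cons_iff[of G] ends_shrink_Some[OF vw] using V(2) by metis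
  finally show ?case .
qed

text \<open>The same edge list is a path in \<open>G\<close> once \<open>None\<close> is replaced by
  the end outside \<open>L\<close> of its first edge. The cut edge \<open>h\<close> certifies that
  this end is attached to \<open>L\<close>, which is what the near-perfect matchings
  require.\<close>

lemma shrink_path_NoneD:
  assumes vs: "set vs \<subseteq> L" "vs \<noteq> []" and p: "is_path Gs (None # map Some vs) es"
  obtains b h where "b \<in> Y" "h \<in> cut G L" "b \<in> ends G h" "is_path G (b # vs) es"
proof -
  obtain w ws where ws: "vs = w # ws" using vs(2) by (cases vs) auto
  have "is_path Gs (None # Some w # map Some ws) es" using p ws by simp
  then obtain e es' where e: "es = e # es'" "e \<in> edges Gs" "ends Gs e = {None, Some w}"
    "is_path Gs (Some w # map Some ws) es'" unfolding is_path_Cons_iff by blast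
  obtain b where b: "b \<in> Y" "ends G e = {b, w}" "e \<in> cut G L" using ends_shrink_None[OF e(2,3)] by metis
  have "is_path G vs es'" using e(4) shrink_path[OF vs(1)] ws by simp
  moreover have "b \<notin> set vs" using b(1) vs(1) by auto
  moreover have "e \<in> edges G" using e(2) by (simp add: edges_shrink)
  ultimately have "is_path G (b # vs) es" using b(1,2) by (simp add: e(1) ws is_path_Cons)
  then show thesis using that[of b e] b by simp
qed

lemma shrink_path_NoneI:
  assumes vs: "set vs \<subseteq> L" "vs \<noteq> []" and b: "b \<in> Y" and p: "is_path G (b # vs) es"
  shows "is_path Gs (None # map Some vs) es"
proof -
  obtain w ws where ws: "vs = w # ws" using vs(2) by (cases vs) auto
  have "is_path G (b # w # ws) es" using p ws by simp
  then obtain e es' where e: "es = e # es'" "e \<in> edges G" "ends G e = {b, w}" "is_path G (w # ws) es'"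
    unfolding is_path_Cons_iff by blast
  have w: "w \<in> L" using vs(1) ws by simp
  have "ends Gs e = {None, Some w}" unfolding ends_shrink[OF e(2)] e(3) using b w by simp
  moreover have "e \<in> edges Gs" using e(2,3) w by (simp add: edges_shrink)
  moreover have "is_path Gs (Some w # map Some ws) es'" using e(4) shrink_path[OF vs(1)] ws by simp
  moreover have "None \<in> verts Gs" using b by (auto simp: verts_shrink)
  ultimately show ?thesis by (auto simp: e(1) ws is_path_Cons)
qed

lemma pmatch_shrink:
  assumes "W \<subseteq> L"
  shows "pmatch Gs (Some ` W) M \<longleftrightarrow> pmatch G W M"
proof -
  have 1: "e \<in> edges Gs \<and> ends Gs e \<subseteq> Some ` W \<longleftrightarrow> e \<in> edges G \<and> ends G e \<subseteq> W" for e
  proof (cases "e \<in> edges G")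
    case True
    obtain x y where xy: "ends G e = {x, y}" using ends_cases[OF loopless True] by metis
    have "pr u \<in> Some ` W \<longleftrightarrow> u \<in> W" for u using assms by (auto simp: pr_def)
    then show ?thesis using True assms by (auto simp: edges_shrink ends_shrink xy)
  qed (simp add: edges_shrink)
  have 2: "Some v \<in> ends Gs e \<longleftrightarrow> v \<in> ends G e" if "e \<in> edges G" "v \<in> W" for v e
    unfolding ends_shrink[OF that(1)] using that(2) assms by (auto simp: pr_def image_iff)
  have 3: "(\<exists>!e. e \<in> M \<and> Some v \<in> ends Gs e) \<longleftrightarrow> (\<exists>!e. e \<in> M \<and> v \<in> ends G e)"
    if "v \<in> W" "M \<subseteq> edges G" for v
  proof -
    have "e \<in> M \<and> Some v \<in> ends Gs e \<longleftrightarrow> e \<in> M \<and> v \<in> ends G e" for e using 2[OF _ that(1)] that(2) by blast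
    then show ?thesis by simp
  qed
  have 4: "M \<subseteq> edges G" if "M \<subseteq> edges Gs" using that by (auto simp: edges_shrink)
  have 5: "M \<subseteq> edges Gs \<and> (\<forall>e\<in>M. ends Gs e \<subseteq> Some ` W) \<longleftrightarrow> M \<subseteq> edges G \<and> (\<forall>e\<in>M. ends G e \<subseteq> W)"
    using 1 by blast
  show ?thesis
  proof (cases "M \<subseteq> edges G")
    case True
    have 6: "(\<forall>v\<in>Some ` W. \<exists>!e. e \<in> M \<and> v \<in> ends Gs e) \<longleftrightarrow> (\<forall>v\<in>W. \<exists>!e. e \<in> M \<and> v \<in> ends G e)"
      using 3[OF _ True] by simp
    show ?thesis unfolding pmatch_def 6 using 5 by (simp only: conj_assoc[symmetric])
  next
    case False
    then have "\<not> M \<subseteq> edges Gs" using 4 by blast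
    then show ?thesis unfolding pmatch_def using False by simp
  qed
qed

text \<open>The edge matched to \<open>None\<close> comes from some \<open>b\<close> outside
  \<open>L\<close>; a near-perfect matching that misses \<open>b\<close> covers the rest of
  \<open>Y\<close>.\<close>

lemma pmatch_shrink_NoneD:
  assumes W: "W \<subseteq> L" and M: "pmatch Gs (insert None (Some ` W)) M"
    and near: "\<And>e b. e \<in> cut G L \<Longrightarrow> b \<in> ends G e \<Longrightarrow> b \<in> Y \<Longrightarrow> \<exists>N. pmatch G (Y - {b}) N"
  shows "\<exists>M. pmatch G (W \<union> Y) M"
proof -
  obtain e where e: "e \<in> M" "None \<in> ends Gs e" using pmatchD(3)[OF M] by blast
  have eGs: "e \<in> edges Gs" using pmatchD(1)[OF M] e(1) by blast
  then obtain w where w: "ends Gs e = {None, w}" "None \<noteq> w"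
    using ends_other[OF finite_loopless_shrink eGs e(2)] by metis
  then obtain v where v: "w = Some v" by (cases w) auto
  obtain b where b: "b \<in> Y" "ends G e = {b, v}" "e \<in> cut G L" "v \<in> L"
    using ends_shrink_None[OF eGs] w v by metis
  have vW: "v \<in> W" using pmatchD(2)[OF M e(1)] w v by auto
  have "pmatch Gs (insert None (Some ` W) - ends Gs e) (M - {e})" by (rule pmatch_remove_edge[OF M e(1)])
  moreover have "insert None (Some ` W) - ends Gs e = Some ` (W - {v})" unfolding w(1) v by auto
  ultimately have "pmatch Gs (Some ` (W - {v})) (M - {e})" by simp
  then have 1: "pmatch G (W - {v}) (M - {e})" using pmatch_shrink[of "W - {v}" "M - {e}"] W by blast
  obtain N where N: "pmatch G (Y - {b}) N" using near[OF b(3) _ b(1)] b(2) by auto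
  have "pmatch G ((W - {v}) \<union> (Y - {b})) ((M - {e}) \<union> N)" using pmatch_Un[OF 1 N] W by blast
  moreover have "ends G e \<inter> ((W - {v}) \<union> (Y - {b})) = {}" unfolding b(2) using b(1) vW W by auto
  moreover have "e \<in> edges G" using eGs by (simp add: edges_shrink)
  ultimately have "pmatch G (ends G e \<union> ((W - {v}) \<union> (Y - {b}))) ({e} \<union> ((M - {e}) \<union> N))"
    using pmatch_Un[OF pmatch_edge] by metis
  moreover have "ends G e \<union> ((W - {v}) \<union> (Y - {b})) = W \<union> Y" unfolding b(2) using b(1) vW by auto
  ultimately show ?thesis by auto
qed

text \<open>The single edge of \<open>M\<close> in the cut becomes the edge at \<open>None\<close>;
  all other edges of \<open>M\<close> that meet \<open>L\<close> lie inside it.\<close>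

lemma pmatch_shrink_NoneI:
  assumes M: "pmatch G W M" and W: "Y \<subseteq> W" "W \<subseteq> verts G" and c: "card (M \<inter> cut G L) = 1"
  shows "\<exists>M. pmatch Gs (insert None (Some ` (W \<inter> L))) M"
proof -
  obtain e where e: "M \<inter> cut G L = {e}" using c by (auto simp: card_1_singleton_iff)
  then have eM: "e \<in> M" and ec: "e \<in> cut G L" by auto
  have eG: "e \<in> edges G" using ec by (simp add: cut_def)
  obtain v where v: "v \<in> ends G e" "v \<in> L" using ec by (auto simp: cut_def)
  obtain b where b: "ends G e = {v, b}" "v \<noteq> b" "b \<in> verts G" using ends_other[OF loopless eG v(1)] by metis
  have bL: "b \<notin> L" using ec b(1) v(2) by (auto simp: cut_def)
  have vW: "v \<in> W" using pmatchD(2)[OF M eM] v(1) by auto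
  let ?X = "W \<inter> L - {v}"
  have "pmatch G ?X {g \<in> M. ends G g \<subseteq> ?X}"
  proof (rule pmatch_restrict[OF M])
    show "?X \<subseteq> W" by auto
    fix g assume g: "g \<in> M"
    show "ends G g \<inter> ?X = {} \<or> ends G g \<subseteq> ?X"
    proof (cases "g = e")
      case True
      then show ?thesis using b(1) bL by auto
    next
      case False
      then have "g \<notin> cut G L" using e g by auto
      then have "ends G g \<inter> L = {} \<or> ends G g \<subseteq> L" using pmatchD(1)[OF M] g by (auto simp: cut_def)
      moreover have "v \<notin> ends G g" using pmatchD(4)[OF M, of e g v] eM g v(1) False by blast
      ultimately show ?thesis using pmatchD(2)[OF M g] by auto
    qed
  qed
  then obtain N where "pmatch Gs (Some ` ?X) N" using pmatch_shrink[of ?X] by blast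
  moreover have eGs: "e \<in> edges Gs" using eG v L_sub by (auto simp: edges_shrink)
  moreover have ends: "ends Gs e = {None, Some v}" unfolding ends_shrink[OF eG] b(1) using v bL by auto
  then have "ends Gs e \<inter> Some ` ?X = {}" by auto
  ultimately have "pmatch Gs (ends Gs e \<union> Some ` ?X) ({e} \<union> N)" using pmatch_Un[OF pmatch_edge] by metis
  moreover have "ends Gs e \<union> Some ` ?X = insert None (Some ` (W \<inter> L))" unfolding ends using vW v by auto
  ultimately show ?thesis by auto
qed

text \<open>Only the new parts outside \<open>L\<close> have to be checked for disjointness.\<close>

lemma model_lift:
  assumes m: "model Gs J s t f I Q"
    and f: "\<And>v. v \<in> verts J \<Longrightarrow> f' v \<in> verts G \<and> f v = pr (f' v)"
    and I: "\<And>e x. e \<in> edges J \<Longrightarrow> x \<in> set (I' e) \<Longrightarrow> x \<in> L \<Longrightarrow> Some x \<in> set (I e)"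
    and path: "\<And>e. e \<in> edges J \<Longrightarrow> is_path G (f' (s e) # I' e @ [f' (t e)]) (Q' e)"
    and even: "\<And>e. e \<in> edges J \<Longrightarrow> even (length (I' e))"
    and Yf: "\<And>e x. e \<in> edges J \<Longrightarrow> x \<in> set (I' e) \<Longrightarrow> x \<notin> L \<Longrightarrow> x \<notin> f' ` verts J"
    and YI: "\<And>e e' x. e \<in> edges J \<Longrightarrow> e' \<in> edges J \<Longrightarrow> e \<noteq> e' \<Longrightarrow> x \<in> set (I' e) \<Longrightarrow> x \<in> set (I' e') \<Longrightarrow> x \<in> L"
    and Q: "\<And>e q. e \<in> edges J \<Longrightarrow> q \<in> set (Q' e) \<Longrightarrow> \<not> ends G q \<subseteq> Y \<Longrightarrow> q \<in> set (Q e)"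
    and YQ: "\<And>e e' q. e \<in> edges J \<Longrightarrow> e' \<in> edges J \<Longrightarrow> e \<noteq> e' \<Longrightarrow> q \<in> set (Q' e) \<Longrightarrow> q \<in> set (Q' e') \<Longrightarrow>
      \<not> ends G q \<subseteq> Y"
  shows "model G J s t f' I' Q'"
  unfolding model_def
proof (intro conjI ballI impI)
  show "inj_on f' (verts J)"
    by (rule inj_onI) (use f modelD(1)[OF m] in \<open>metis inj_onD\<close>)
  show "f' ` verts J \<subseteq> verts G" using f by auto
  fix e assume e: "e \<in> edges J"
  show "is_path G (f' (s e) # I' e @ [f' (t e)]) (Q' e)" "even (length (I' e))" using path[OF e] even[OF e] .
  show "set (I' e) \<inter> f' ` verts J = {}"
  proof (rule equals0I)
    fix x assume x: "x \<in> set (I' e) \<inter> f' ` verts J"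
    then have xL: "x \<in> L" using Yf[OF e] by blast
    obtain v where v: "v \<in> verts J" "x = f' v" using x by auto
    have "f v = Some x" using f[OF v(1)] v(2) xL by simp
    moreover have "Some x \<in> set (I e)" using I[OF e] x xL by auto
    ultimately have "Some x \<in> set (I e) \<inter> f ` verts J" using v(1) by (metis IntI imageI)
    then show False using modelD(5)[OF m e] by simp
  qed
  fix e' assume e': "e' \<in> edges J" "e \<noteq> e'"
  show "set (I' e) \<inter> set (I' e') = {}"
  proof (rule equals0I)
    fix x assume x: "x \<in> set (I' e) \<inter> set (I' e')"
    then have "x \<in> L" using YI[OF e e'] by blast
    then have "Some x \<in> set (I e) \<inter> set (I e')" using I[OF e] I[OF e'(1)] x by simp
    then show False using modelD(6)[OF m e e'] by simp
  qed
  show "set (Q' e) \<inter> set (Q' e') = {}"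
  proof (rule equals0I)
    fix q assume q: "q \<in> set (Q' e) \<inter> set (Q' e')"
    then have "\<not> ends G q \<subseteq> Y" using YQ[OF e e'] by blast
    then have "q \<in> set (Q e) \<inter> set (Q e')" using Q[OF e] Q[OF e'(1)] q by simp
    then show False using modelD(7)[OF m e e'] by simp
  qed
qed

text \<open>Counterpart of \<open>model_lift\<close>: disjointness inside \<open>L\<close> is
  inherited from the given model, so only collisions at \<open>None\<close> must be
  excluded.\<close>

lemma model_push:
  assumes m: "model G J s t f I Q"
    and f: "inj_on f' (verts J)" "\<And>v. v \<in> verts J \<Longrightarrow> f' v \<in> verts Gs"
    and f_L: "\<And>v x. v \<in> verts J \<Longrightarrow> f' v = Some x \<Longrightarrow> x = f v"
    and path: "\<And>e. e \<in> edges J \<Longrightarrow> is_path Gs (f' (s e) # I' e @ [f' (t e)]) (Q' e)"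
    and even: "\<And>e. e \<in> edges J \<Longrightarrow> even (length (I' e))"
    and I: "\<And>e x. e \<in> edges J \<Longrightarrow> Some x \<in> set (I' e) \<Longrightarrow> x \<in> set (I e)"
    and If: "\<And>e. e \<in> edges J \<Longrightarrow> None \<in> set (I' e) \<Longrightarrow> None \<notin> f' ` verts J"
    and II: "\<And>e e'. e \<in> edges J \<Longrightarrow> e' \<in> edges J \<Longrightarrow> None \<in> set (I' e) \<Longrightarrow> None \<in> set (I' e') \<Longrightarrow> e = e'"
    and Q: "\<And>e. e \<in> edges J \<Longrightarrow> set (Q' e) \<subseteq> set (Q e)"
  shows "model Gs J s t f' I' Q'"
  unfolding model_def
proof (intro conjI ballI impI)
  show "inj_on f' (verts J)" by fact
  show "f' ` verts J \<subseteq> verts Gs" using f(2) by auto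
  fix e assume e: "e \<in> edges J"
  show "is_path Gs (f' (s e) # I' e @ [f' (t e)]) (Q' e)" "even (length (I' e))" using path[OF e] even[OF e] .
  show "set (I' e) \<inter> f' ` verts J = {}"
  proof (rule equals0I)
    fix x assume x: "x \<in> set (I' e) \<inter> f' ` verts J"
    then have "x \<in> set (I' e)" "x \<in> f' ` verts J" by simp_all
    then have "x \<noteq> None" using If[OF e] by metis
    then obtain y where y: "x = Some y" by (cases x) simp_all
    obtain v where v: "v \<in> verts J" "x = f' v" using x by auto
    have "y = f v" using f_L[OF v(1)] v(2) y by simp
    moreover have "y \<in> set (I e)" using I[OF e] x y by auto
    ultimately have "y \<in> set (I e) \<inter> f ` verts J" using v(1) by (metis IntI imageI)
    then show False using modelD(5)[OF m e] by simp
  qed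
  fix e' assume e': "e' \<in> edges J" "e \<noteq> e'"
  show "set (I' e) \<inter> set (I' e') = {}"
  proof (rule equals0I)
    fix x assume x: "x \<in> set (I' e) \<inter> set (I' e')"
    then have "x \<in> set (I' e)" "x \<in> set (I' e')" by simp_all
    then have "x \<noteq> None" using II[OF e e'(1)] e'(2) by metis
    then obtain y where "x = Some y" by (cases x) simp_all
    then have "y \<in> set (I e) \<inter> set (I e')" using I[OF e] I[OF e'(1)] x by simp
    then show False using modelD(6)[OF m e e'] by simp
  qed
  show "set (Q' e) \<inter> set (Q' e') = {}"
    using modelD(7)[OF m e e'] Q[OF e] Q[OF e'(1)] by blast
qed

end

section \<open>Lifting bisubdivisions out of a shrunken graph\<close>

context shrinking
begin

lemma model_lift_avoiding:
  assumes J: "finite_loopless J" "orientation J s t" and m: "model Gs J s t f I Q"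
    and no: "None \<notin> model_verts J f I"
  obtains f' I' U where "model G J s t f' I' Q" "U \<subseteq> L" "model_verts J f I = Some ` U" "model_verts J f' I' = U"
proof -
  define f' where "f' v = the (f v)" for v
  define I' where "I' e = map the (I e)" for e
  have sub: "model_verts J f I \<subseteq> Some ` L"
    using model_verts_subset[OF m] no unfolding verts_shrink by (auto split: if_splits)
  have f: "f v = Some (f' v)" "f' v \<in> L" if "v \<in> verts J" for v
  proof -
    have "f v \<in> Some ` L" using sub that by (auto simp: model_verts_def)
    then show "f v = Some (f' v)" "f' v \<in> L" by (auto simp: f'_def)
  qed
  have I: "I e = map Some (I' e)" "set (I' e) \<subseteq> L" if "e \<in> edges J" for e
  proof -
    have *: "set (I e) \<subseteq> Some ` L" using sub that by (auto simp: model_verts_def)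
    then show "I e = map Some (I' e)" by (auto simp: I'_def intro!: map_idI[symmetric])
    then have "Some ` set (I' e) \<subseteq> Some ` L" using * by simp
    then show "set (I' e) \<subseteq> L" by auto
  qed
  have fim: "f ` verts J = Some ` f' ` verts J" unfolding image_image by (rule image_cong[OF refl f(1)])
  have Iim: "(\<Union>e\<in>edges J. set (I e)) = Some ` (\<Union>e\<in>edges J. set (I' e))" using I(1) by auto
  have U: "model_verts J f I = Some ` model_verts J f' I'" unfolding model_verts_def fim Iim by auto
  have UL: "model_verts J f' I' \<subseteq> L" unfolding model_verts_def using f(2) I(2) by auto
  have "model G J s t f' I' Q"
  proof (rule model_lift[OF m])
    show "f' v \<in> verts G \<and> f v = pr (f' v)" if "v \<in> verts J" for v
      using f[OF that] L_sub by auto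
    fix e assume e: "e \<in> edges J"
    show "Some x \<in> set (I e)" if "x \<in> set (I' e)" for x using that I(1)[OF e] by simp
    show "is_path G (f' (s e) # I' e @ [f' (t e)]) (Q e)"
    proof -
      have "set (f' (s e) # I' e @ [f' (t e)]) \<subseteq> L"
        using f(2) I(2)[OF e] orientationD(2,3)[OF J e] by auto
      moreover have "f (s e) # I e @ [f (t e)] = map Some (f' (s e) # I' e @ [f' (t e)])"
        using f(1) I(1)[OF e] orientationD(2,3)[OF J e] by simp
      ultimately show ?thesis using modelD(3)[OF m e] shrink_path by metis
    qed
    show "even (length (I' e))" using modelD(4)[OF m e] by (simp add: I'_def)
    show "x \<notin> f' ` verts J" if "x \<in> set (I' e)" "x \<notin> L" for x using that I(2)[OF e] by auto
    show "x \<in> L" if "x \<in> set (I' e)" for x using that I(2)[OF e] by auto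
    show "\<not> ends G q \<subseteq> Y" if "q \<in> set (Q e)" for q
      using that is_pathD(5)[OF modelD(3)[OF m e]] by (auto simp: edges_shrink)
  qed
  then show thesis using that[OF _ UL U] by blast
qed

lemma based_lift_avoiding:
  assumes J: "finite_loopless J" "orientation J s t" and m: "model Gs J s t f I Q"
    and no: "None \<notin> model_verts J f I"
    and M: "pmatch Gs (verts Gs - model_verts J f I) M"
    and near: "\<And>e b. e \<in> cut G L \<Longrightarrow> b \<in> ends G e \<Longrightarrow> b \<in> Y \<Longrightarrow> \<exists>N. pmatch G (Y - {b}) N"
  shows "based J G"
proof -
  obtain f' I' U where m': "model G J s t f' I' Q" and U: "U \<subseteq> L" "model_verts J f I = Some ` U"
    "model_verts J f' I' = U" using model_lift_avoiding[OF J m no] .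
  have "\<exists>N. pmatch G (verts G - U) N"
  proof (cases "Y = {}")
    case True
    then have "verts G - U = L - U" using L_sub by auto
    moreover have "verts Gs - Some ` U = Some ` (L - U)" using True by (auto simp: verts_shrink)
    ultimately show ?thesis using M pmatch_shrink[of "L - U" M] U(2) by auto
  next
    case False
    then have "verts Gs - Some ` U = insert None (Some ` (L - U))" by (auto simp: verts_shrink)
    then have "pmatch Gs (insert None (Some ` (L - U))) M" using M U(2) by simp
    from pmatch_shrink_NoneD[OF Diff_subset this near]
    have "\<exists>N. pmatch G ((L - U) \<union> Y) N" .
    moreover have "(L - U) \<union> Y = verts G - U" using L_sub U(1) by auto
    ultimately show ?thesis by simp
  qed
  then show ?thesis unfolding based_iff_model[OF J] using m' U(3) by blast
qed

end

context odd_blobs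
begin

lemma near_matching_cut:
  assumes L: "L \<in> Ks" and "e \<in> cut G L" "b \<in> ends G e" "b \<in> verts G - L"
  shows "\<exists>N. near_matching (verts G - L) b N"
proof -
  obtain b' v where bv: "b' \<in> B" "v \<in> L" "ends G e = {b', v}" using cut_blob_ends[OF L assms(2)] .
  then have "b \<in> B" using assms(3,4) by auto
  then show ?thesis using near_matchingI[OF L assms(2,3)] by blast
qed

text \<open>\<open>None\<close> is the image of the branch vertex \<open>z\<close>. The centre
  \<open>w\<close> of an even star takes its place, and the three legs are prefixed to the paths at
  \<open>z\<close>, all of which start there by the choice of orientation.\<close>

lemma based_lift_branch:
  assumes J: "finite_loopless J" and cub: "cubic J" and L: "L \<in> Ks" and o: "orientation J s t"
    and z: "z \<in> verts J" "f z = None" and sz: "\<And>e. e \<in> edges J \<Longrightarrow> z \<in> ends J e \<Longrightarrow> s e = z"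
    and m: "model (shrink G (verts G - L)) J s t f I Q"
    and M: "pmatch (shrink G (verts G - L)) (verts (shrink G (verts G - L)) - model_verts J f I) M"
  shows "based J G"
proof -
  have L_sub: "L \<subseteq> verts G" using blob_subset[OF L] by auto
  interpret shrinking G L by (rule shrinking.intro[OF G L_sub])
  define A where "A = {e \<in> edges J. z \<in> ends J e}"
  have cardA: "card A = 3" using cub z(1) by (simp add: A_def cubic_def degree_def)
  define f0 where "f0 v = the (f v)" for v
  define I0 where "I0 e = map the (I e)" for e
  define R where "R e = I0 e @ [f0 (t e)]" for e
  have V_Some: "x = Some (the x) \<and> the x \<in> L" if "x \<in> verts Gs" "x \<noteq> None" for x
    using that by (auto simp: verts_shrink split: if_splits)
  have f0: "f v = Some (f0 v)" "f0 v \<in> L" if "v \<in> verts J" "v \<noteq> z" for v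
  proof -
    have "f v \<noteq> f z" using inj_onD[OF modelD(1)[OF m]] that z(1) by metis
    moreover have "f v \<in> verts Gs" using modelD(2)[OF m] that(1) by auto
    ultimately show "f v = Some (f0 v)" "f0 v \<in> L" using V_Some[of "f v"] z(2) by (simp_all add: f0_def)
  qed
  have I0: "I e = map Some (I0 e)" "set (I0 e) \<subseteq> L" if e: "e \<in> edges J" for e
  proof -
    have "x = Some (the x) \<and> the x \<in> L" if "x \<in> set (I e)" for x
    proof (rule V_Some)
      show "x \<in> verts Gs" using is_pathD(4)[OF modelD(3)[OF m e]] that by auto
      have "None \<in> f ` verts J" using z by (metis image_eqI)
      then show "x \<noteq> None" using modelD(5)[OF m e] that by auto
    qed
    then show "I e = map Some (I0 e)" "set (I0 e) \<subseteq> L" by (auto simp: I0_def intro!: map_idI[symmetric])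
  qed
  have tz: "t e \<noteq> z" if "e \<in> edges J" for e
    using sz[OF that] orientationD(1,4)[OF J o that] by auto
  have R: "set (R e) \<subseteq> L" "R e \<noteq> []" "I e @ [f (t e)] = map Some (R e)" if e: "e \<in> edges J" for e
    using I0[OF e] f0[OF orientationD(3)[OF J o e] tz[OF e]] by (auto simp: R_def)
  have Ae: "e \<in> edges J" "s e = z" if "e \<in> A" for e using that sz by (auto simp: A_def)
  have "\<exists>b. b \<in> Y \<and> (\<exists>N. near_matching Y b N) \<and> is_path G (b # R a) (Q a)" if a: "a \<in> A" for a
  proof -
    have "is_path Gs (None # map Some (R a)) (Q a)"
      using modelD(3)[OF m Ae(1)[OF a]] unfolding Ae(2)[OF a] z(2) R(3)[OF Ae(1)[OF a]] .
    then obtain b h where "b \<in> Y" "h \<in> cut G L" "b \<in> ends G h" "is_path G (b # R a) (Q a)"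
      using shrink_path_NoneD[OF R(1,2)[OF Ae(1)[OF a]]] by metis
    then show ?thesis using near_matching_cut[OF L] by metis
  qed
  then have "\<forall>a\<in>A. \<exists>b. b \<in> Y \<and> (\<exists>N. near_matching Y b N) \<and> is_path G (b # R a) (Q a)" by simp
  from bchoice[OF this] obtain b where b: "\<And>a. a \<in> A \<Longrightarrow> \<exists>N. near_matching Y (b a) N"
    "\<And>a. a \<in> A \<Longrightarrow> is_path G (b a # R a) (Q a)" by auto
  have "\<exists>w V E N. w \<in> Y \<and> w \<in> B \<and>
    (\<forall>i\<in>A. is_path G (w # V i) (E i) \<and> last (w # V i) = b i \<and> even (length (V i)) \<and> set (V i) \<subseteq> Y) \<and>
    (\<forall>i\<in>A. \<forall>j\<in>A. i \<noteq> j \<longrightarrow> set (V i) \<inter> set (V j) = {}) \<and>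
    pmatch G (Y - ({w} \<union> (\<Union>i\<in>A. set (V i)))) N"
    by (rule near_matching_star[where b = b, OF Diff_subset cardA b(1)])
  then obtain w V E N where w: "w \<in> Y" "w \<in> B"
    and V': "\<forall>i\<in>A. is_path G (w # V i) (E i) \<and> last (w # V i) = b i \<and> even (length (V i)) \<and> set (V i) \<subseteq> Y"
    "\<forall>i\<in>A. \<forall>j\<in>A. i \<noteq> j \<longrightarrow> set (V i) \<inter> set (V j) = {}"
    and N: "pmatch G (Y - ({w} \<union> (\<Union>i\<in>A. set (V i)))) N" by (elim exE conjE)
  have V: "\<And>i. i \<in> A \<Longrightarrow> is_path G (w # V i) (E i)" "\<And>i. i \<in> A \<Longrightarrow> last (w # V i) = b i"
    "\<And>i. i \<in> A \<Longrightarrow> even (length (V i))" "\<And>i. i \<in> A \<Longrightarrow> set (V i) \<subseteq> Y"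
    "\<And>i j. i \<in> A \<Longrightarrow> j \<in> A \<Longrightarrow> i \<noteq> j \<Longrightarrow> set (V i) \<inter> set (V j) = {}"
    using V' by simp_all
  define f' where "f' v = (if v = z then w else f0 v)" for v
  define I' where "I' e = (if e \<in> A then V e else []) @ I0 e" for e
  define Q' where "Q' e = (if e \<in> A then E e else []) @ Q e" for e
  have f'z: "f' z = w" and f'_ne: "v \<noteq> z \<Longrightarrow> f' v = f0 v" for v by (simp_all add: f'_def)
  have f'V: "x = w \<or> x \<in> L" if "x \<in> f' ` verts J" for x using that f0(2) by (auto simp: f'_def)
  have wL: "w \<notin> L" using w(1) by simp
  \<comment> \<open>Edges of the legs lie inside \<open>Y\<close>, edges that survive shrinking do
    not, so the two kinds never coincide.\<close>
  have EY: "ends G q \<subseteq> Y" if "e \<in> A" "q \<in> set (E e)" for e q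
    using is_path_ends[OF V(1)[OF that(1)] that(2)] V(4)[OF that(1)] w(1) by auto
  have QY: "\<not> ends G q \<subseteq> Y" if "e \<in> edges J" "q \<in> set (Q e)" for e q
    using is_pathD(5)[OF modelD(3)[OF m that(1)]] that(2) by (auto simp: edges_shrink)
  have I'Y: "e \<in> A \<and> x \<in> set (V e)" if "e \<in> edges J" "x \<in> set (I' e)" "x \<notin> L" for e x
    using that I0(2)[OF that(1)] by (auto simp: I'_def split: if_splits)
  have m': "model G J s t f' I' Q'"
  proof (rule model_lift[OF m])
    show "f' v \<in> verts G \<and> f v = pr (f' v)" if "v \<in> verts J" for v
    proof (cases "v = z")
      case True
      then show ?thesis using w z(2) wL f'z by simp
    next
      case False
      then show ?thesis using f0[OF that False] f'_ne[OF False] L_sub by auto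
    qed
    fix e assume e: "e \<in> edges J"
    show "Some x \<in> set (I e)" if x: "x \<in> set (I' e)" "x \<in> L" for x
    proof -
      have "x \<notin> set (V e)" if "e \<in> A" using V(4)[OF that] x(2) by auto
      then have "x \<in> set (I0 e)" using x(1) by (auto simp: I'_def split: if_splits)
      then show ?thesis using I0(1)[OF e] by simp
    qed
    show "is_path G (f' (s e) # I' e @ [f' (t e)]) (Q' e)"
    proof (cases "e \<in> A")
      case True
      have "is_path G ((w # V e) @ R e) (E e @ Q e)"
      proof (rule is_path_append[OF V(1)[OF True]])
        show "is_path G (last (w # V e) # R e) (Q e)" unfolding V(2)[OF True] by (rule b(2)[OF True])
        show "set (w # V e) \<inter> set (R e) = {}" using V(4)[OF True] w(1) R(1)[OF e] by auto
      qed
      then show ?thesis using True Ae(2)[OF True] f'z f'_ne[OF tz[OF e]] by (simp add: I'_def Q'_def R_def)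
    next
      case False
      then have sz': "s e \<noteq> z" using e orientationD(1)[OF J o e] by (auto simp: A_def)
      have fs: "f (s e) = Some (f0 (s e))" "f0 (s e) \<in> L" using f0[OF orientationD(2)[OF J o e] sz'] .
      have "is_path Gs (map Some (f0 (s e) # R e)) (Q e)"
        using modelD(3)[OF m e] fs(1) R(3)[OF e] by simp
      then have "is_path G (f0 (s e) # R e) (Q e)" using shrink_path[of "f0 (s e) # R e"] fs(2) R(1)[OF e] by simp
      then show ?thesis using False f'_ne[OF sz'] f'_ne[OF tz[OF e]] by (simp add: I'_def Q'_def R_def)
    qed
    have "length (I0 e) = length (I e)" by (simp add: I0_def)
    then show "even (length (I' e))" using modelD(4)[OF m e] V(3)[of e] by (simp add: I'_def)
    show "x \<notin> f' ` verts J" if x: "x \<in> set (I' e)" "x \<notin> L" for x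
    proof -
      have eA: "e \<in> A" "x \<in> set (V e)" using I'Y[OF e x] by simp_all
      have "x \<noteq> w" using is_pathD(3)[OF V(1)[OF eA(1)]] eA(2) by auto
      then show ?thesis using f'V x(2) by blast
    qed
    show "q \<in> set (Q e)" if "q \<in> set (Q' e)" "\<not> ends G q \<subseteq> Y" for q
      using that EY[of e q] by (auto simp: Q'_def split: if_splits)
    fix e' assume e': "e' \<in> edges J" "e \<noteq> e'"
    show "x \<in> L" if "x \<in> set (I' e)" "x \<in> set (I' e')" for x
    proof (rule ccontr)
      assume xL: "x \<notin> L"
      have "e \<in> A" "x \<in> set (V e)" "e' \<in> A" "x \<in> set (V e')"
        using I'Y[OF e that(1) xL] I'Y[OF e'(1) that(2) xL] by simp_all
      then show False using V(5)[of e e'] e'(2) by auto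
    qed
    show "\<not> ends G q \<subseteq> Y" if q: "q \<in> set (Q' e)" "q \<in> set (Q' e')" for q
    proof
      assume qY: "ends G q \<subseteq> Y"
      then have "q \<notin> set (Q e)" "q \<notin> set (Q e')" using QY[OF e] QY[OF e'(1)] by auto
      then have q': "e \<in> A" "q \<in> set (E e)" "e' \<in> A" "q \<in> set (E e')"
        using q by (auto simp: Q'_def split: if_splits)
      have "set (w # V e) \<inter> set (w # V e') \<subseteq> {w}" using V(5)[OF q'(1,3) e'(2)] by auto
      then have "set (E e) \<inter> set (E e') = {}"
        by (rule is_path_edges_disjoint[OF G V(1)[OF q'(1)] V(1)[OF q'(3)]])
      then show False using q' by auto
    qed
  qed
  \<comment> \<open>The part of the model in \<open>L\<close>, common to the shrunken and the lifted
    model.\<close>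
  define U where "U = f0 ` (verts J - {z}) \<union> (\<Union>e\<in>edges J. set (I0 e))"
  have UL: "U \<subseteq> L" unfolding U_def using f0(2) I0(2) by auto
  have "f ` verts J = insert None (f ` (verts J - {z}))" using z by (metis image_insert insert_Diff)
  also have "f ` (verts J - {z}) = Some ` f0 ` (verts J - {z})"
    unfolding image_image by (rule image_cong[OF refl]) (use f0(1) in auto)
  finally have "model_verts J f I = insert None (Some ` U)"
    unfolding model_verts_def U_def image_Un image_UN using I0(1) by auto
  then have "verts Gs - model_verts J f I = Some ` (L - U)" by (auto simp: verts_shrink split: if_splits)
  then have "pmatch G (L - U) M" using M pmatch_shrink[of "L - U" M] by auto
  then have "pmatch G ((L - U) \<union> (Y - ({w} \<union> (\<Union>i\<in>A. set (V i))))) (M \<union> N)"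
    by (rule pmatch_Un[OF _ N]) auto
  moreover have "(L - U) \<union> (Y - ({w} \<union> (\<Union>i\<in>A. set (V i)))) = verts G - model_verts J f' I'"
  proof -
    have "f' ` verts J = insert (f' z) (f' ` (verts J - {z}))" using z(1) by (metis image_insert insert_Diff)
    also have "f' ` (verts J - {z}) = f0 ` (verts J - {z})" by (rule image_cong[OF refl]) (use f'_ne in auto)
    finally have 1: "f' ` verts J = insert w (f0 ` (verts J - {z}))" unfolding f'z .
    have 2: "(\<Union>e\<in>edges J. set (I' e)) = (\<Union>i\<in>A. set (V i)) \<union> (\<Union>e\<in>edges J. set (I0 e))"
      using Ae(1) by (auto simp: I'_def split: if_splits)
    have mv: "model_verts J f' I' = ({w} \<union> (\<Union>i\<in>A. set (V i))) \<union> U"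
      unfolding model_verts_def 1 2 U_def by auto
    have "({w} \<union> (\<Union>i\<in>A. set (V i))) \<subseteq> Y" using w(1) V(4) by auto
    then show ?thesis unfolding mv using UL L_sub by blast
  qed
  ultimately have "pmatch G (verts G - model_verts J f' I') (M \<union> N)" by simp
  then show ?thesis unfolding based_iff_model[OF J o] using m' by blast
qed

text \<open>\<open>None\<close> is an internal vertex of one path, where two cut edges meet. An even
  alternating path between their ends outside \<open>L\<close> takes its place.\<close>

lemma based_lift_inner:
  assumes J: "finite_loopless J" and L: "L \<in> Ks" and o: "orientation J s t"
    and e0: "e0 \<in> edges J" "None \<in> set (I e0)"
    and m: "model (shrink G (verts G - L)) J s t f I Q"
    and M: "pmatch (shrink G (verts G - L)) (verts (shrink G (verts G - L)) - model_verts J f I) M"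
  shows "based J G"
proof -
  have L_sub: "L \<subseteq> verts G" using blob_subset[OF L] by auto
  interpret shrinking G L by (rule shrinking.intro[OF G L_sub])
  define f0 where "f0 v = the (f v)" for v
  have V_Some: "x = Some (the x) \<and> the x \<in> L" if "x \<in> verts Gs" "x \<noteq> None" for x
    using that by (auto simp: verts_shrink split: if_splits)
  have f0: "f v = Some (f0 v)" "f0 v \<in> L" if v: "v \<in> verts J" for v
  proof -
    have "f v \<noteq> None" using modelD(5)[OF m e0(1)] e0(2) v by force
    moreover have "f v \<in> verts Gs" using modelD(2)[OF m] v by auto
    ultimately show "f v = Some (f0 v)" "f0 v \<in> L" using V_Some[of "f v"] by (simp_all add: f0_def)
  qed
  have pull: "xs = map Some (map the xs)" "set (map the xs) \<subseteq> L" if "set xs \<subseteq> verts Gs" "None \<notin> set xs" for xs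
  proof -
    have "x = Some (the x) \<and> the x \<in> L" if "x \<in> set xs" for x
    proof (rule V_Some)
      show "x \<in> verts Gs" using \<open>x \<in> set xs\<close> \<open>set xs \<subseteq> verts Gs\<close> by blast
      show "x \<noteq> None" using \<open>x \<in> set xs\<close> \<open>None \<notin> set xs\<close> by metis
    qed
    then show "xs = map Some (map the xs)" "set (map the xs) \<subseteq> L" by (auto intro!: map_idI[symmetric])
  qed
  have IV: "set (I e) \<subseteq> verts Gs" if "e \<in> edges J" for e
    using is_pathD(4)[OF modelD(3)[OF m that]] by auto
  obtain xs ys where xys: "I e0 = xs @ None # ys" using e0(2) by (metis split_list)
  have dist: "distinct (I e0)" using is_pathD(3)[OF modelD(3)[OF m e0(1)]] by simp
  define xs0 where "xs0 = map the xs"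
  define ys0 where "ys0 = map the ys"
  have xs0: "xs = map Some xs0" "set xs0 \<subseteq> L" and ys0: "ys = map Some ys0" "set ys0 \<subseteq> L"
    using pull[of xs] pull[of ys] IV[OF e0(1)] dist unfolding xys xs0_def ys0_def by simp_all
  define I0 where "I0 e = map the (I e)" for e
  have I0: "I e = map Some (I0 e)" "set (I0 e) \<subseteq> L" if e: "e \<in> edges J" "e \<noteq> e0" for e
  proof -
    have "None \<notin> set (I e)" using modelD(6)[OF m e(1) e0(1) e(2)] e0(2) by auto
    then show "I e = map Some (I0 e)" "set (I0 e) \<subseteq> L" using pull[OF IV[OF e(1)]] unfolding I0_def by simp_all
  qed
  have sV: "s e0 \<in> verts J" "t e0 \<in> verts J" using orientationD(2,3)[OF J o e0(1)] .
  let ?xs = "f0 (s e0) # xs0" and ?ys = "ys0 @ [f0 (t e0)]"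
  have xsL: "set ?xs \<subseteq> L" "set (rev ?xs) \<subseteq> L" "rev ?xs \<noteq> []" and ysL: "set ?ys \<subseteq> L" "?ys \<noteq> []"
    using f0(2)[OF sV(1)] f0(2)[OF sV(2)] xs0(2) ys0(2) by auto
  have "is_path Gs (map Some ?xs @ None # map Some ?ys) (Q e0)"
    using modelD(3)[OF m e0(1)] f0(1)[OF sV(1)] f0(1)[OF sV(2)] xys xs0(1) ys0(1) by simp
  then obtain es1 es2 where es: "Q e0 = es1 @ es2" "is_path Gs (map Some ?xs @ [None]) es1"
    "is_path Gs (None # map Some ?ys) es2" using is_path_split by metis
  \<comment> \<open>Reversed, so that both halves of the path start at \<open>None\<close>.\<close>
  have "is_path Gs (None # map Some (rev ?xs)) (rev es1)"
    using is_path_rev[OF es(2)] by (simp add: rev_map)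
  then obtain b1 h1 where b1: "b1 \<in> Y" "h1 \<in> cut G L" "b1 \<in> ends G h1" "is_path G (b1 # rev ?xs) (rev es1)"
    using shrink_path_NoneD[OF xsL(2,3)] by metis
  obtain b2 h2 where b2: "b2 \<in> Y" "h2 \<in> cut G L" "b2 \<in> ends G h2" "is_path G (b2 # ?ys) es2"
    using shrink_path_NoneD[OF ysL es(3)] by metis
  have p1: "is_path G (?xs @ [b1]) es1" using is_path_rev[OF b1(4)] by simp
  obtain N1 N2 where "near_matching Y b1 N1" "near_matching Y b2 N2"
    using near_matching_cut[OF L b1(2,3,1)] near_matching_cut[OF L b2(2,3,1)] by blast
  from near_matching_path[OF Diff_subset this]
  obtain vs es N where vs: "is_path G vs es" "hd vs = b1" "last vs = b2" "even (length es)" "set vs \<subseteq> Y"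
    and N: "pmatch G (Y - set vs) N" by metis
  obtain ws where ws: "vs = b1 # ws" using vs(2) is_pathD(1)[OF vs(1)] by (cases vs) auto
  have "is_path G ((?xs @ [b1]) @ ws) (es1 @ es)"
  proof (rule is_path_append[OF p1])
    show "is_path G (last (?xs @ [b1]) # ws) es" using vs(1) ws by simp
    have "b1 \<notin> set ws" using is_pathD(3)[OF vs(1)] ws by simp
    then show "set (?xs @ [b1]) \<inter> set ws = {}" using xsL(1) vs(5) ws by auto
  qed
  then have p2: "is_path G (?xs @ vs) (es1 @ es)" using ws by simp
  have p3: "is_path G ((?xs @ vs) @ ?ys) ((es1 @ es) @ es2)"
  proof (rule is_path_append[OF p2])
    have "last (?xs @ vs) = b2" using vs(3) ws by simp
    then show "is_path G (last (?xs @ vs) # ?ys) es2" using b2(4) by simp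
    have d: "distinct (f (s e0) # I e0 @ [f (t e0)])" using is_pathD(3)[OF modelD(3)[OF m e0(1)]] .
    have "distinct (map Some (?xs @ ?ys))" using d unfolding xys xs0(1) ys0(1) f0(1)[OF sV(1)] f0(1)[OF sV(2)] by auto
    then have "distinct (?xs @ ?ys)" unfolding distinct_map by blast
    then have "set ?xs \<inter> set ?ys = {}" unfolding distinct_append by blast
    moreover have "set vs \<inter> set ?ys = {}" using ysL(1) vs(5) by blast
    ultimately show "set (?xs @ vs) \<inter> set ?ys = {}" unfolding set_append by blast
  qed
  define I' where "I' e = (if e = e0 then xs0 @ vs @ ys0 else I0 e)" for e
  define Q' where "Q' e = (if e = e0 then es1 @ es @ es2 else Q e)" for e
  have QY: "\<not> ends G q \<subseteq> Y" if "e \<in> edges J" "q \<in> set (Q e)" for e q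
    using is_pathD(5)[OF modelD(3)[OF m that(1)]] that(2) by (auto simp: edges_shrink)
  have EY: "ends G q \<subseteq> Y" if "q \<in> set es" for q using is_path_ends[OF vs(1) that] vs(5) by blast
  have m': "model G J s t f0 I' Q'"
  proof (rule model_lift[OF m])
    show "f0 v \<in> verts G \<and> f v = pr (f0 v)" if "v \<in> verts J" for v
      using f0[OF that] L_sub by auto
    fix e assume e: "e \<in> edges J"
    show "Some x \<in> set (I e)" if x: "x \<in> set (I' e)" "x \<in> L" for x
    proof (cases "e = e0")
      case True
      then have "x \<in> set xs0 \<union> set ys0" using x vs(5) by (auto simp: I'_def)
      then show ?thesis unfolding True xys xs0(1) ys0(1) by auto
    next
      case False
      then have "x \<in> set (I0 e)" using x(1) by (simp add: I'_def)
      then show ?thesis using I0(1)[OF e False] by simp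
    qed
    show "is_path G (f0 (s e) # I' e @ [f0 (t e)]) (Q' e)"
    proof (cases "e = e0")
      case True
      then show ?thesis using p3 by (simp add: I'_def Q'_def)
    next
      case False
      let ?l = "f0 (s e) # I0 e @ [f0 (t e)]"
      have V: "s e \<in> verts J" "t e \<in> verts J" using orientationD(2,3)[OF J o e] .
      have "is_path Gs (map Some ?l) (Q e)"
        using modelD(3)[OF m e] f0(1)[OF V(1)] f0(1)[OF V(2)] I0(1)[OF e False] by simp
      then have "is_path G ?l (Q e)" using shrink_path[of ?l] f0(2)[OF V(1)] f0(2)[OF V(2)] I0(2)[OF e False] by simp
      then show ?thesis using False by (simp add: I'_def Q'_def)
    qed
    \<comment> \<open>\<open>vs\<close> has an odd number of vertices and replaces the single vertex
      \<open>None\<close>, so evenness survives.\<close>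
    have "length vs = Suc (length es)" using is_pathD(2)[OF vs(1)] .
    then have "odd (length vs)" using vs(4) by simp
    moreover have "length xs0 = length xs" "length ys0 = length ys" by (simp_all add: xs0_def ys0_def)
    moreover have "even (length xs + Suc (length ys))" using modelD(4)[OF m e0(1)] xys by simp
    moreover have "length (I0 e) = length (I e)" by (simp add: I0_def)
    ultimately show "even (length (I' e))" using modelD(4)[OF m e] by (simp add: I'_def)
    show "x \<notin> f0 ` verts J" if "x \<in> set (I' e)" "x \<notin> L" for x using that f0(2) by auto
    show "q \<in> set (Q e)" if "q \<in> set (Q' e)" "\<not> ends G q \<subseteq> Y" for q
      using that EY es(1) by (auto simp: Q'_def split: if_splits)
    fix e' assume e': "e' \<in> edges J" "e \<noteq> e'"
    show "x \<in> L" if "x \<in> set (I' e)" "x \<in> set (I' e')" for x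
    proof (cases "e = e0")
      case True
      then have "x \<in> set (I0 e')" using that(2) e'(2) by (simp add: I'_def)
      then show ?thesis using I0(2)[OF e'(1)] True e'(2) by blast
    next
      case False
      then have "x \<in> set (I0 e)" using that(1) by (simp add: I'_def)
      then show ?thesis using I0(2)[OF e False] by blast
    qed
    show "\<not> ends G q \<subseteq> Y" if "q \<in> set (Q' e)" "q \<in> set (Q' e')" for q
    proof (cases "e = e0")
      case True
      then have "q \<in> set (Q e')" using that(2) e'(2) by (simp add: Q'_def)
      then show ?thesis using QY[OF e'(1)] by blast
    next
      case False
      then have "q \<in> set (Q e)" using that(1) by (simp add: Q'_def)
      then show ?thesis using QY[OF e] by blast
    qed
  qed
  define U where "U = f0 ` verts J \<union> (set xs0 \<union> set ys0 \<union> (\<Union>e\<in>edges J - {e0}. set (I0 e)))"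
  have UL: "U \<subseteq> L" unfolding U_def using f0(2) I0(2) xs0(2) ys0(2) by auto
  have split: "(\<Union>e\<in>edges J. X e) = X e0 \<union> (\<Union>e\<in>edges J - {e0}. X e)" for X :: "'d \<Rightarrow> 'x set"
    using e0(1) by auto
  have "f ` verts J = Some ` f0 ` verts J" unfolding image_image by (rule image_cong[OF refl f0(1)])
  moreover have "(\<Union>e\<in>edges J - {e0}. set (I e)) = Some ` (\<Union>e\<in>edges J - {e0}. set (I0 e))"
    using I0(1) by (auto simp: image_UN)
  ultimately have "model_verts J f I = insert None (Some ` U)"
    unfolding model_verts_def U_def split[of "\<lambda>e. set (I e)"] image_Un xys xs0(1) ys0(1) by auto
  then have "verts Gs - model_verts J f I = Some ` (L - U)" by (auto simp: verts_shrink split: if_splits)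
  then have "pmatch G (L - U) M" using M pmatch_shrink[of "L - U" M] by auto
  then have "pmatch G ((L - U) \<union> (Y - set vs)) (M \<union> N)" by (rule pmatch_Un[OF _ N]) auto
  moreover have "(L - U) \<union> (Y - set vs) = verts G - model_verts J f0 I'"
  proof -
    have "(\<Union>e\<in>edges J - {e0}. set (I' e)) = (\<Union>e\<in>edges J - {e0}. set (I0 e))"
      by (auto simp: I'_def)
    then have mv: "model_verts J f0 I' = set vs \<union> U"
      unfolding model_verts_def split[of "\<lambda>e. set (I' e)"] U_def by (auto simp: I'_def)
    show ?thesis unfolding mv using UL L_sub vs(5) by blast
  qed
  ultimately have "pmatch G (verts G - model_verts J f0 I') (M \<union> N)" by simp
  then show ?thesis unfolding based_iff_model[OF J o] using m' by blast
qed

lemma based_from_shrink: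
  assumes J: "finite_loopless J" and cub: "cubic J" and L: "L \<in> Ks"
    and based: "based J (shrink G (verts G - L))"
  shows "based J G"
proof -
  have L_sub: "L \<subseteq> verts G" using blob_subset[OF L] by auto
  interpret shrinking G L by (rule shrinking.intro[OF G L_sub])
  obtain s t where o: "orientation J s t" using orientation_from[OF J] by metis
  obtain f I Q M where m: "model Gs J s t f I Q" and M: "pmatch Gs (verts Gs - model_verts J f I) M"
    using based unfolding based_iff_model[OF J o] by blast
  consider (avoid) "None \<notin> model_verts J f I" | (branch) "None \<in> f ` verts J"
    | (inner) e where "e \<in> edges J" "None \<in> set (I e)"
    unfolding model_verts_def by blast
  then show ?thesis
  proof cases
    case avoid
    have "\<exists>N. pmatch G (Y - {b}) N" if "e \<in> cut G L" "b \<in> ends G e" "b \<in> Y" for e b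
      using near_matching_cut[OF L that] by (auto simp: near_matching_def)
    then show ?thesis using based_lift_avoiding[OF J o m avoid M] by blast
  next
    case branch
    then obtain z where z: "z \<in> verts J" "f z = None" by auto
    obtain s' t' where o': "orientation J s' t'" and s'z: "\<And>e. e \<in> edges J \<Longrightarrow> z \<in> ends J e \<Longrightarrow> s' e = z"
      using orientation_from[OF J, of z] by metis
    obtain I' Q' where m': "model Gs J s' t' f I' Q'" and mv: "model_verts J f I' = model_verts J f I"
      using model_reorient[OF J o o' m] .
    have M': "pmatch Gs (verts Gs - model_verts J f I') M" using M mv by simp
    show ?thesis by (rule based_lift_branch[OF J cub L o' z s'z m' M'])
  next
    case inner
    then show ?thesis by (rule based_lift_inner[OF J L o _ _ m M])
  qed
qed

end

subsection \<open>Crossing edges of a model\<close>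

lemma path_hd_degree:
  assumes "is_path G (b # ys) es"
  shows "card {q \<in> set es. b \<in> ends G q} \<le> 1"
proof (cases ys)
  case Nil
  then show ?thesis using assms by simp
next
  case (Cons y ys')
  then obtain e es' where e: "es = e # es'" "b \<notin> set (y # ys')" "is_path G (y # ys') es'"
    using assms unfolding Cons is_path_Cons_iff by blast
  have "q = e" if "q \<in> set es" "b \<in> ends G q" for q
  proof (rule ccontr)
    assume "q \<noteq> e"
    then have "q \<in> set es'" using that(1) e(1) by simp
    then show False using is_path_ends[OF e(3)] that(2) e(2) by blast
  qed
  then have "{q \<in> set es. b \<in> ends G q} \<subseteq> {e}" by blast
  then show ?thesis using card_mono[of "{e}"] by simp
qed

lemma path_last_degree:
  assumes "is_path G (xs @ [b]) es"
  shows "card {q \<in> set es. b \<in> ends G q} \<le> 1"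
  using path_hd_degree[of G b "rev xs" "rev es"] is_path_rev[OF assms] by simp

lemma path_degree:
  assumes "is_path G (xs @ b # ys) es"
  shows "card {q \<in> set es. b \<in> ends G q} \<le> 2"
proof -
  obtain es1 es2 where es: "es = es1 @ es2" "is_path G (xs @ [b]) es1" "is_path G (b # ys) es2"
    using is_path_split[OF assms] .
  have eq: "{q \<in> set es. b \<in> ends G q} = {q \<in> set es1. b \<in> ends G q} \<union> {q \<in> set es2. b \<in> ends G q}"
    using es(1) by auto
  have "card {q \<in> set es. b \<in> ends G q} \<le> card {q \<in> set es1. b \<in> ends G q} + card {q \<in> set es2. b \<in> ends G q}"
    unfolding eq by (rule card_Un_le)
  then show ?thesis using path_last_degree[OF es(2)] path_hd_degree[OF es(3)] by linarith
qed

text \<open>Once the path has entered \<open>X\<close> at its first vertex \<open>d\<close> there, a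
  later vertex outside \<open>X\<close> would force a second crossing.\<close>

lemma path_one_crossing:
  assumes G: "finite_loopless G" and p: "is_path G vs es" and c: "card (set es \<inter> cut G X) \<le> 1"
    and X: "hd vs \<notin> X" "last vs \<in> X"
  obtains zs b ys where "vs = zs @ b # ys" "ys \<noteq> []" "set (zs @ [b]) \<inter> X = {}" "set ys \<subseteq> X"
proof -
  obtain zs d ys where vs: "vs = zs @ d # ys" "d \<in> X" "\<forall>z\<in>set zs. z \<notin> X"
    using split_list_first_prop[of vs "\<lambda>x. x \<in> X"] X(2) is_pathD(1)[OF p] last_in_set[of vs] by metis
  have "zs \<noteq> []" using vs X(1) by auto
  then obtain zs' b where zs: "zs = zs' @ [b]" by (metis rev_exhaust)
  have "y \<in> X" if y: "y \<in> set ys" for y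
  proof (rule ccontr)
    assume yX: "y \<notin> X"
    obtain y1 y2 where ys: "ys = y1 @ y # y2" using y by (metis split_list)
    have "is_path G ((zs @ d # y1) @ y # y2) es" using p vs(1) ys by simp
    then obtain es1 es2 where es: "es = es1 @ es2" "is_path G ((zs @ d # y1) @ [y]) es1"
      using is_path_split by metis
    have p1: "is_path G (zs @ d # (y1 @ [y])) es1" using es(2) by simp
    have "hd (zs @ [d]) \<notin> X" using X(1) vs(1) \<open>zs \<noteq> []\<close> by simp
    then have "\<exists>e e'. e \<noteq> e' \<and> {e, e'} \<subseteq> set es1 \<inter> cut G X"
      by (intro path_crosses_cut_twice[OF G p1]) (use vs(2) yX in simp_all)
    then obtain e e' where e: "e \<noteq> e'" "{e, e'} \<subseteq> set es1 \<inter> cut G X" by blast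
    then have "{e, e'} \<subseteq> set es \<inter> cut G X" using es(1) by auto
    then have "card {e, e'} \<le> card (set es \<inter> cut G X)" by (intro card_mono) simp_all
    then show False using c e(1) by simp
  qed
  moreover have "set (zs' @ [b]) \<inter> X = {}" using vs(3) zs by auto
  ultimately show thesis using that[of zs' b "d # ys"] vs(1,2) zs by auto
qed

text \<open>The case of a model that lies in no single blob. The orientation is a parameter because
  the locale is interpreted again once a branch vertex in \<open>B\<close> is known.\<close>

locale blob_model = odd_blobs G B Ks
  for G :: "('a, 'e) mgraph" and B :: "'a set" and Ks :: "'a set set" +
  fixes J :: "('b, 'f) mgraph" and s t :: "'f \<Rightarrow> 'b" and f :: "'b \<Rightarrow> 'a"
    and I :: "'f \<Rightarrow> 'a list" and Q :: "'f \<Rightarrow> 'e list" and M :: "'e set"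
  assumes J: "finite_loopless J" and bic: "bicritical J" and cub: "cubic J"
    and o: "orientation J s t" and m: "model G J s t f I Q"
    and M: "pmatch G (verts G - model_verts J f I) M"
    and not_inside: "K \<in> Ks \<Longrightarrow> \<not> model_verts J f I \<subseteq> K"
    and J_nonempty: "verts J \<noteq> {}"
begin

abbreviation U where "U \<equiv> model_verts J f I"

definition crossing :: "'a set \<Rightarrow> 'e set" where
  "crossing K = (\<Union>e\<in>edges J. set (Q e) \<inter> cut G K)"

lemma finEJ: "finite (edges J)"
  using finite_looplessD(2)[OF J] .

lemma U_sub: "U \<subseteq> verts G"
  by (rule model_verts_subset[OF m])

lemma fin_U: "finite U"
  using U_sub finV finite_subset by blast

lemma fV: "v \<in> verts J \<Longrightarrow> f v \<in> U"
  by (simp add: model_verts_def)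

lemma IU: "e \<in> edges J \<Longrightarrow> x \<in> set (I e) \<Longrightarrow> x \<in> U"
  by (auto simp: model_verts_def)

lemma stV: "e \<in> edges J \<Longrightarrow> s e \<in> verts J" "e \<in> edges J \<Longrightarrow> t e \<in> verts J"
  using orientationD(2,3)[OF J o] by blast+

lemma U_cases:
  assumes "x \<in> U"
  obtains v where "v \<in> verts J" "x = f v" | e where "e \<in> edges J" "x \<in> set (I e)"
  using assms unfolding model_verts_def by blast

lemma path: "e \<in> edges J \<Longrightarrow> is_path G (f (s e) # I e @ [f (t e)]) (Q e)"
  by (rule modelD(3)[OF m])

lemma QU: "e \<in> edges J \<Longrightarrow> q \<in> set (Q e) \<Longrightarrow> ends G q \<subseteq> U"
  by (rule model_edge_ends[OF J o _ m])

lemma card_crossing: "card (crossing K) = (\<Sum>e\<in>edges J. card (set (Q e) \<inter> cut G K))"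
  unfolding crossing_def by (rule card_UN_disjoint) (use finEJ modelD(7)[OF m] in auto)

lemma finite_crossing: "finite (crossing K)"
  unfolding crossing_def using finEJ by simp

lemma crossing_edge:
  assumes e: "e \<in> edges J" and ne: "(f (s e) \<in> K) \<noteq> (f (t e) \<in> K)"
  shows "1 \<le> card (set (Q e) \<inter> cut G K)"
proof -
  have "\<exists>q. q \<in> set (Q e) \<and> q \<in> cut G K"
    by (rule path_crosses_cut[OF path[OF e]]) (use ne in simp)
  then have "set (Q e) \<inter> cut G K \<noteq> {}" by blast
  then show ?thesis by (simp add: Suc_le_eq card_gt_0_iff)
qed

lemma crossing_twice:
  assumes e: "e \<in> edges J" and x: "x \<in> set (I e)"
    and ne: "(f (s e) \<in> K) \<noteq> (x \<in> K)" "(f (t e) \<in> K) \<noteq> (x \<in> K)"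
  shows "2 \<le> card (set (Q e) \<inter> cut G K)"
proof -
  obtain xs ys where I: "I e = xs @ x # ys" using x by (metis split_list)
  have p: "is_path G ((f (s e) # xs) @ x # (ys @ [f (t e)])) (Q e)" using path[OF e] I by simp
  have "\<exists>q q'. q \<noteq> q' \<and> {q, q'} \<subseteq> set (Q e) \<inter> cut G K"
    by (rule path_crosses_cut_twice[OF G p]) (use ne in simp_all)
  then obtain q q' where q: "q \<noteq> q'" "{q, q'} \<subseteq> set (Q e) \<inter> cut G K" by blast
  then have "card {q, q'} \<le> card (set (Q e) \<inter> cut G K)" by (intro card_mono) simp_all
  then show ?thesis using q(1) by simp
qed

lemma crossing_edge_le: "e \<in> edges J \<Longrightarrow> card (set (Q e) \<inter> cut G K) \<le> card (crossing K)"
  unfolding card_crossing by (rule member_le_sum) (use finEJ in simp_all)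

text \<open>Sorting the branch vertices by membership in \<open>K\<close> gives a cut of
  \<open>J\<close>, and each of its edges contributes a crossing on its own path.\<close>

lemma crossing_ge_3:
  assumes v: "v \<in> verts J" "f v \<in> K" and v': "v' \<in> verts J" "f v' \<notin> K"
  shows "3 \<le> card (crossing K)"
proof -
  define S where "S = {v \<in> verts J. f v \<in> K}"
  have "3 \<le> card (cut J S)"
    by (rule bicritical_cubic_cut[OF J bic cub]) (use v v' in \<open>auto simp: S_def\<close>)
  also have "\<dots> = (\<Sum>e\<in>cut J S. 1)" by simp
  also have "\<dots> \<le> (\<Sum>e\<in>cut J S. card (set (Q e) \<inter> cut G K))"
  proof (rule sum_mono)
    fix e assume e: "e \<in> cut J S"
    then have eJ: "e \<in> edges J" by (simp add: cut_def)
    have "(s e \<in> S) \<noteq> (t e \<in> S)" using e orientationD(1)[OF J o eJ] by (auto simp: cut_def)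
    then have "(f (s e) \<in> K) \<noteq> (f (t e) \<in> K)" using stV[OF eJ] by (simp add: S_def)
    then show "1 \<le> card (set (Q e) \<inter> cut G K)" by (rule crossing_edge[OF eJ])
  qed
  also have "\<dots> \<le> card (crossing K)"
    unfolding card_crossing by (rule sum_mono2[OF finEJ]) (auto simp: cut_def)
  finally show ?thesis .
qed

text \<open>If \<open>K\<close> does not separate the branch vertices, then some internal vertex
  lies on the side opposite to all of them, and its path crosses there and back.\<close>

lemma crossing_ge_2:
  assumes K: "K \<in> Ks" "K \<inter> U \<noteq> {}"
  shows "2 \<le> card (crossing K)"
proof -
  obtain x y where x: "x \<in> K" "x \<in> U" and y: "y \<in> U" "y \<notin> K" using K not_inside by blast
  consider (split) v v' where "v \<in> verts J" "f v \<in> K" "v' \<in> verts J" "f v' \<notin> K"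
    | (all) "\<forall>v\<in>verts J. f v \<in> K" | (none) "\<forall>v\<in>verts J. f v \<notin> K" by blast
  then show ?thesis
  proof cases
    case split
    then show ?thesis using crossing_ge_3[of v K v'] by simp
  next
    case all
    obtain e where e: "e \<in> edges J" "y \<in> set (I e)" using y all by (metis U_cases)
    have "2 \<le> card (set (Q e) \<inter> cut G K)" by (rule crossing_twice[OF e]) (use all y(2) stV[OF e(1)] in simp_all)
    then show ?thesis using crossing_edge_le[OF e(1), of K] by linarith
  next
    case none
    obtain e where e: "e \<in> edges J" "x \<in> set (I e)" using x none by (metis U_cases)
    have "2 \<le> card (set (Q e) \<inter> cut G K)" by (rule crossing_twice[OF e]) (use none x(1) stV[OF e(1)] in simp_all)
    then show ?thesis using crossing_edge_le[OF e(1), of K] by linarith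
  qed
qed

definition lift_matching :: "'f set \<Rightarrow> 'e set" where
  "lift_matching F = (\<Union>e\<in>edges J. alternate (e \<in> F) (Q e))"

lemma pmatch_lift_matching:
  assumes "D \<subseteq> verts J" "pmatch J (verts J - D) F"
  shows "pmatch G (U - f ` D) (lift_matching F)"
    and "pmatch G (verts G - f ` D) (lift_matching F \<union> M)"
proof -
  show 1: "pmatch G (U - f ` D) (lift_matching F)"
    unfolding lift_matching_def by (rule model_pmatch[OF J o m assms])
  have "pmatch G ((U - f ` D) \<union> (verts G - U)) (lift_matching F \<union> M)"
    by (rule pmatch_Un[OF 1 M]) blast
  moreover have "f ` D \<subseteq> U" using fV assms(1) by blast
  then have "(U - f ` D) \<union> (verts G - U) = verts G - f ` D" using U_sub by blast
  ultimately show "pmatch G (verts G - f ` D) (lift_matching F \<union> M)" by simp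
qed

text \<open>By bicriticality, two branch vertices in \<open>B\<close> could be deleted together and
  the rest of \<open>G\<close> matched. All \<open>card B\<close> blobs would remain odd, with fewer
  vertices of \<open>B\<close> left to serve them.\<close>

lemma branch_in_B_unique:
  assumes u: "u \<in> verts J" "f u \<in> B" and v: "v \<in> verts J" "f v \<in> B"
  shows "u = v"
proof (rule ccontr)
  assume ne: "u \<noteq> v"
  obtain F where F: "pmatch J (verts J - {u, v}) F" using bicritical_pmatch[OF bic u(1) v(1) ne] .
  define N where "N = lift_matching F \<union> M"
  have N: "pmatch G (verts G - f ` {u, v}) N"
    unfolding N_def by (rule pmatch_lift_matching(2)[OF _ F]) (use u v in simp)
  have KD: "K - f ` {u, v} = K" if "K \<in> Ks" for K using blob_subset[OF that] u(2) v(2) by auto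
  have OK: "{K \<in> Ks. odd (card (K - f ` {u, v}))} = Ks" using KD odd_blob by auto
  have sub: "B - f ` {u, v} \<subset> B" using u(2) by auto
  have lt: "card (B - f ` {u, v}) < card B" by (rule psubset_card_mono[OF finite_B sub])
  have "card (N \<inter> cut G K) = 1" if "K \<in> Ks" for K
    using blob_tight(1)[OF N _ that] OK lt card_Ks KD[OF that] odd_blob[OF that] by simp
  then have "card Ks = (\<Sum>K\<in>Ks. card (N \<inter> cut G K))" by simp
  also have "\<dots> \<le> card {e \<in> N. ends G e \<inter> B \<noteq> {}}"
  proof -
    have "finite {e \<in> N. ends G e \<inter> B \<noteq> {}}"
      using pmatchD(1)[OF N] finite_looplessD(2)[OF G] finite_subset by fastforce
    from card_mono[OF this sum_cut_le(2)[OF N]] show ?thesis using sum_cut_le(1)[OF N] by simp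
  qed
  also have "\<dots> \<le> card (B - f ` {u, v})" by (rule sum_cut_le(3)[OF N])
  finally show False using lt card_Ks by simp
qed

definition met :: "'a set set" where
  "met = {K \<in> Ks. K \<inter> U \<noteq> {}}"

lemma finite_met: "finite met"
  using finite_Ks by (simp add: met_def)

lemma degree_inner:
  assumes e: "e \<in> edges J" and b: "b \<in> set (I e)"
  shows "card {q \<in> (\<Union>e\<in>edges J. set (Q e)). b \<in> ends G q} \<le> 2"
proof -
  obtain xs ys where I: "I e = xs @ b # ys" using b by (metis split_list)
  have p: "is_path G ((f (s e) # xs) @ b # (ys @ [f (t e)])) (Q e)" using path[OF e] I by simp
  have "q \<in> set (Q e)" if e': "e' \<in> edges J" "q \<in> set (Q e')" "b \<in> ends G q" for e' q
  proof (rule ccontr)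
    assume "q \<notin> set (Q e)"
    then have ne: "e \<noteq> e'" using e'(2) by auto
    have "b \<in> set (f (s e') # I e' @ [f (t e')])" using is_path_ends[OF path[OF e'(1)] e'(2)] e'(3) by blast
    then have "b \<in> f ` verts J \<or> b \<in> set (I e')" using stV[OF e'(1)] by auto
    then show False using modelD(5)[OF m e] modelD(6)[OF m e e'(1) ne] b by blast
  qed
  then have "{q \<in> (\<Union>e\<in>edges J. set (Q e)). b \<in> ends G q} \<subseteq> {q \<in> set (Q e). b \<in> ends G q}" by blast
  then have "card {q \<in> (\<Union>e\<in>edges J. set (Q e)). b \<in> ends G q} \<le> card {q \<in> set (Q e). b \<in> ends G q}"
    by (intro card_mono) simp_all
  then show ?thesis using path_degree[OF p] by linarith
qed

lemma degree_branch:
  assumes z: "z \<in> verts J"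
  shows "card {q \<in> (\<Union>e\<in>edges J. set (Q e)). f z \<in> ends G q} \<le> 3"
proof -
  define A where "A = {e \<in> edges J. z \<in> ends J e}"
  have finA: "finite A" using finEJ by (simp add: A_def)
  have cardA: "card A = 3" using cub z by (simp add: A_def cubic_def degree_def)
  have le1: "card {q \<in> set (Q e). f z \<in> ends G q} \<le> 1" if "e \<in> A" for e
  proof -
    have e: "e \<in> edges J" "z = s e \<or> z = t e" using that orientationD(1)[OF J o] by (auto simp: A_def)
    from e(2) show ?thesis
    proof
      assume "z = s e"
      then show ?thesis using path_hd_degree[OF path[OF e(1)]] by simp
    next
      assume "z = t e"
      moreover have "is_path G ((f (s e) # I e) @ [f (t e)]) (Q e)" using path[OF e(1)] by simp
      ultimately show ?thesis using path_last_degree by metis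
    qed
  qed
  have "e \<in> A" if e: "e \<in> edges J" "q \<in> set (Q e)" "f z \<in> ends G q" for e q
  proof -
    have "f z \<in> set (f (s e) # I e @ [f (t e)])" using is_path_ends[OF path[OF e(1)] e(2)] e(3) by blast
    moreover have "f z \<notin> set (I e)" using modelD(5)[OF m e(1)] z by blast
    ultimately have "f z = f (s e) \<or> f z = f (t e)" by auto
    then have "z = s e \<or> z = t e" using inj_onD[OF modelD(1)[OF m]] z stV[OF e(1)] by metis
    then show ?thesis using orientationD(1)[OF J o e(1)] e(1) by (auto simp: A_def)
  qed
  then have "{q \<in> (\<Union>e\<in>edges J. set (Q e)). f z \<in> ends G q} \<subseteq> (\<Union>e\<in>A. {q \<in> set (Q e). f z \<in> ends G q})" by blast
  then have "card {q \<in> (\<Union>e\<in>edges J. set (Q e)). f z \<in> ends G q} \<le> card (\<Union>e\<in>A. {q \<in> set (Q e). f z \<in> ends G q})"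
    using finA by (intro card_mono) simp_all
  also have "\<dots> \<le> (\<Sum>e\<in>A. card {q \<in> set (Q e). f z \<in> ends G q})" by (rule card_UN_le[OF finA])
  also have "\<dots> \<le> (\<Sum>e\<in>A. 1)" by (rule sum_mono) (rule le1)
  finally show ?thesis using cardA by simp
qed

text \<open>Each crossing edge is charged to its end in \<open>B\<close>, a vertex of the model
  whose degree there is two if internal and three if a branch vertex.\<close>

lemma sum_crossing_le: "(\<Sum>K\<in>met. card (crossing K)) \<le> 2 * card (B \<inter> U) + card (B \<inter> f ` verts J)"
proof -
  let ?E = "\<Union>e\<in>edges J. set (Q e)"
  have finE: "finite ?E" using finEJ by simp
  have finBU: "finite (B \<inter> U)" using finite_B by simp
  have metKs: "K \<in> Ks" if "K \<in> met" for K using that by (simp add: met_def)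
  have "(\<Sum>K\<in>met. card (crossing K)) = card (\<Union>K\<in>met. crossing K)"
  proof (rule card_UN_disjoint[symmetric])
    show "finite met" by (rule finite_met)
    show "\<forall>K\<in>met. finite (crossing K)" using finite_crossing by simp
    show "\<forall>K\<in>met. \<forall>K'\<in>met. K \<noteq> K' \<longrightarrow> crossing K \<inter> crossing K' = {}"
    proof (intro ballI impI equals0I)
      fix K K' q assume K: "K \<in> met" "K' \<in> met" "K \<noteq> K'" and "q \<in> crossing K \<inter> crossing K'"
      then have "q \<in> cut G K" "q \<in> cut G K'" by (auto simp: crossing_def)
      then show False using cut_blobs_disjoint[OF metKs[OF K(1)] metKs[OF K(2)]] K(3) by blast
    qed
  qed
  also have "\<dots> \<le> card (\<Union>b\<in>B \<inter> U. {q \<in> ?E. b \<in> ends G q})"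
  proof (rule card_mono)
    show "finite (\<Union>b\<in>B \<inter> U. {q \<in> ?E. b \<in> ends G q})"
      by (rule finite_subset[OF _ finE]) blast
    show "(\<Union>K\<in>met. crossing K) \<subseteq> (\<Union>b\<in>B \<inter> U. {q \<in> ?E. b \<in> ends G q})"
    proof
      fix q assume "q \<in> (\<Union>K\<in>met. crossing K)"
      then obtain K e where K: "K \<in> met" "e \<in> edges J" "q \<in> set (Q e)" "q \<in> cut G K"
        by (auto simp: crossing_def)
      obtain b v where b: "b \<in> B" "ends G q = {b, v}" using cut_blob_ends[OF metKs[OF K(1)] K(4)] by metis
      have "b \<in> U" using QU[OF K(2,3)] b(2) by simp
      then show "q \<in> (\<Union>b\<in>B \<inter> U. {q \<in> ?E. b \<in> ends G q})" using b K by auto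
    qed
  qed
  also have "\<dots> \<le> (\<Sum>b\<in>B \<inter> U. card {q \<in> ?E. b \<in> ends G q})" by (rule card_UN_le[OF finBU])
  also have "\<dots> \<le> (\<Sum>b\<in>B \<inter> U. 2 + of_bool (b \<in> f ` verts J))"
  proof (rule sum_mono)
    fix b assume b: "b \<in> B \<inter> U"
    show "card {q \<in> ?E. b \<in> ends G q} \<le> 2 + of_bool (b \<in> f ` verts J)"
    proof (cases "b \<in> f ` verts J")
      case True
      then obtain z where "z \<in> verts J" "b = f z" by blast
      then show ?thesis using degree_branch[of z] by simp
    next
      case False
      obtain e where "e \<in> edges J" "b \<in> set (I e)" using b False by (metis IntD2 U_cases imageI)
      then show ?thesis using degree_inner[of e b] by simp
    qed
  qed
  also have "\<dots> = 2 * card (B \<inter> U) + card (B \<inter> U \<inter> f ` verts J)"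
    unfolding sum.distrib using finBU by simp
  also have "B \<inter> U \<inter> f ` verts J = B \<inter> f ` verts J" using fV by blast
  finally show ?thesis .
qed

lemma card_B_branch: "card (B \<inter> f ` verts J) \<le> 1"
proof -
  have "x = y" if "x \<in> B \<inter> f ` verts J" "y \<in> B \<inter> f ` verts J" for x y
    using that branch_in_B_unique by blast
  then show ?thesis using finite_B by (simp add: card_le_Suc0_iff_eq)
qed

end

section \<open>The blob that holds the branch vertices\<close>

context blob_model
begin

lemma blob_of_branch:
  assumes v: "v \<in> verts J" "f v \<notin> B"
  obtains K where "K \<in> Ks" "f v \<in> K" "K \<in> met"
proof -
  have "f v \<in> verts G - B" using v(2) fV[OF v(1)] U_sub by blast
  then obtain K where K: "K \<in> Ks" "f v \<in> K" using Union_Ks by blast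
  then have "K \<in> met" using fV[OF v(1)] by (auto simp: met_def)
  then show thesis using that K by blast
qed

text \<open>A perfect matching of \<open>J\<close> yields \<open>N\<close> on the model, and
  \<open>N \<union> M\<close> is perfect in \<open>G\<close>. Each vertex of
  \<open>B \<inter> U\<close> is sent by its \<open>N\<close>-edge to a blob. That edge is the only
  one of \<open>N \<union> M\<close> in the cut, hence injectivity and the absence of
  \<open>M\<close> from the cut.\<close>

lemma matching_meets:
  obtains h where "inj_on h (B \<inter> U)" "h ` (B \<inter> U) \<subseteq> met"
    "\<forall>b\<in>B \<inter> U. M \<inter> cut G (h b) = {}"
proof -
  obtain F where F: "pmatch J (verts J - {}) F"
    using bic unfolding bicritical_def has_perfect_matching_def perfect_matching_iff_pmatch[OF J] by auto
  define N where "N = lift_matching F"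
  have N: "pmatch G U N" and NM: "pmatch G (verts G) (N \<union> M)"
    using pmatch_lift_matching[OF _ F] by (simp_all add: N_def)
  have "\<exists>K q. K \<in> Ks \<and> q \<in> N \<and> q \<in> cut G K \<and> b \<in> ends G q" if b: "b \<in> B \<inter> U" for b
  proof -
    obtain q where q: "q \<in> N" "b \<in> ends G q" using pmatchD(3)[OF N, of b] b by blast
    obtain K where K: "K \<in> Ks" "ends G q \<subseteq> K \<or> q \<in> cut G K" using edge_cases pmatchD(1)[OF N] q(1) by blast
    have "b \<notin> K" using b blob_subset[OF K(1)] by blast
    then have "q \<in> cut G K" using K(2) q(2) by blast
    then show ?thesis using K(1) q by blast
  qed
  then have "\<forall>b\<in>B \<inter> U. \<exists>p. fst p \<in> Ks \<and> snd p \<in> N \<and> snd p \<in> cut G (fst p) \<and> b \<in> ends G (snd p)"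
    by simp
  from bchoice[OF this] obtain p where p: "\<forall>b\<in>B \<inter> U. fst (p b) \<in> Ks \<and> snd (p b) \<in> N \<and>
    snd (p b) \<in> cut G (fst (p b)) \<and> b \<in> ends G (snd (p b))" ..
  define h where "h b = fst (p b)" for b
  define g where "g b = snd (p b)" for b
  have hg: "h b \<in> Ks" "g b \<in> N" "g b \<in> cut G (h b)" "b \<in> ends G (g b)" if "b \<in> B \<inter> U" for b
    using p that by (simp_all add: h_def g_def)
  show thesis
  proof (rule that)
    show "inj_on h (B \<inter> U)"
    proof (rule inj_onI)
      fix b b' assume b: "b \<in> B \<inter> U" "b' \<in> B \<inter> U" "h b = h b'"
      have "g b = g b'"
        by (rule pmatch_cut_blob_unique[OF NM hg(1)[OF b(1)]])
          (use hg(2,3)[OF b(1)] hg(2,3)[OF b(2)] b(3) in simp_all)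
      moreover obtain c v where c: "c \<in> B" "v \<in> h b" "ends G (g b) = {c, v}"
        using cut_blob_ends[OF hg(1,3)[OF b(1)]] .
      moreover have "v \<notin> B" using blob_subset[OF hg(1)[OF b(1)]] c(2) by blast
      ultimately show "b = b'" using hg(4)[OF b(1)] hg(4)[OF b(2)] b(1,2) by auto
    qed
    show "h ` (B \<inter> U) \<subseteq> met"
    proof
      fix K assume "K \<in> h ` (B \<inter> U)"
      then obtain b where b: "b \<in> B \<inter> U" "K = h b" by blast
      have "ends G (g b) \<inter> h b \<noteq> {}" using hg(3)[OF b(1)] by (simp add: cut_def)
      moreover have "ends G (g b) \<subseteq> U" using pmatchD(2)[OF N hg(2)[OF b(1)]] .
      ultimately show "K \<in> met" using hg(1)[OF b(1)] b(2) unfolding met_def by blast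
    qed
    show "\<forall>b\<in>B \<inter> U. M \<inter> cut G (h b) = {}"
    proof (intro ballI equals0I)
      fix b q assume b: "b \<in> B \<inter> U" and q: "q \<in> M \<inter> cut G (h b)"
      have "q = g b"
        by (rule pmatch_cut_blob_unique[OF NM hg(1)[OF b]]) (use q hg(2,3)[OF b] in simp_all)
      moreover have "ends G q \<subseteq> verts G - U" using pmatchD(2)[OF M] q by blast
      ultimately show False using hg(4)[OF b] b by blast
    qed
  qed
qed

text \<open>\<open>matching_meets\<close> gives one inequality; the other follows from two crossings
  per blob, where the surplus of one disappears by integrality. The injection is then onto
  \<open>met\<close>, so the absence of \<open>M\<close> from the cut extends to all blobs that are
  met.\<close>

lemma met_tight: "card met = card (B \<inter> U)" "K \<in> met \<Longrightarrow> M \<inter> cut G K = {}"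
proof -
  obtain h where h: "inj_on h (B \<inter> U)" "h ` (B \<inter> U) \<subseteq> met"
    "\<forall>b\<in>B \<inter> U. M \<inter> cut G (h b) = {}" using matching_meets .
  have ge: "card (B \<inter> U) \<le> card met" by (rule card_inj_on_le[OF h(1,2) finite_met])
  have "2 * card met = (\<Sum>K\<in>met. 2)" by simp
  also have "\<dots> \<le> (\<Sum>K\<in>met. card (crossing K))"
    by (rule sum_mono) (use crossing_ge_2 in \<open>simp add: met_def\<close>)
  finally have "2 * card met \<le> 2 * card (B \<inter> U) + 1" using sum_crossing_le card_B_branch by linarith
  then show eq: "card met = card (B \<inter> U)" using ge by linarith
  have "h ` (B \<inter> U) = met"
    by (rule card_subset_eq[OF finite_met h(2)]) (simp add: card_image[OF h(1)] eq)
  then have "M \<inter> cut G K = {}" if K: "K \<in> met" for K using h(3) K by (metis imageE)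
  then show "K \<in> met \<Longrightarrow> M \<inter> cut G K = {}" .
qed

text \<open>Truncated subtraction loses nothing here, by \<open>crossing_ge_2\<close>; the
  right-hand side is at most one.\<close>

lemma crossing_excess: "(\<Sum>K\<in>met. card (crossing K) - 2) \<le> card (B \<inter> f ` verts J)"
proof -
  have "(\<Sum>K\<in>met. card (crossing K)) = (\<Sum>K\<in>met. (card (crossing K) - 2) + 2)"
  proof (rule sum.cong[OF refl])
    fix K assume "K \<in> met"
    then have "2 \<le> card (crossing K)" using crossing_ge_2 by (simp add: met_def)
    then show "card (crossing K) = (card (crossing K) - 2) + 2" by simp
  qed
  also have "\<dots> = (\<Sum>K\<in>met. card (crossing K) - 2) + 2 * card met" unfolding sum.distrib by simp
  finally show ?thesis using sum_crossing_le met_tight(1) by linarith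
qed

lemma crossing_le:
  assumes "K \<in> met"
  shows "card (crossing K) \<le> 2 + card (B \<inter> f ` verts J)"
proof -
  have "card (crossing K) - 2 \<le> (\<Sum>K\<in>met. card (crossing K) - 2)"
    by (rule member_le_sum) (use assms finite_met in simp_all)
  then show ?thesis using crossing_excess by linarith
qed

text \<open>Without a branch vertex in \<open>B\<close> there is no excess, so no blob that is met
  separates branch vertices. With \<open>z\<close> in \<open>B\<close>, a blob containing another
  branch vertex separates it from \<open>z\<close> and has excess at least one; the total allows
  just one such blob.\<close>

lemma branch_blob:
  obtains (inner) L where "L \<in> met" "f ` verts J \<subseteq> L" "card (crossing L) \<le> 2"
  | (branch) L z where "L \<in> met" "z \<in> verts J" "f z \<in> B" "f ` (verts J - {z}) \<subseteq> L"
proof (cases "B \<inter> f ` verts J = {}")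
  case True
  obtain v where v: "v \<in> verts J" using J_nonempty by blast
  then obtain L where L: "L \<in> Ks" "f v \<in> L" "L \<in> met" using blob_of_branch True by blast
  have le: "card (crossing L) \<le> 2" using crossing_le[OF L(3)] True by simp
  have "f v' \<in> L" if "v' \<in> verts J" for v'
    using crossing_ge_3[OF v L(2) that] le by (cases "f v' \<in> L") simp_all
  then show thesis using inner[OF L(3) _ le] by blast
next
  case False
  then obtain z where z: "z \<in> verts J" "f z \<in> B" by blast
  have "card {e \<in> edges J. z \<in> ends J e} = 3" using cub z(1) by (simp add: cubic_def degree_def)
  then have "{e \<in> edges J. z \<in> ends J e} \<noteq> {}" by (metis card.empty zero_neq_numeral)
  then obtain e where e: "e \<in> edges J" "z \<in> ends J e" by blast
  obtain v where v: "v \<in> verts J" "v \<noteq> z" using ends_other[OF J e] by metis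
  have notB: "f v \<notin> B" if "v \<in> verts J" "v \<noteq> z" for v using branch_in_B_unique[OF that(1) _ z] that(2) by blast
  have ge3: "3 \<le> card (crossing K)" if "K \<in> Ks" "v \<in> verts J" "f v \<in> K" for K v
  proof -
    have "f z \<notin> K" using blob_subset[OF that(1)] z(2) by blast
    then show ?thesis by (rule crossing_ge_3[OF that(2,3) z(1)])
  qed
  obtain L where L: "L \<in> Ks" "f v \<in> L" "L \<in> met" using blob_of_branch[OF v(1) notB[OF v]] .
  have "f v' \<in> L" if v': "v' \<in> verts J" "v' \<noteq> z" for v'
  proof (rule ccontr)
    assume n: "f v' \<notin> L"
    obtain K where K: "K \<in> Ks" "f v' \<in> K" "K \<in> met" using blob_of_branch[OF v'(1) notB[OF v']] .
    have ne: "K \<noteq> L" using n K(2) by blast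
    have "(\<Sum>K\<in>{K, L}. card (crossing K) - 2) \<le> (\<Sum>K\<in>met. card (crossing K) - 2)"
      by (rule sum_mono2[OF finite_met]) (use K(3) L(3) in simp_all)
    then have "(card (crossing K) - 2) + (card (crossing L) - 2) \<le> 1"
      using ne crossing_excess card_B_branch by simp
    then show False using ge3[OF K(1) v'(1) K(2)] ge3[OF L(1) v(1) L(2)] by linarith
  qed
  then show thesis using branch[OF L(3) z] by blast
qed

section \<open>Shrinking a bisubdivision that spans several blobs\<close>

lemma pmatch_shrink_met:
  assumes L: "L \<in> met"
  shows "\<exists>N. pmatch (shrink G (verts G - L)) (Some ` (L - U)) N"
proof -
  have LKs: "L \<in> Ks" using L by (simp add: met_def)
  have L_sub: "L \<subseteq> verts G" using blob_subset[OF LKs] by blast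
  interpret shrinking G L by (rule shrinking.intro[OF G L_sub])
  \<comment> \<open>\<open>None\<close> will belong to the shrunken model, so only
    \<open>L - U\<close> remains to be matched; \<open>M\<close> does this because none of its edges
    leaves \<open>L\<close>.\<close>
  have "pmatch G (L - U) {e \<in> M. ends G e \<subseteq> L - U}"
  proof (rule pmatch_restrict[OF M])
    show "L - U \<subseteq> verts G - U" using L_sub by blast
    fix e assume e: "e \<in> M"
    have "e \<notin> cut G L" using met_tight(2)[OF L] e by blast
    then have "ends G e \<inter> L = {} \<or> ends G e \<subseteq> L" using pmatchD(1)[OF M] e by (auto simp: cut_def)
    then show "ends G e \<inter> (L - U) = {} \<or> ends G e \<subseteq> L - U" using pmatchD(2)[OF M e] by blast
  qed
  then show ?thesis using pmatch_shrink[of "L - U"] by blast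
qed

lemma inner_path_in_blob:
  assumes e: "e \<in> edges J" and st: "f (s e) \<in> L" "f (t e) \<in> L" and c: "card (set (Q e) \<inter> cut G L) \<le> 1"
  shows "set (I e) \<subseteq> L"
proof
  fix x assume x: "x \<in> set (I e)"
  show "x \<in> L"
  proof (rule ccontr)
    assume "x \<notin> L"
    then have "2 \<le> card (set (Q e) \<inter> cut G L)" by (intro crossing_twice[OF e x]) (use st in simp_all)
    then show False using c by simp
  qed
qed

text \<open>Two crossings suffice for just one path to leave \<open>L\<close> and return, so all
  other paths stay inside. The excursion of that path is contracted to \<open>None\<close>.\<close>

lemma shrink_inner_based:
  assumes L: "L \<in> met" and f_L: "f ` verts J \<subseteq> L" and c: "card (crossing L) \<le> 2"
  shows "based J (shrink G (verts G - L))"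
proof -
  have LKs: "L \<in> Ks" using L by (simp add: met_def)
  have L_sub: "L \<subseteq> verts G" using blob_subset[OF LKs] by blast
  interpret shrinking G L by (rule shrinking.intro[OF G L_sub])
  have fL: "f v \<in> L" if "v \<in> verts J" for v using f_L that by blast
  obtain x where x: "x \<in> U" "x \<notin> L" using not_inside[OF LKs] by blast
  obtain e0 where e0: "e0 \<in> edges J" "x \<in> set (I e0)" using x fL by (metis U_cases)
  have st0: "f (s e0) \<in> L" "f (t e0) \<in> L" using fL stV[OF e0(1)] by simp_all
  have two: "2 \<le> card (set (Q e0) \<inter> cut G L)"
    by (rule crossing_twice[OF e0]) (use st0 x(2) in simp_all)
  have IL: "set (I e) \<subseteq> L" if e: "e \<in> edges J" "e \<noteq> e0" for e
  proof (rule inner_path_in_blob[OF e(1)])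
    show "f (s e) \<in> L" "f (t e) \<in> L" using fL stV[OF e(1)] by simp_all
    have "(\<Sum>e\<in>{e, e0}. card (set (Q e) \<inter> cut G L)) \<le> card (crossing L)"
      unfolding card_crossing by (rule sum_mono2[OF finEJ]) (use e(1) e0(1) in simp_all)
    then show "card (set (Q e) \<inter> cut G L) \<le> 1" using two c e(2) by simp
  qed
  \<comment> \<open>\<open>a\<close> is the first vertex outside \<open>L\<close>. The crossing
    before it leaves at most one for the rest, which therefore consists of the excursion
    \<open>zs @ [b]\<close> and a final part in \<open>L\<close>.\<close>
  obtain xs a r where xar: "I e0 = xs @ a # r" "a \<notin> L" "\<forall>x\<in>set xs. x \<in> L"
    using split_list_first_prop[of "I e0" "\<lambda>x. x \<notin> L"] e0(2) x(2) by metis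
  have p0: "is_path G ((f (s e0) # xs) @ a # (r @ [f (t e0)])) (Q e0)" using path[OF e0(1)] xar(1) by simp
  then obtain es1 es2 where es: "Q e0 = es1 @ es2" "is_path G ((f (s e0) # xs) @ [a]) es1"
    "is_path G (a # (r @ [f (t e0)])) es2" using is_path_split by metis
  have dist: "distinct (f (s e0) # I e0 @ [f (t e0)])" using is_pathD(3)[OF path[OF e0(1)]] .
  have "set ((f (s e0) # xs) @ [a]) \<inter> set (a # (r @ [f (t e0)])) \<subseteq> {a}" using is_pathD(3)[OF p0] by auto
  then have d12: "set es1 \<inter> set es2 = {}" by (rule is_path_edges_disjoint[OF G es(2,3)])
  have "\<exists>q. q \<in> set es1 \<and> q \<in> cut G L"
    by (rule path_crosses_cut[OF es(2)]) (use st0(1) xar(2) in simp)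
  then obtain q where q: "q \<in> set es1" "q \<in> cut G L" by blast
  have c2: "card (set es2 \<inter> cut G L) \<le> 1"
  proof -
    have "insert q (set es2 \<inter> cut G L) \<subseteq> set (Q e0) \<inter> cut G L" using q es(1) by auto
    then have "card (insert q (set es2 \<inter> cut G L)) \<le> card (set (Q e0) \<inter> cut G L)" by (intro card_mono) simp_all
    moreover have "q \<notin> set es2 \<inter> cut G L" using q d12 by blast
    ultimately show ?thesis using crossing_edge_le[OF e0(1), of L] c by simp
  qed
  have "hd (a # (r @ [f (t e0)])) \<notin> L" "last (a # (r @ [f (t e0)])) \<in> L" using xar(2) st0(2) by simp_all
  then obtain zs b ys where zby: "a # (r @ [f (t e0)]) = zs @ b # ys" "ys \<noteq> []" "set (zs @ [b]) \<inter> L = {}" "set ys \<subseteq> L"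
    using path_one_crossing[OF G es(3) c2] by metis
  obtain ys' where ys': "ys = ys' @ [f (t e0)]"
  proof -
    have "last ys = f (t e0)" using arg_cong[OF zby(1), of last] zby(2) by simp
    then show thesis using that[of "butlast ys"] zby(2) append_butlast_last_id[of ys] by simp
  qed
  have "(a # r) @ [f (t e0)] = (zs @ b # ys') @ [f (t e0)]" using zby(1) ys' by simp
  then have ar: "a # r = zs @ b # ys'" by (simp only: append1_eq_conv)
  have I0: "I e0 = xs @ (zs @ [b]) @ ys'" using xar(1) ar by simp
  have b: "b \<in> Y" "a \<in> Y" "set (zs @ [b]) \<subseteq> Y"
  proof -
    have "set (I e0) \<subseteq> verts G" using is_pathD(4)[OF path[OF e0(1)]] by auto
    moreover have "set (zs @ [b]) \<subseteq> set (I e0)" unfolding I0 by auto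
    moreover have "a \<in> set (I e0)" using xar(1) by simp
    ultimately show "b \<in> Y" "a \<in> Y" "set (zs @ [b]) \<subseteq> Y" using zby(3) xar(2) by auto
  qed
  have "is_path G (zs @ b # ys) es2" using es(3) zby(1) by simp
  then obtain es3 es4 where es34: "es2 = es3 @ es4" "is_path G (b # ys) es4" using is_path_split by metis
  have right: "is_path Gs (None # map Some ys) es4" by (rule shrink_path_NoneI[OF zby(4,2) b(1) es34(2)])
  let ?xs = "f (s e0) # xs"
  have xsL: "set ?xs \<subseteq> L" using st0(1) xar(3) by auto
  have "is_path G (a # rev ?xs) (rev es1)" using is_path_rev[OF es(2)] by simp
  then have "is_path Gs (None # map Some (rev ?xs)) (rev es1)"
    by (intro shrink_path_NoneI[OF _ _ b(2)]) (use xsL in auto)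
  from is_path_rev[OF this] have left: "is_path Gs (map Some ?xs @ [None]) es1" by (simp add: rev_map)
  have new: "is_path Gs ((map Some ?xs @ [None]) @ map Some ys) (es1 @ es4)"
  proof (rule is_path_append[OF left])
    show "is_path Gs (last (map Some ?xs @ [None]) # map Some ys) es4" using right by simp
    have "set ?xs \<inter> set ys = {}" using dist unfolding I0 ys' by auto
    then show "set (map Some ?xs @ [None]) \<inter> set (map Some ys) = {}" by auto
  qed
  define f' where "f' v = Some (f v)" for v
  define I' where "I' e = (if e = e0 then map Some xs @ None # map Some ys' else map Some (I e))" for e
  define Q' where "Q' e = (if e = e0 then es1 @ es4 else Q e)" for e
  have U_L: "U - L = set (zs @ [b])"
  proof
    show "set (zs @ [b]) \<subseteq> U - L" using zby(3) IU[OF e0(1)] I0 by auto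
    show "U - L \<subseteq> set (zs @ [b])"
    proof
      fix y assume y: "y \<in> U - L"
      then obtain e where e: "e \<in> edges J" "y \<in> set (I e)" using fL by (metis DiffD1 DiffD2 U_cases)
      then have "e = e0" using IL y by blast
      then have "y \<in> set xs \<union> set (zs @ [b]) \<union> set ys'" using e(2) I0 by auto
      moreover have "set ys' \<subseteq> L" using zby(4) ys' by simp
      ultimately show "y \<in> set (zs @ [b])" using y xar(3) by blast
    qed
  qed
  \<comment> \<open>One vertex replaces the excursion, so its length must be odd. \<open>U\<close>
    is even, having a perfect matching; \<open>L - U\<close> is even, as \<open>M\<close> does not
    cross \<open>L\<close>; and \<open>L\<close> is odd. Hence \<open>U - L\<close> is odd.\<close>
  have odd_zs: "odd (length (zs @ [b]))"
  proof -
    obtain F where F: "pmatch J (verts J - {}) F"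
      using bic unfolding bicritical_def has_perfect_matching_def perfect_matching_iff_pmatch[OF J] by auto
    have "even (card U)" using pmatch_even[OF G _ fin_U] pmatch_lift_matching(1)[OF _ F] by simp
    moreover have "even (card ((verts G - U) \<inter> L))"
      using pmatch_parity[OF G M, of L] finV met_tight(2)[OF L] by simp
    moreover have "(verts G - U) \<inter> L = L - U" using L_sub by blast
    ultimately have ev: "even (card U)" "even (card (L - U))" by simp_all
    have "card L = card (U \<inter> L) + card (L - U)"
      using card_Int_Diff[OF finite_blob[OF LKs], of U] by (simp add: Int_commute)
    moreover have "card U = card (U \<inter> L) + card (U - L)" by (rule card_Int_Diff[OF fin_U])
    moreover have "distinct (zs @ [b])" using dist unfolding I0 by simp
    then have "card (U - L) = length (zs @ [b])" unfolding U_L by (rule distinct_card)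
    ultimately show ?thesis using ev odd_blob[OF LKs] by presburger
  qed
  have m': "model Gs J s t f' I' Q'"
  proof (rule model_push[OF m])
    show "inj_on f' (verts J)" using modelD(1)[OF m] by (simp add: f'_def inj_on_def)
    show "f' v \<in> verts Gs" if "v \<in> verts J" for v using fL[OF that] by (simp add: f'_def verts_shrink)
    show "x = f v" if "f' v = Some x" for v x using that by (simp add: f'_def)
    fix e assume e: "e \<in> edges J"
    show "is_path Gs (f' (s e) # I' e @ [f' (t e)]) (Q' e)"
    proof (cases "e = e0")
      case True
      then show ?thesis using new ys' by (simp add: f'_def I'_def Q'_def)
    next
      case False
      let ?l = "f (s e) # I e @ [f (t e)]"
      have "set ?l \<subseteq> L" using IL[OF e False] fL stV[OF e] by simp
      then have "is_path Gs (map Some ?l) (Q e)" using shrink_path path[OF e] by blast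
      then show ?thesis using False by (simp add: f'_def I'_def Q'_def)
    qed
    have len: "length (I e0) = length xs + length (zs @ [b]) + length ys'" unfolding I0 by simp
    have "even (length xs + length (zs @ [b]) + length ys')" using modelD(4)[OF m e0(1)] unfolding len .
    then have "even (length xs + Suc (length ys'))" using odd_zs by presburger
    then show "even (length (I' e))" using modelD(4)[OF m e] by (simp add: I'_def)
    show "y \<in> set (I e)" if "Some y \<in> set (I' e)" for y
      using that I0 by (auto simp: I'_def split: if_splits)
    show "None \<notin> f' ` verts J" by (auto simp: f'_def)
    show "e = e'" if "None \<in> set (I' e)" "None \<in> set (I' e')" for e'
      using that by (auto simp: I'_def split: if_splits)
    show "set (Q' e) \<subseteq> set (Q e)" using es(1) es34(1) by (auto simp: Q'_def)
  qed
  have "verts Gs - model_verts J f' I' = Some ` (L - U)"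
  proof -
    have "None \<in> model_verts J f' I'" using e0(1) by (auto simp: model_verts_def I'_def)
    moreover have "Some y \<in> model_verts J f' I' \<longleftrightarrow> y \<in> U" if "y \<in> L" for y
    proof -
      have "Some y \<in> f' ` verts J \<longleftrightarrow> y \<in> f ` verts J" by (auto simp: f'_def)
      moreover have "Some y \<in> set (I' e) \<longleftrightarrow> y \<in> set (I e)" for e
        using zby(3) that I0 by (auto simp: I'_def)
      ultimately show ?thesis by (simp add: model_verts_def)
    qed
    ultimately show ?thesis by (auto simp: verts_shrink split: if_splits)
  qed
  then show ?thesis unfolding based_iff_model[OF J o] using m' pmatch_shrink_met[OF L] by metis
qed

text \<open>The segments in \<open>L\<close> of the three paths at \<open>z\<close> have even length because a perfect matching of
  \<open>J - z - t a\<close> yields one of \<open>G - f z - f (t a)\<close> that, by tightness of \<open>B - f z\<close>, does not cross \<open>L\<close>.\<close>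

lemma shrink_branch_based:
  assumes L: "L \<in> met" and z: "z \<in> verts J" "f z \<in> B" and f_L: "f ` (verts J - {z}) \<subseteq> L"
    and c: "card (crossing L) \<le> 3" and sz: "\<And>e. e \<in> edges J \<Longrightarrow> z \<in> ends J e \<Longrightarrow> s e = z"
  shows "based J (shrink G (verts G - L))"
proof -
  have LKs: "L \<in> Ks" using L by (simp add: met_def)
  have L_sub: "L \<subseteq> verts G" using blob_subset[OF LKs] by blast
  interpret shrinking G L by (rule shrinking.intro[OF G L_sub])
  have fL: "f v \<in> L" if "v \<in> verts J" "v \<noteq> z" for v using f_L that by blast
  have fz: "f z \<notin> L" "f z \<in> Y" using blob_subset[OF LKs] z(2) B_sub by blast+
  define A where "A = {e \<in> edges J. z \<in> ends J e}"
  have cardA: "card A = 3" using cub z(1) by (simp add: A_def cubic_def degree_def)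
  have Ae: "e \<in> edges J" "s e = z" if "e \<in> A" for e using that sz by (auto simp: A_def)
  have tz: "t e \<noteq> z" if "e \<in> edges J" for e
    using sz[OF that] orientationD(1,4)[OF J o that] by auto
  have ftL: "f (t e) \<in> L" if "e \<in> edges J" for e using fL[OF stV(2)[OF that] tz[OF that]] .
  \<comment> \<open>The three paths at \<open>z\<close> need a crossing each, and there are no more
    than three in all.\<close>
  have cQ: "card (set (Q e) \<inter> cut G L) = of_bool (e \<in> A)" if "e \<in> edges J" for e
  proof (rule sum_eq_indicator[OF finEJ _ _ _ that])
    show "A \<subseteq> edges J" using Ae by blast
    show "1 \<le> card (set (Q a) \<inter> cut G L)" if "a \<in> A" for a
      by (rule crossing_edge[OF Ae(1)[OF that]]) (use Ae[OF that] fz ftL in simp)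
    show "(\<Sum>e\<in>edges J. card (set (Q e) \<inter> cut G L)) \<le> card A" using c cardA card_crossing by simp
  qed
  have sL: "s e \<noteq> z" "f (s e) \<in> L" "set (I e) \<subseteq> L" if e: "e \<in> edges J" "e \<notin> A" for e
  proof -
    show sz': "s e \<noteq> z" using e orientationD(1)[OF J o e(1)] by (auto simp: A_def)
    show fs: "f (s e) \<in> L" using fL[OF stV(1)[OF e(1)] sz'] .
    show "set (I e) \<subseteq> L" by (rule inner_path_in_blob[OF e(1) fs ftL[OF e(1)]]) (use cQ[OF e(1)] in simp)
  qed
  \<comment> \<open>With a single crossing, a path at \<open>z\<close> is an outer part, absorbed by
    \<open>None\<close>, followed by an inner part. The entries of \<open>p\<close> are the outer
    internal vertices, the inner ones and the edges from \<open>None\<close> on.\<close>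
  have "\<exists>p. I a = fst p @ fst (snd p) \<and> set (fst p) \<inter> L = {} \<and> set (fst (snd p)) \<subseteq> L \<and>
      is_path Gs (None # map Some (fst (snd p) @ [f (t a)])) (snd (snd p)) \<and> set (snd (snd p)) \<subseteq> set (Q a)"
    if a: "a \<in> A" for a
  proof -
    let ?l = "f z # I a @ [f (t a)]"
    have p: "is_path G ?l (Q a)" using path[OF Ae(1)[OF a]] Ae(2)[OF a] by simp
    have cle: "card (set (Q a) \<inter> cut G L) \<le> 1" using cQ[OF Ae(1)[OF a]] by simp
    have "hd ?l \<notin> L" "last ?l \<in> L" using fz(1) ftL[OF Ae(1)[OF a]] by simp_all
    then obtain zs b ys where zby: "?l = zs @ b # ys" "ys \<noteq> []" "set (zs @ [b]) \<inter> L = {}" "set ys \<subseteq> L"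
      using path_one_crossing[OF G p cle] by metis
    obtain ys' where ys': "ys = ys' @ [f (t a)]"
    proof -
      have "last ys = f (t a)" using arg_cong[OF zby(1), of last] zby(2) by simp
      then show thesis using that[of "butlast ys"] zby(2) append_butlast_last_id[of ys] by simp
    qed
    have "(f z # I a) @ [f (t a)] = ((zs @ [b]) @ ys') @ [f (t a)]" using zby(1) ys' by simp
    then have "f z # I a = (zs @ [b]) @ ys'" by (simp only: append1_eq_conv)
    \<comment> \<open>The outer part begins with \<open>f z\<close>, which is not internal and is
      dropped.\<close>
    moreover obtain w ws where w: "zs @ [b] = w # ws" by (cases "zs @ [b]") auto
    ultimately have I: "I a = ws @ ys'" by simp
    have wsL: "set ws \<inter> L = {}" using zby(3) unfolding w by auto
    have "b \<in> set ?l" unfolding zby(1) by simp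
    then have "b \<in> Y" using is_pathD(4)[OF p] zby(3) by auto
    obtain es1 es2 where es: "Q a = es1 @ es2" "is_path G (b # ys) es2"
      using is_path_split p unfolding zby(1) by metis
    have "is_path Gs (None # map Some ys) es2" by (rule shrink_path_NoneI[OF zby(4,2) \<open>b \<in> Y\<close> es(2)])
    moreover have "set es2 \<subseteq> set (Q a)" "set ys' \<subseteq> L" using es(1) zby(4) ys' by simp_all
    ultimately show ?thesis using I wsL ys' by (intro exI[of _ "(ws, ys', es2)"]) simp
  qed
  then have "\<forall>a\<in>A. \<exists>p. I a = fst p @ fst (snd p) \<and> set (fst p) \<inter> L = {} \<and> set (fst (snd p)) \<subseteq> L \<and>
      is_path Gs (None # map Some (fst (snd p) @ [f (t a)])) (snd (snd p)) \<and> set (snd (snd p)) \<subseteq> set (Q a)"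
    by simp
  from bchoice[OF this] obtain p where p: "\<forall>a\<in>A. I a = fst (p a) @ fst (snd (p a)) \<and> set (fst (p a)) \<inter> L = {} \<and>
      set (fst (snd (p a))) \<subseteq> L \<and> is_path Gs (None # map Some (fst (snd (p a)) @ [f (t a)])) (snd (snd (p a))) \<and>
      set (snd (snd (p a))) \<subseteq> set (Q a)" ..
  define R where "R a = fst (snd (p a))" for a
  define E where "E a = snd (snd (p a))" for a
  have RE: "I a = fst (p a) @ R a" "set (fst (p a)) \<inter> L = {}" "set (R a) \<subseteq> L"
    "is_path Gs (None # map Some (R a @ [f (t a)])) (E a)" "set (E a) \<subseteq> set (Q a)" if "a \<in> A" for a
    using p that by (simp_all add: R_def E_def)
  have even_R: "even (length (R a))" if a: "a \<in> A" for a
  proof -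
    define v where "v = t a"
    have v: "v \<in> verts J" "v \<noteq> z" using stV(2)[OF Ae(1)[OF a]] tz[OF Ae(1)[OF a]] by (simp_all add: v_def)
    obtain F where F: "pmatch J (verts J - {z, v}) F" using bicritical_pmatch[OF bic z(1) v(1)] v(2) by metis
    define N where "N = lift_matching F \<union> M"
    let ?D = "{f z, f v}"
    have N: "pmatch G (verts G - ?D) N"
      using pmatch_lift_matching(2)[OF _ F] z(1) v(1) by (simp add: N_def)
    have vL: "f v \<in> L" using fL v by blast
    have KD: "K - ?D = K" if "K \<in> Ks" "K \<noteq> L" for K
      using blob_subset[OF that(1)] z(2) vL Ks_disjoint[OF LKs that(1)] that(2) by auto
    have "L - ?D = L - {f v}" using fz(1) by auto
    then have evL: "even (card (L - ?D))" using odd_blob[OF LKs] vL finite_blob[OF LKs] by simp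
    \<comment> \<open>Deleting \<open>f v\<close> makes \<open>L\<close> the only even blob, while
      \<open>B\<close> loses just \<open>f z\<close>, so the hypothesis of \<open>blob_tight\<close>
      holds with equality.\<close>
    have "odd (card (K - ?D)) \<longleftrightarrow> K \<noteq> L" if "K \<in> Ks" for K
      using evL KD[OF that] odd_blob[OF that] by (cases "K = L") simp_all
    then have "{K \<in> Ks. odd (card (K - ?D))} = Ks - {L}" by blast
    then have cO: "card {K \<in> Ks. odd (card (K - ?D))} = card B - 1"
      using card_Ks LKs by simp
    have "B - ?D = B - {f z}" using vL blob_subset[OF LKs] by auto
    then have cB: "card (B - ?D) = card B - 1" using z(2) by simp
    have "card (N \<inter> cut G L) = 0"
      using blob_tight(1)[OF N _ LKs] cO cB evL by simp
    moreover have "finite N" using pmatchD(1)[OF N] finite_looplessD(2)[OF G] finite_subset by blast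
    ultimately have noN: "N \<inter> cut G L = {}" by simp
    \<comment> \<open>\<open>F\<close> misses \<open>z\<close>, so the internal vertices of the path
      of \<open>a\<close> are matched among themselves, without crossing \<open>L\<close>; those in
      \<open>L\<close> are thus even in number.\<close>
    have aF: "a \<notin> F" using pmatchD(2)[OF F, of a] a by (auto simp: A_def)
    then have "alternate False (Q a) \<subseteq> lift_matching F"
      using Ae(1)[OF a] unfolding lift_matching_def by force
    then have no: "alternate False (Q a) \<inter> cut G L = {}" using noN by (auto simp: N_def)
    have pa: "is_path G (f (s a) # I a @ [f (t a)]) (Q a)" using path[OF Ae(1)[OF a]] .
    have dI: "distinct (I a)" "f (t a) \<notin> set (I a)" using is_pathD(3)[OF pa] by simp_all
    have "length (Q a) = Suc (length (I a))" using is_pathD(2)[OF pa] by simp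
    then have "odd (length (Q a))" using modelD(4)[OF m Ae(1)[OF a]] by simp
    then have "pmatch G (set (I a)) (alternate False (Q a))" using pmatch_alternate[OF pa] dI(2) by simp
    from pmatch_parity[OF G this, of L] have "even (card (set (I a) \<inter> L))" using no by simp
    moreover have "set (I a) \<inter> L = set (R a)" using RE(1-3)[OF a] by auto
    moreover have "distinct (R a)" using dI(1) RE(1)[OF a] by simp
    ultimately show ?thesis by (simp add: distinct_card)
  qed
  define f' where "f' v = (if v = z then None else Some (f v))" for v
  define I' where "I' e = map Some (if e \<in> A then R e else I e)" for e
  define Q' where "Q' e = (if e \<in> A then E e else Q e)" for e
  have f'z: "f' z = None" and f'_ne: "v \<noteq> z \<Longrightarrow> f' v = Some (f v)" for v by (simp_all add: f'_def)
  have m': "model Gs J s t f' I' Q'"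
  proof (rule model_push[OF m])
    show "inj_on f' (verts J)" using modelD(1)[OF m] by (simp add: f'_def inj_on_def)
    show "f' v \<in> verts Gs" if "v \<in> verts J" for v
      using fL[OF that] fz(2) by (auto simp: f'_def verts_shrink)
    show "x = f v" if "f' v = Some x" for v x using that by (simp add: f'_def split: if_splits)
    fix e assume e: "e \<in> edges J"
    show "is_path Gs (f' (s e) # I' e @ [f' (t e)]) (Q' e)"
    proof (cases "e \<in> A")
      case True
      then show ?thesis using RE(4)[OF True] Ae(2)[OF True] f'z f'_ne[OF tz[OF e]] by (simp add: I'_def Q'_def)
    next
      case False
      let ?l = "f (s e) # I e @ [f (t e)]"
      have "set ?l \<subseteq> L" using sL[OF e False] ftL[OF e] by simp
      then have "is_path Gs (map Some ?l) (Q e)" using shrink_path path[OF e] by blast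
      then show ?thesis using False f'_ne[OF sL(1)[OF e False]] f'_ne[OF tz[OF e]] by (simp add: I'_def Q'_def)
    qed
    show "even (length (I' e))" using modelD(4)[OF m e] even_R by (simp add: I'_def)
    show "y \<in> set (I e)" if "Some y \<in> set (I' e)" for y
    proof (cases "e \<in> A")
      case True
      then have "y \<in> set (R e)" using that by (auto simp: I'_def)
      then show ?thesis using RE(1)[OF True] by (metis UnI2 set_append)
    next
      case False
      then show ?thesis using that by (auto simp: I'_def)
    qed
    show "None \<notin> f' ` verts J" if "None \<in> set (I' e)" using that by (auto simp: I'_def)
    show "e = e'" if "None \<in> set (I' e)" for e' using that by (auto simp: I'_def)
    show "set (Q' e) \<subseteq> set (Q e)" using RE(5) by (simp add: Q'_def)
  qed
  have "verts Gs - model_verts J f' I' = Some ` (L - U)"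
  proof -
    have "None \<in> f' ` verts J" using f'z z(1) by (metis imageI)
    then have "None \<in> model_verts J f' I'" by (simp add: model_verts_def)
    moreover have "Some y \<in> model_verts J f' I' \<longleftrightarrow> y \<in> U" if y: "y \<in> L" for y
    proof -
      have "Some y \<in> f' ` verts J \<longleftrightarrow> y \<in> f ` verts J"
      proof
        assume "Some y \<in> f' ` verts J"
        then show "y \<in> f ` verts J" by (auto simp: f'_def split: if_splits)
      next
        assume "y \<in> f ` verts J"
        then obtain v where v: "v \<in> verts J" "y = f v" by blast
        then have "v \<noteq> z" using y fz(1) by auto
        then show "Some y \<in> f' ` verts J" using v f'_ne by (metis imageI)
      qed
      moreover have "Some y \<in> set (I' e) \<longleftrightarrow> y \<in> set (I e)" for e
      proof (cases "e \<in> A")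
        case True
        have "y \<notin> set (fst (p e))" using RE(2)[OF True] y by blast
        then have "y \<in> set (I e) \<longleftrightarrow> y \<in> set (R e)" unfolding RE(1)[OF True] by simp
        then show ?thesis using True by (auto simp: I'_def)
      qed (auto simp: I'_def)
      ultimately show ?thesis by (simp add: model_verts_def)
    qed
    ultimately show ?thesis by (auto simp: verts_shrink split: if_splits)
  qed
  then show ?thesis unfolding based_iff_model[OF J o] using m' pmatch_shrink_met[OF L] by metis
qed

end

section \<open>Both directions together\<close>

lemma (in shrinking) based_push_inside:
  assumes J: "finite_loopless J" and o: "orientation J s t" and m: "model G J s t f I Q"
    and inside: "model_verts J f I \<subseteq> L" and M: "pmatch G (verts G - model_verts J f I) M"
    and c: "Y = {} \<or> card (M \<inter> cut G L) = 1"
  shows "based J Gs"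
proof -
  let ?U = "model_verts J f I"
  have fL: "f v \<in> L" if "v \<in> verts J" for v using inside that by (auto simp: model_verts_def)
  have IL: "set (I e) \<subseteq> L" if "e \<in> edges J" for e using inside that by (auto simp: model_verts_def)
  have m': "model Gs J s t (\<lambda>v. Some (f v)) (\<lambda>e. map Some (I e)) Q"
  proof (rule model_push[OF m])
    show "inj_on (\<lambda>v. Some (f v)) (verts J)" using modelD(1)[OF m] by (simp add: inj_on_def)
    show "Some (f v) \<in> verts Gs" if "v \<in> verts J" for v using fL[OF that] by (simp add: verts_shrink)
    fix e assume e: "e \<in> edges J"
    let ?l = "f (s e) # I e @ [f (t e)]"
    have "set ?l \<subseteq> L" using IL[OF e] fL orientationD(2,3)[OF J o e] by simp
    then have "is_path Gs (map Some ?l) (Q e)" using shrink_path modelD(3)[OF m e] by blast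
    then show "is_path Gs (Some (f (s e)) # map Some (I e) @ [Some (f (t e))]) (Q e)" by simp
    show "even (length (map Some (I e)))" using modelD(4)[OF m e] by simp
  qed auto
  have mv: "model_verts J (\<lambda>v. Some (f v)) (\<lambda>e. map Some (I e)) = Some ` ?U"
    by (auto simp: model_verts_def)
  \<comment> \<open>The only edge of \<open>M\<close> in the cut covers \<open>None\<close>; for
    empty \<open>Y\<close> there is no such vertex.\<close>
  have "\<exists>N. pmatch Gs (verts Gs - Some ` ?U) N"
  proof (cases "Y = {}")
    case True
    then have "verts G - ?U = L - ?U" using L_sub by blast
    moreover have "verts Gs - Some ` ?U = Some ` (L - ?U)" using True by (auto simp: verts_shrink)
    ultimately show ?thesis using M pmatch_shrink[of "L - ?U" M] by auto
  next
    case False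
    then have "verts Gs - Some ` ?U = insert None (Some ` ((verts G - ?U) \<inter> L))"
      using L_sub by (auto simp: verts_shrink)
    moreover have "Y \<subseteq> verts G - ?U" using inside by blast
    ultimately show ?thesis using pmatch_shrink_NoneI[OF M _ Diff_subset] c False by simp
  qed
  then show ?thesis unfolding based_iff_model[OF J o] using m' mv by metis
qed

lemma (in odd_blobs) based_shrink:
  assumes J: "finite_loopless J" and bic: "bicritical J" and cub: "cubic J"
    and based: "based J G" and nonempty: "Ks \<noteq> {}"
  shows "\<exists>L\<in>Ks. based J (shrink G (verts G - L))"
proof -
  obtain s t where o: "orientation J s t" using orientation_from[OF J] by metis
  obtain f I Q M where m: "model G J s t f I Q" and M: "pmatch G (verts G - model_verts J f I) M"
    using based unfolding based_iff_model[OF J o] by blast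
  show ?thesis
  proof (cases "\<exists>L\<in>Ks. model_verts J f I \<subseteq> L")
    case True
    then obtain L where L: "L \<in> Ks" "model_verts J f I \<subseteq> L" by blast
    have L_sub: "L \<subseteq> verts G" using blob_subset[OF L(1)] by blast
    interpret shrinking G L by (rule shrinking.intro[OF G L_sub])
    obtain F where F: "pmatch J (verts J - {}) F"
      using bic unfolding bicritical_def has_perfect_matching_def perfect_matching_iff_pmatch[OF J] by auto
    obtain N where N: "pmatch G (model_verts J f I) N" using model_pmatch[OF J o m _ F] by auto
    have "pmatch G (model_verts J f I \<union> (verts G - model_verts J f I)) (N \<union> M)"
      by (rule pmatch_Un[OF N M]) blast
    moreover have "model_verts J f I \<union> (verts G - model_verts J f I) = verts G" using L(2) L_sub by blast
    ultimately have "card ((N \<union> M) \<inter> cut G L) = 1" using pmatch_cut_blob[OF _ L(1)] by simp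
    \<comment> \<open>\<open>N\<close> stays inside \<open>L\<close>, so the one matching edge that
      leaves \<open>L\<close> belongs to \<open>M\<close>.\<close>
    moreover have "N \<inter> cut G L = {}" using pmatchD(2)[OF N] L(2) by (auto simp: cut_def)
    then have "(N \<union> M) \<inter> cut G L = M \<inter> cut G L" by blast
    ultimately have "based J Gs" using based_push_inside[OF J o m L(2) M] by simp
    then show ?thesis using L(1) by blast
  next
    case False
    \<comment> \<open>An empty model would lie inside any blob, and there is one.\<close>
    have J_nonempty: "verts J \<noteq> {}"
    proof
      assume "verts J = {}"
      then have "edges J = {}" using orientationD(2)[OF J o] by blast
      then have "model_verts J f I = {}" using \<open>verts J = {}\<close> by (simp add: model_verts_def)
      then show False using False nonempty by blast
    qed
    \<comment> \<open>Stated for every orientation: \<open>z\<close> is found through a first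
      interpretation, and the branch case then needs the paths at \<open>z\<close> to start
      there.\<close>
    have bm: "blob_model G B Ks J s' t' f I' Q' M"
      if "orientation J s' t'" "model G J s' t' f I' Q'" "model_verts J f I' = model_verts J f I" for s' t' I' Q'
      using that J bic cub M False J_nonempty by unfold_locales auto
    interpret blob_model G B Ks J s t f I Q M by (rule bm[OF o m refl])
    show ?thesis
    proof (cases rule: branch_blob)
      case (inner L)
      then show ?thesis using shrink_inner_based[OF inner] by (auto simp: met_def)
    next
      case (branch L z)
      obtain s' t' where o': "orientation J s' t'" and sz: "\<And>e. e \<in> edges J \<Longrightarrow> z \<in> ends J e \<Longrightarrow> s' e = z"
        using orientation_from[OF J, of z] by metis
      obtain I' Q' where m': "model G J s' t' f I' Q'" and mv: "model_verts J f I' = model_verts J f I"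
        using model_reorient[OF J o o' m] .
      interpret re: blob_model G B Ks J s' t' f I' Q' M by (rule bm[OF o' m' mv])
      have L: "L \<in> re.met" using branch(1) by (simp add: met_def re.met_def mv)
      have "card (re.crossing L) \<le> 3" using re.crossing_le[OF L] card_B_branch by linarith
      from re.shrink_branch_based[OF L branch(2,3,4) this sz]
      have "based J (shrink G (verts G - L))" .
      then show ?thesis using branch(1) by (auto simp: met_def)
    qed
  qed
qed

theorem theorem25:
  fixes G :: "('a, 'e) mgraph" and B :: "'a set" and J :: "('b, 'f) mgraph"
  assumes "finite_loopless G" and "matching_covered G" and "barrier G B"
    and "finite_loopless J" and "bicritical J" and "cubic J"
  shows "free_of J G \<longleftrightarrow>
    (\<forall>L\<in>components (delete_verts G B). free_of J (shrink G (verts G - verts L)))"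
proof -
  define Ks where "Ks = reach G B ` (verts G - B)"
  have Ks: "verts ` components (delete_verts G B) = Ks" unfolding Ks_def by (rule verts_components)
  have "based J G \<longleftrightarrow> (\<exists>L\<in>Ks. based J (shrink G (verts G - L)))"
  proof (cases "B = {} \<and> Ks = {verts G}")
    \<comment> \<open>Trivial barrier: nothing is shrunk, no vertex \<open>None\<close> arises, and
      the shrunken graph is a copy of \<open>G\<close> under \<open>Some\<close>.\<close>
    case True
    interpret shrinking G "verts G" by (rule shrinking.intro[OF assms(1) subset_refl])
    obtain s t where o: "orientation J s t" using orientation_from[OF assms(4)] by metis
    have "based J G \<longleftrightarrow> based J (shrink G (verts G - verts G))"
    proof
      assume "based J G"
      then obtain f I Q M where m: "model G J s t f I Q" and M: "pmatch G (verts G - model_verts J f I) M"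
        unfolding based_iff_model[OF assms(4) o] by blast
      show "based J (shrink G (verts G - verts G))"
        by (rule based_push_inside[OF assms(4) o m model_verts_subset[OF m] M]) simp
    next
      assume "based J (shrink G (verts G - verts G))"
      then obtain f I Q M where m: "model Gs J s t f I Q" and M: "pmatch Gs (verts Gs - model_verts J f I) M"
        unfolding based_iff_model[OF assms(4) o] by blast
      have "None \<notin> model_verts J f I" using model_verts_subset[OF m] unfolding verts_shrink by auto
      then show "based J G"
        by (rule based_lift_avoiding[OF assms(4) o m _ M]) simp
    qed
    then show ?thesis using True by simp
  next
    case False
    then interpret odd_blobs G B Ks using barrier_blobs[OF assms(1-3)] unfolding Ks_def by blast
    have "Ks \<noteq> {}"
    proof
      assume "Ks = {}"
      then have "B = {}" using card_Ks finite_B by simp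
      then have "verts G = {}" using Union_Ks \<open>Ks = {}\<close> by simp
      then show False using assms(2) by (simp add: matching_covered_def)
    qed
    then show ?thesis
      using based_shrink[OF assms(4-6)] based_from_shrink[OF assms(4,6)] by blast
  qed
  then show ?thesis unfolding Ks[symmetric] free_of_def by simp
qed

end
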